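(* There is an isomorphism $\psi:B_8\to C_8$ of classical crystals, where $B_8$ is the level $1$ perfect crystal of Benkart–Frenkel–Kang–Lee in type $E_8^{(1)}$ and $C_8$ is the classical crystal of equivalence classes of Young columns in type $E_8^{(1)}$.
   Context: **Notation.** $\hat{\mathfrak g}$ is of type $E_8^{(1)}$, $I=\{0,\dots,8\}$, simple roots $\alpha_i$, coroots $h_i$, fundamental weights $\Lambda_i$, null root $\delta$, $\overline P=\bigoplus_i\mathbb Z\Lambda_i$ viewed as the quotient of the affine weight lattice by $\mathbb Z\delta$. Dynkin diagram (Bourbaki): chain $0-8-7-6-5-4-3-1$ together with $4-2$. **Classical crystals.** A classical crystal is a set $B$ with maps $\tilde e_i,\tilde f_i:B\to B\sqcup\{0\}$, $\varepsilon_i,\varphi_i:B\to\mathbb Z\cup\{-\infty\}$ ($i\in I$) and $\mathrm{wt}:B\to\overline P$ such that $\varphi_i(b)-\varepsilon_i(b)=\langle h_i,\mathrm{wt}(b)\rangle$; if $\tilde e_ib\in B$ then $\mathrm{wt},\varepsilon_i,\varphi_i$ change by $+\alpha_i,-1,+1$; if $\tilde f_ib\in B$ they change by $-\alpha_i,+1,-1$; $\tilde f_ib=b'$ iff $b=\tilde e_ib'$; $\varphi_i(b)=-\infty$ implies $\tilde e_ib=\tilde f_ib=0$. An isomorphism is a bijection (extended by $0\mapsto0$) preserving $\mathrm{wt},\varepsilon_i,\varphi_i$ and commuting with all $\tilde e_i,\tilde f_i$. **$B_8$.** Its elements are $x_\alpha$ ($\alpha$ a root of $E_8$), $y_i$ ($i\in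 I\setminus\{0\}$) and $\emptyset$. With $\theta$ the highest root and $b\xrightarrow{i}b'$ meaning $\tilde f_ib=b'$, the arrows are: $x_\alpha\xrightarrow{i}x_{\alpha-\alpha_i}$ if $i\ne0$ and $\alpha,\alpha-\alpha_i$ are roots; $x_{\alpha_i}\xrightarrow{i}y_i\xrightarrow{i}x_{-\alpha_i}$ for $i\ne0$; $x_\alpha\xrightarrow{0}x_{\alpha+\theta}$ if $\alpha,\alpha+\theta$ are roots different from $\pm\theta$; $x_{-\theta}\xrightarrow{0}\emptyset\xrightarrow{0}x_\theta$. $\varepsilon_i,\varphi_i$ are the distances to the start and end of the $i$-string, and $\mathrm{wt}(b)=\sum_i(\varphi_i(b)-\varepsilon_i(b))\Lambda_i$. **Young column pattern.** An infinite vertical strip of unit cubes indexed by $k\in\mathbb Z$ (height increasing with $k$), each cut by vertical cuts into blocks coloured by $I$. The horizontal cross-section of every cube is a grid with $6$ columns of cells (numbered $1,\dots,6$ from left to right) and two rows (upper, lower). A block is the full-height prism over a union of cells. Write $u/l$ for a cross-section whose upper row has colours $u$ and lower row has colours $l$ (just $u$ if both rows agree); equally coloured cells of one cube form a single block, except that a cube $444444$ consists of two $4$-blocks, one over cell columns 1–3 and one over cell columns 4–6. Rotation by $180^\circ$ sends $u/l$ to $\mathrm{rev}(l)/\mathrm{rev}(u)$, where rev reverses a word. The pattern has period 20: cubes $1,\dots,10$ are $775522/075552$; $866444$; $755533/775533$; $664441$; $552233/555233$; $444444$; $332555/332255$; $144466$; $335577/335557$; $444668$; and cube $k+10$ is the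 rotation of cube $k$ for all $k$. **Young columns.** A Young column is a nonempty collection of blocks of the pattern of bounded height with no empty space below any block (if a block of cube $k$ belongs to it, so does every block of cube $k-1$ lying below at least one of its cells), or a member of one of two further equivalence classes, those of: (S1) all blocks of cubes $k\le4$, the $5$- and $3$-blocks of cube 5, and the $4$-block over cell columns 4–6 of cube 6; (S2) all blocks of cubes $k\le5$, the $4$-block over cell columns 4–6 of cube 6, and the $2$-block of cube 7. Young columns are equivalent if obtained from one another by vertical translation and/or rotation by $180^\circ$ about the vertical axis. An $i$-block of a Young column is removable if removing it leaves a Young column; an $i$-block not in it is addable if adding it gives a Young column. $\tilde f_i$ adds an addable $i$-block if one exists and gives $0$ otherwise; $\tilde e_i$ removes a removable $i$-block if one exists and gives $0$ otherwise; with these rules: (a) if there are two addable $i$-blocks, $\tilde f_i$ adds the higher one if $i\ne4$ and the one lying on top of a $5$-block if $i=4$; if there are two removable $i$-blocks, $\tilde e_i$ removes the lower one if $i\ne4$ and the one lying on top of a $3$-block if $i=4$; (b) if a Young column $y$ is obtained by adding (resp. removing) an $i$-block to (from) some other Young column under these rules and $y$ itself has an addable (resp. removable) $i$-block, then $\tilde f_j(y)=\tilde e_j(y)=0$ for all $j\ne i$. Put $\varphi_i(y)=\max\{m:\tilde f_i^my\neq0\}$, $\varepsilon_i(y)=\max\{m:\tilde e_i^my\neq0\}$. These descend to the set $C_8$ of equivalence classes, a classical crystal with $\mathrm{wt}(y)=\sum_i(\varphi_i(y)-\varepsilon_i(y))\Lambda_i$. *)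

theory Defs
  imports Main "HOL-Library.Extended" "HOL-Library.Function_Algebras"
begin

abbreviation idx :: "nat set" where
  "idx \<equiv> {0..8}"

definition dynkin_edges :: "nat set set" where
  "dynkin_edges = {{0,8}, {8,7}, {7,6}, {6,5}, {5,4}, {4,3}, {3,1}, {4,2}}"

text \<open>
  Bourbaki labelling of the Dynkin diagram of type \<open>E\<^sub>8\<^sup>(\<^sup>1\<^sup>)\<close>, with 0 the affine node. \<open>cartan i j\<close> is the
  pairing of the coroot \<open>h\<^sub>i\<close> with the simple root \<open>\<alpha>\<^sub>j\<close>.
\<close>

definition cartan :: "nat \<Rightarrow> nat \<Rightarrow> int" where
  "cartan i j = (if i = j then 2 else if {i, j} \<in> dynkin_edges then -1 else 0)"

text \<open>
  A classical weight, that is, an element of the affine weight lattice modulo the null root, is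
  the family of its coefficients with respect to the fundamental weights. The coefficient at
  \<open>i\<close> is its pairing with \<open>h\<^sub>i\<close>.
\<close>

type_synonym weight = "nat \<Rightarrow> int"

definition weight_lattice :: "weight set" where
  "weight_lattice = {w. \<forall>i. i \<notin> idx \<longrightarrow> w i = 0}"

definition alpha :: "nat \<Rightarrow> weight" where
  "alpha i = (\<lambda>j. if j \<in> idx then cartan j i else 0)"

text \<open>
  \<open>None\<close> plays the role of the extra element 0, and \<open>Minf\<close> that of \<open>-\<infinity>\<close>. The value \<open>Pinf\<close>,
  which the type \<^typ>\<open>int extended\<close> also provides, is excluded by the axioms.
\<close>

record 'b crystal =
  carrier :: "'b set"
  e_op :: "nat \<Rightarrow> 'b \<Rightarrow> 'b option"
  f_op :: "nat \<Rightarrow> 'b \<Rightarrow> 'b option"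
  eps :: "nat \<Rightarrow> 'b \<Rightarrow> int extended"
  phi :: "nat \<Rightarrow> 'b \<Rightarrow> int extended"
  wt :: "'b \<Rightarrow> weight"

definition classical_crystal :: "'b crystal \<Rightarrow> bool" where
  "classical_crystal B \<longleftrightarrow>
     (\<forall>b \<in> carrier B. wt B b \<in> weight_lattice) \<and>
     (\<forall>i \<in> idx. \<forall>b \<in> carrier B.
        eps B i b \<noteq> Pinf \<and> phi B i b \<noteq> Pinf \<and>
        phi B i b = eps B i b + Fin (wt B b i) \<and>
        (\<forall>b'. e_op B i b = Some b' \<longrightarrow>
           b' \<in> carrier B \<and> wt B b' = wt B b + alpha i \<and>
           eps B i b' = eps B i b - Fin 1 \<and> phi B i b' = phi B i b + Fin 1) \<and>
        (\<forall>b'. f_op B i b = Some b' \<longrightarrow>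
           b' \<in> carrier B \<and> wt B b' = wt B b - alpha i \<and>
           eps B i b' = eps B i b + Fin 1 \<and> phi B i b' = phi B i b - Fin 1) \<and>
        (\<forall>b' \<in> carrier B. f_op B i b = Some b' \<longleftrightarrow> e_op B i b' = Some b) \<and>
        (phi B i b = Minf \<longrightarrow> e_op B i b = None \<and> f_op B i b = None))"

definition crystal_iso :: "('b \<Rightarrow> 'c) \<Rightarrow> 'b crystal \<Rightarrow> 'c crystal \<Rightarrow> bool" where
  "crystal_iso \<psi> B C \<longleftrightarrow>
     bij_betw \<psi> (carrier B) (carrier C) \<and>
     (\<forall>b \<in> carrier B. wt C (\<psi> b) = wt B b) \<and>
     (\<forall>i \<in> idx. \<forall>b \<in> carrier B.
        eps C i (\<psi> b) = eps B i b \<and>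
        phi C i (\<psi> b) = phi B i b \<and>
        e_op C i (\<psi> b) = map_option \<psi> (e_op B i b) \<and>
        f_op C i (\<psi> b) = map_option \<psi> (f_op B i b))"

definition string_length :: "('b \<Rightarrow> 'b option) \<Rightarrow> 'b \<Rightarrow> nat" where
  "string_length g b = Max {m. ((\<lambda>x. Option.bind x g) ^^ m) (Some b) \<noteq> None}"

text \<open>A root of \<open>E\<^sub>8\<close> is the family of its coefficients with respect to the simple roots.\<close>

type_synonym root = "nat \<Rightarrow> int"

definition simple_root :: "nat \<Rightarrow> root" where
  "simple_root i = (\<lambda>j. if j = i then 1 else 0)"

definition reflect :: "nat \<Rightarrow> root \<Rightarrow> root" where
  "reflect i \<alpha> = (\<lambda>j. \<alpha> j - (\<Sum>k=1..8. cartan i k * \<alpha> k) * simple_root i j)"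

inductive_set roots :: "root set" where
  simple: "i \<in> {1..8} \<Longrightarrow> simple_root i \<in> roots"
| reflect: "\<alpha> \<in> roots \<Longrightarrow> i \<in> {1..8} \<Longrightarrow> reflect i \<alpha> \<in> roots"

definition highest_root :: root where
  "highest_root = (THE \<theta>. \<theta> \<in> roots \<and> (\<forall>\<beta> \<in> roots. \<forall>j. \<beta> j \<le> \<theta> j))"

datatype b8 = X root | Y nat | Empty

inductive arrow :: "nat \<Rightarrow> b8 \<Rightarrow> b8 \<Rightarrow> bool" where
  "i \<in> {1..8} \<Longrightarrow> \<alpha> \<in> roots \<Longrightarrow> \<alpha> - simple_root i \<in> roots \<Longrightarrow>
     arrow i (X \<alpha>) (X (\<alpha> - simple_root i))"
| "i \<in> {1..8} \<Longrightarrow> arrow i (X (simple_root i)) (Y i)"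
| "i \<in> {1..8} \<Longrightarrow> arrow i (Y i) (X (- simple_root i))"
| "\<alpha> \<in> roots - {highest_root, - highest_root} \<Longrightarrow>
     \<alpha> + highest_root \<in> roots - {highest_root, - highest_root} \<Longrightarrow>
     arrow 0 (X \<alpha>) (X (\<alpha> + highest_root))"
| "arrow 0 (X (- highest_root)) Empty"
| "arrow 0 Empty (X highest_root)"

definition B8_f :: "nat \<Rightarrow> b8 \<Rightarrow> b8 option" where
  "B8_f i b = (if \<exists>b'. arrow i b b' then Some (THE b'. arrow i b b') else None)"

definition B8_e :: "nat \<Rightarrow> b8 \<Rightarrow> b8 option" where
  "B8_e i b = (if \<exists>b'. arrow i b' b then Some (THE b'. arrow i b' b) else None)"

definition B8 :: "b8 crystal" where
  "B8 = \<lparr>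
     carrier = X ` roots \<union> Y ` {1..8} \<union> {Empty},
     e_op = B8_e,
     f_op = B8_f,
     eps = (\<lambda>i b. Fin (int (string_length (B8_e i) b))),
     phi = (\<lambda>i b. Fin (int (string_length (B8_f i) b))),
     wt = (\<lambda>b i. if i \<in> idx
        then int (string_length (B8_f i) b) - int (string_length (B8_e i) b) else 0)\<rparr>"

type_synonym cross_section = "nat list \<times> nat list"

text \<open>
  The upper and the lower row of the cross-sections of the cubes 1 to 10, each read from left to
  right.
\<close>

definition base_pattern :: "cross_section list" where
  "base_pattern =
    [([7,7,5,5,2,2], [0,7,5,5,5,2]),
     ([8,6,6,4,4,4], [8,6,6,4,4,4]),
     ([7,5,5,5,3,3], [7,7,5,5,3,3]),
     ([6,6,4,4,4,1], [6,6,4,4,4,1]),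
     ([5,5,2,2,3,3], [5,5,5,2,3,3]),
     ([4,4,4,4,4,4], [4,4,4,4,4,4]),
     ([3,3,2,5,5,5], [3,3,2,2,5,5]),
     ([1,4,4,4,6,6], [1,4,4,4,6,6]),
     ([3,3,5,5,7,7], [3,3,5,5,5,7]),
     ([4,4,4,6,6,8], [4,4,4,6,6,8])]"

definition rotate_section :: "cross_section \<Rightarrow> cross_section" where
  "rotate_section s = (rev (snd s), rev (fst s))"

definition section_of :: "int \<Rightarrow> cross_section" where
  "section_of k =
     (let r = nat ((k - 1) mod 20)
      in if r < 10 then base_pattern ! r else rotate_section (base_pattern ! (r - 10)))"

datatype row = Upper | Lower

type_synonym cell = "row \<times> nat"

definition cells :: "cell set" where
  "cells = UNIV \<times> {1..6}"

fun cell_colour :: "int \<Rightarrow> cell \<Rightarrow> nat" where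
  "cell_colour k (Upper, c) = fst (section_of k) ! (c - 1)"
| "cell_colour k (Lower, c) = snd (section_of k) ! (c - 1)"

text \<open>A block consists of the index of its cube, the cells it lies over, and its colour.\<close>

type_synonym block = "int \<times> cell set \<times> nat"

abbreviation cube :: "block \<Rightarrow> int" where "cube b \<equiv> fst b"
abbreviation base :: "block \<Rightarrow> cell set" where "base b \<equiv> fst (snd b)"
abbreviation colour :: "block \<Rightarrow> nat" where "colour b \<equiv> snd (snd b)"

definition blocks :: "block set" where
  "blocks =
     {(k, S, i) | k S i. (\<exists>p \<in> cells. cell_colour k p \<noteq> 4) \<and>
        S = {p \<in> cells. cell_colour k p = i} \<and> S \<noteq> {}} \<union>
     {(k, S, 4) | k S. (\<forall>p \<in> cells. cell_colour k p = 4) \<and>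
        (S = UNIV \<times> {1..3} \<or> S = UNIV \<times> {4..6})}"

definition directly_below :: "block \<Rightarrow> block \<Rightarrow> bool" where
  "directly_below c b \<longleftrightarrow> c \<in> blocks \<and> cube c = cube b - 1 \<and> base c \<inter> base b \<noteq> {}"

text \<open>\<open>move n r\<close> is the translation by \<open>n\<close> cubes, followed by the half-turn if \<open>r\<close> holds.\<close>

definition rotate_cell :: "cell \<Rightarrow> cell" where
  "rotate_cell p = (case fst p of Upper \<Rightarrow> Lower | Lower \<Rightarrow> Upper, 7 - snd p)"

definition move :: "int \<Rightarrow> bool \<Rightarrow> block \<Rightarrow> block" where
  "move n r b = (cube b + n, if r then rotate_cell ` base b else base b, colour b)"

definition congruent_columns :: "block set \<Rightarrow> block set \<Rightarrow> bool" where
  "congruent_columns y z \<longleftrightarrow> (\<exists>n r. z = move n r ` y)"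

definition ordinary_column :: "block set \<Rightarrow> bool" where
  "ordinary_column y \<longleftrightarrow>
     y \<noteq> {} \<and> y \<subseteq> blocks \<and> (\<exists>N. \<forall>b \<in> y. cube b \<le> N) \<and>
     (\<forall>b \<in> y. \<forall>c. directly_below c b \<longrightarrow> c \<in> y)"

definition S1 :: "block set" where
  "S1 = {b \<in> blocks. cube b \<le> 4 \<or> (cube b = 5 \<and> colour b \<in> {5, 3}) \<or>
     (cube b = 6 \<and> base b = UNIV \<times> {4..6})}"

definition S2 :: "block set" where
  "S2 = {b \<in> blocks. cube b \<le> 5 \<or> (cube b = 6 \<and> base b = UNIV \<times> {4..6}) \<or>
     (cube b = 7 \<and> colour b = 2)}"

definition young_column :: "block set \<Rightarrow> bool" where
  "young_column y \<longleftrightarrow>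
     ordinary_column y \<or>
     (y \<subseteq> blocks \<and> (congruent_columns S1 y \<or> congruent_columns S2 y))"

definition addable :: "nat \<Rightarrow> block set \<Rightarrow> block set" where
  "addable i y = {b \<in> blocks - y. colour b = i \<and> young_column (insert b y)}"

definition removable :: "nat \<Rightarrow> block set \<Rightarrow> block set" where
  "removable i y = {b \<in> y. colour b = i \<and> young_column (y - {b})}"

definition on_top_of :: "nat \<Rightarrow> block \<Rightarrow> bool" where
  "on_top_of i b \<longleftrightarrow> (\<exists>c. directly_below c b \<and> colour c = i)"

definition add_choice :: "nat \<Rightarrow> block set \<Rightarrow> block" where
  "add_choice i y = (THE b. b \<in> addable i y \<and>
     (\<forall>c \<in> addable i y. c \<noteq> b \<longrightarrow> (if i = 4 then on_top_of 5 b else cube c < cube b)))"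

definition remove_choice :: "nat \<Rightarrow> block set \<Rightarrow> block" where
  "remove_choice i y = (THE b. b \<in> removable i y \<and>
     (\<forall>c \<in> removable i y. c \<noteq> b \<longrightarrow> (if i = 4 then on_top_of 3 b else cube b < cube c)))"

definition add_block :: "nat \<Rightarrow> block set \<Rightarrow> block set option" where
  "add_block i y =
     (if addable i y = {} then None else Some (insert (add_choice i y) y))"

definition remove_block :: "nat \<Rightarrow> block set \<Rightarrow> block set option" where
  "remove_block i y =
     (if removable i y = {} then None else Some (y - {remove_choice i y}))"

text \<open>
  A column in the middle of an \<open>i\<close>-string, for which the operators of all other colours are
  declared to vanish. Whether a column arises by adding or removing an \<open>i\<close>-block is decided by
  \<open>add_block\<close> and \<open>remove_block\<close>, that is, by the rule for choosing between two blocks alone;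
  referring to \<open>column_f\<close> and \<open>column_e\<close> instead would be circular.
\<close>

definition reserved :: "nat \<Rightarrow> block set \<Rightarrow> bool" where
  "reserved i y \<longleftrightarrow>
     (\<exists>z. young_column z \<and> add_block i z = Some y) \<and> addable i y \<noteq> {} \<or>
     (\<exists>z. young_column z \<and> remove_block i z = Some y) \<and> removable i y \<noteq> {}"

definition column_f :: "nat \<Rightarrow> block set \<Rightarrow> block set option" where
  "column_f j y = (if \<exists>i \<in> idx - {j}. reserved i y then None else add_block j y)"

definition column_e :: "nat \<Rightarrow> block set \<Rightarrow> block set option" where
  "column_e j y = (if \<exists>i \<in> idx - {j}. reserved i y then None else remove_block j y)"

definition column_equiv :: "(block set \<times> block set) set" where
  "column_equiv = {(y, z). young_column y \<and> young_column z \<and> congruent_columns y z}"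

text \<open>
  A function on Young columns which is constant on equivalence classes descends to the classes by
  taking the only element of the image of a class.
\<close>

definition descend :: "(block set \<Rightarrow> 'a) \<Rightarrow> block set set \<Rightarrow> 'a" where
  "descend g Q = the_elem (g ` Q)"

definition C8_op ::
  "(block set \<Rightarrow> block set option) \<Rightarrow> block set set \<Rightarrow> block set set option" where
  "C8_op g = descend (\<lambda>y. map_option (\<lambda>z. column_equiv `` {z}) (g y))"

definition C8 :: "block set set crystal" where
  "C8 = \<lparr>
     carrier = Collect young_column // column_equiv,
     e_op = (\<lambda>i. C8_op (column_e i)),
     f_op = (\<lambda>i. C8_op (column_f i)),
     eps = (\<lambda>i. descend (\<lambda>y. Fin (int (string_length (column_e i) y)))),
     phi = (\<lambda>i. descend (\<lambda>y. Fin (int (string_length (column_f i) y)))),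
     wt = descend (\<lambda>y i. if i \<in> idx
        then int (string_length (column_f i) y) - int (string_length (column_e i) y) else 0)\<rparr>"

end

theory Submission
  imports Defs
begin

text \<open>
  Numbering the blocks by integers turns a Young column, up to the half-turn with translation by
  ten cubes, into a down-closed set \<open>{..<m} \<union> T\<close> of integers taken modulo shifts by 30. There are
  247 such sets, and with the two special columns they match the 240 roots and the nine weight
  zero vertices. The matching is given by the content: a constant minus the sum of the simple
  roots of the blocks of a column, computed modulo the null root. Adding an \<open>i\<close>-block subtracts
  \<open>\<alpha>\<^sub>i\<close> from the content, so the arrows agree as soon as every column with content \<open>\<alpha> \<noteq> 0\<close> has an
  \<open>i\<close>-block to add exactly when \<open>\<langle>h\<^sub>i, \<alpha>\<rangle> > 0\<close> and one to remove exactly when \<open>\<langle>h\<^sub>i, \<alpha>\<rangle> < 0\<close>,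
  and as soon as the strings of length two pass through the nine columns of content zero; this is
  checked for each of the columns. That columns of equal content are equivalent, and that the
  contents are the roots, then follows by moving along arrows to the simple roots.
\<close>

section \<open>A numbering of the blocks\<close>

text \<open>Thirty is the height of the null root: ten cubes contain each colour as often as its
  mark, so a full period leaves the content unchanged, and the symmetry of the pattern becomes the
  shift by 30. Only finitely many sets arise modulo shifts because a block missing from an ordinary
  column excludes every block more than 30 numbers above it (\<open>vanishing_above\<close>); the
  first missing number \<open>m\<close>, taken modulo 30, and a bounded list \<open>T\<close> then
  describe the column. The special columns have content plus and minus the simple root of node 2,
  which no ordinary column has: they supply the ends of the 2-string. The delicate content is zero.
  Nine inequivalent columns share it, some with addable blocks of several colours, and the rules for
  choosing blocks and for vanishing operators decide which string passes through which of them; the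
  table \<open>middles\<close> records the outcome. The 240 roots are never listed: they are
  generated by reflections and identified with the nonzero contents by induction in both directions.
  The crystal axioms are proved for \<open>B8\<close> only and carried over to \<open>C8\<close>
  along the isomorphism.\<close>

text \<open>
  The blocks are numbered by the integers from bottom to top, thirty to every ten cubes, so that
  block \<open>n + 30\<close> is block \<open>n\<close> raised by ten cubes and rotated. The numbers 0 to 29 are given to
  the cubes 1 to 10, and within a cube in the order in which the colours first occur in
  \<open>base_pattern\<close>; \<open>depth_table\<close> gives the differences between a number and those of the
  blocks directly below.
\<close>

definition cube_table :: "int list" where
  "cube_table = [1, 1, 1, 1, 2, 2, 2, 3, 3, 3, 4, 4, 4, 5, 5, 5, 6, 6, 7, 7, 7, 8, 8, 8,
     9, 9, 9, 10, 10, 10]"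

definition colour_table :: "nat list" where
  "colour_table = [7, 5, 2, 0, 8, 6, 4, 7, 5, 3, 6, 4, 1, 5, 2, 3, 4, 4, 3, 2, 5, 1, 4, 6,
     3, 5, 7, 4, 6, 8]"

definition depth_table :: "int list list" where
  "depth_table = [[2,1], [4,3], [5], [4], [4,1], [5,4], [5,4], [3,2], [3,2], [3], [3,2], [3,2],
     [3], [3,2], [3], [4,3], [3,2], [3,2], [2], [3,2], [3], [3], [4,3,2], [3], [3,2], [3,2], [3],
     [3,2], [3,2], [3]]"

definition level :: "int \<Rightarrow> int" where
  "level n = 10 * (n div 30) + cube_table ! nat (n mod 30)"

definition colr :: "int \<Rightarrow> nat" where
  "colr n = colour_table ! nat (n mod 30)"

definition lowers :: "int \<Rightarrow> int list" where
  "lowers n = map (\<lambda>d. n - d) (depth_table ! nat (n mod 30))"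

definition rot :: "int \<Rightarrow> cell \<Rightarrow> cell" where
  "rot q p = (if odd q then rotate_cell p else p)"

text \<open>These motions preserve the pattern, since cube k + 10 is cube k rotated. On block
  numbers they act as the shift by \<open>30 * q\<close> (\<open>turn_blk\<close>).\<close>

definition turn :: "int \<Rightarrow> block \<Rightarrow> block" where
  "turn q b = (cube b + 10 * q, rot q ` base b, colour b)"

definition base_block :: "nat \<Rightarrow> block" where
  "base_block r = (cube_table ! r,
     if r = 16 then UNIV \<times> {1..3} else if r = 17 then UNIV \<times> {4..6}
     else {p \<in> cells. cell_colour (cube_table ! r) p = colour_table ! r},
     colour_table ! r)"

definition blk :: "int \<Rightarrow> block" where
  "blk n = turn (n div 30) (base_block (nat (n mod 30)))"

lemma table_simps:
  "level 0 = 1" "level 1 = 1" "level 2 = 1" "level 3 = 1" "level 4 = 2" "level 5 = 2"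
  "level 6 = 2" "level 7 = 3" "level 8 = 3" "level 9 = 3" "level 10 = 4" "level 11 = 4"
  "level 12 = 4" "level 13 = 5" "level 14 = 5" "level 15 = 5" "level 16 = 6" "level 17 = 6"
  "level 18 = 7" "level 19 = 7" "level 20 = 7" "level 21 = 8" "level 22 = 8" "level 23 = 8"
  "level 24 = 9" "level 25 = 9" "level 26 = 9" "level 27 = 10" "level 28 = 10" "level 29 = 10"
  "colr 0 = 7" "colr 1 = 5" "colr 2 = 2" "colr 3 = 0" "colr 4 = 8" "colr 5 = 6"
  "colr 6 = 4" "colr 7 = 7" "colr 8 = 5" "colr 9 = 3" "colr 10 = 6" "colr 11 = 4"
  "colr 12 = 1" "colr 13 = 5" "colr 14 = 2" "colr 15 = 3" "colr 16 = 4" "colr 17 = 4"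
  "colr 18 = 3" "colr 19 = 2" "colr 20 = 5" "colr 21 = 1" "colr 22 = 4" "colr 23 = 6"
  "colr 24 = 3" "colr 25 = 5" "colr 26 = 7" "colr 27 = 4" "colr 28 = 6" "colr 29 = 8"
  "lowers 0 = [-2, -1]" "lowers 1 = [-3, -2]" "lowers 2 = [-3]" "lowers 3 = [-1]"
  "lowers 4 = [0, 3]" "lowers 5 = [0, 1]" "lowers 6 = [1, 2]" "lowers 7 = [4, 5]"
  "lowers 8 = [5, 6]" "lowers 9 = [6]" "lowers 10 = [7, 8]" "lowers 11 = [8, 9]"
  "lowers 12 = [9]" "lowers 13 = [10, 11]" "lowers 14 = [11]" "lowers 15 = [11, 12]"
  "lowers 16 = [13, 14]" "lowers 17 = [14, 15]" "lowers 18 = [16]" "lowers 19 = [16, 17]"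
  "lowers 20 = [17]" "lowers 21 = [18]" "lowers 22 = [18, 19, 20]" "lowers 23 = [20]"
  "lowers 24 = [21, 22]" "lowers 25 = [22, 23]" "lowers 26 = [23]" "lowers 27 = [24, 25]"
  "lowers 28 = [25, 26]" "lowers 29 = [26]"
  by (simp_all add: level_def colr_def lowers_def cube_table_def colour_table_def depth_table_def)

lemma level_shift [simp]: "level (n + 30 * q) = level n + 10 * q"
  and colr_shift [simp]: "colr (n + 30 * q) = colr n"
  and lowers_shift [simp]: "lowers (n + 30 * q) = map (\<lambda>x. x + 30 * q) (lowers n)"
  by (simp_all add: level_def colr_def lowers_def)

text \<open>Brings the arguments slightly outside 0 to 29 that occur in the finite checks back into
  the range of \<open>table_simps\<close>. The side conditions stop the rewriting there.\<close>

lemma period_simps: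
  "30 \<le> n \<Longrightarrow> colr n = colr (n - 30)"
  "30 \<le> n \<Longrightarrow> level n = level (n - 30) + 10"
  "30 \<le> n \<Longrightarrow> lowers n = map (\<lambda>x. x + 30) (lowers (n - 30))"
  "n < 0 \<Longrightarrow> colr n = colr (n + 30)"
  "n < 0 \<Longrightarrow> level n = level (n + 30) - 10"
  "n < 0 \<Longrightarrow> lowers n = map (\<lambda>x. x - 30) (lowers (n + 30))"
  using level_shift[of "n - 30" 1] colr_shift[of "n - 30" 1] lowers_shift[of "n - 30" 1]
    level_shift[of n 1] colr_shift[of n 1] lowers_shift[of n 1]
  by (simp_all add: comp_def)

abbreviation residues :: "int list" where
  "residues \<equiv> [0, 1, 2, 3, 4, 5, 6, 7, 8, 9, 10, 11, 12, 13, 14, 15, 16, 17, 18, 19, 20, 21, 22,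
     23, 24, 25, 26, 27, 28, 29]"

lemma residue_cases:
  fixes r :: int
  assumes "0 \<le> r" "r < 30"
  shows "r \<in> set residues"
proof -
  have "r \<in> set [0..29]" using assms by simp
  then show ?thesis by (simp add: upto.simps del: set_upto)
qed

lemma obtain_residue:
  fixes n :: int
  obtains r q where "n = r + 30 * q" "0 \<le> r" "r < 30"
  by (rule that[of "n mod 30" "n div 30"]) auto

lemma all_residues:
  fixes r :: int
  assumes "list_all P residues" and "0 \<le> r" "r < 30"
  shows "P r"
  using assms(1) residue_cases[OF assms(2,3)] unfolding list_all_iff by blast

text \<open>The 5 is the largest entry of \<open>depth_table\<close>, and the converse bound
  \<open>uppers_exist\<close> is read off the same table. All windows of width five in the
  enumeration rest on these two bounds.\<close>

lemma lowers_range: "x \<in> set (lowers n) \<Longrightarrow> n - 5 \<le> x \<and> x < n"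
  and lowers_nonempty: "lowers n \<noteq> []"
  and colr_idx: "colr n \<in> idx"
  and level_bounds: "10 * (n div 30) < level n" "level n \<le> 10 * (n div 30) + 10"
  and uppers_exist: "\<exists>a. n < a \<and> a \<le> n + 5 \<and> n \<in> set (lowers a)"
proof -
  obtain r q where n: "n = r + 30 * q" and r: "0 \<le> r" "r < 30"
    by (rule obtain_residue)
  have d: "n div 30 = q" using n r by simp
  have 1: "(\<forall>x\<in>set (lowers r). r - 5 \<le> x \<and> x < r) \<and> lowers r \<noteq> [] \<and> colr r \<in> idx \<and>
      0 < level r \<and> level r \<le> 10 \<and> (\<exists>a\<in>set [r+1, r+2, r+3, r+4, r+5]. r \<in> set (lowers a))"
    using _ r by (rule all_residues) (simp add: table_simps period_simps)
  then show "x \<in> set (lowers n) \<Longrightarrow> n - 5 \<le> x \<and> x < n" "lowers n \<noteq> []" "colr n \<in> idx"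
    "10 * (n div 30) < level n" "level n \<le> 10 * (n div 30) + 10"
    unfolding n by (auto simp: d[unfolded n])
  obtain a where "a \<in> set [r+1, r+2, r+3, r+4, r+5]" "r \<in> set (lowers a)" using 1 by blast
  then show "\<exists>a. n < a \<and> a \<le> n + 5 \<and> n \<in> set (lowers a)"
    unfolding n by (intro exI[of _ "a + 30 * q"]) auto
qed

section \<open>Half-turns and the periodicity of the pattern\<close>

lemma cells_eq: "cells = set (List.product [Upper, Lower] [1, 2, 3, 4, 5, 6])"
proof -
  have "(\<rho>, c) \<in> cells \<longleftrightarrow> (\<rho>, c) \<in> set (List.product [Upper, Lower] [1, 2, 3, 4, 5, 6])"
    for \<rho> c
  proof -
    have "{1..6::nat} = {1, 2, 3, 4, 5, 6}" by auto
    then show ?thesis by (cases \<rho>) (simp_all only: cells_def, simp_all)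
  qed
  from this[of "fst p" "snd p" for p] show ?thesis
    by (simp only: prod.collapse set_eq_iff) blast
qed

lemma rot_cells: "p \<in> cells \<Longrightarrow> rot q p \<in> cells"
  and rot_rot: "p \<in> cells \<Longrightarrow> rot q (rot q' p) = rot (q + q') p"
  by (cases p; cases "fst p"; auto simp: cells_def rot_def rotate_cell_def)+

lemma rot_self: "p \<in> cells \<Longrightarrow> rot q (rot q p) = p"
  using rot_rot[of p q q] by (simp add: rot_def)

lemma section_lengths: "length (fst (section_of k)) = 6" "length (snd (section_of k)) = 6"
proof -
  have "\<forall>s\<in>set base_pattern. length (fst s) = 6 \<and> length (snd s) = 6"
    by (simp add: base_pattern_def)
  moreover have "length base_pattern = 10" by (simp add: base_pattern_def)
  moreover have "nat ((k - 1) mod 20) < 20" by (simp add: nat_less_iff)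
  ultimately show "length (fst (section_of k)) = 6" "length (snd (section_of k)) = 6"
    by (auto simp: section_of_def Let_def rotate_section_def)
qed

lemma section_step: "section_of (k + 10) = rotate_section (section_of k)"
proof -
  define r where "r = (k - 1) mod 20"
  have r: "0 \<le> r" "r < 20" unfolding r_def by simp_all
  have s: "(k + 10 - 1) mod 20 = (r + 10) mod 20"
    using mod_add_left_eq[of "k - 1" 20 10] unfolding r_def by (simp only: diff_add_eq)
  show ?thesis
  proof (cases "r < 10")
    case True
    with r have "(r + 10) mod 20 = r + 10" by (intro mod_pos_pos_trivial) simp_all
    then have "nat ((k + 10 - 1) mod 20) = nat r + 10" using r s by (simp add: nat_add_distrib)
    moreover have "nat r < 10" using True by simp
    ultimately show ?thesis by (simp add: section_of_def Let_def r_def[symmetric])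
  next
    case False
    with r have "(r + 10) mod 20 = r - 10"
      using mod_pos_pos_trivial[of "r - 10" 20] mod_add_self2[of "r - 10" 20]
      by (simp add: add.commute)
    then have "nat ((k + 10 - 1) mod 20) = nat r - 10" using s False by (simp add: nat_diff_distrib)
    moreover have "nat r - 10 < 10" "\<not> nat r < 10" using r False by simp_all
    ultimately show ?thesis by (simp add: section_of_def Let_def rotate_section_def r_def[symmetric])
  qed
qed

lemma section_period: "section_of (k + 20 * j) = section_of k"
proof -
  have "(k + 20 * j - 1) mod 20 = (k - 1) mod 20"
    using mod_mult_self2[of "k - 1" 20 j] by (simp add: algebra_simps)
  then show ?thesis by (simp only: section_of_def)
qed

text \<open>An even \<open>q\<close> moves by full periods of 20 cubes. An odd \<open>q\<close>
  leaves one rotation over: the rows are exchanged and reversed, which the half-turn of the cell,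
  sending column c to 7 - c, undoes.\<close>

lemma cell_colour_rot:
  assumes p: "p \<in> cells"
  shows "cell_colour (k + 10 * q) (rot q p) = cell_colour k p"
proof (cases "even q")
  case True
  then obtain j where "q = 2 * j" by blast
  then show ?thesis using section_period[of k j]
    by (cases p; cases "fst p") (auto simp: rot_def)
next
  case False
  then obtain j where j: "q = 2 * j + 1" by (auto elim: oddE)
  have "section_of (k + 10 * q) = rotate_section (section_of k)"
    using section_period[of "k + 10" j] section_step[of k] by (simp add: j algebra_simps)
  moreover obtain \<rho> c where "p = (\<rho>, c)" "1 \<le> c" "c \<le> 6" using p by (auto simp: cells_def)
  moreover have "6 - Suc (6 - c) = c - 1" "7 - c - 1 = 6 - c" "6 - c < 6"
    using \<open>1 \<le> c\<close> \<open>c \<le> 6\<close> by auto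
  ultimately show ?thesis using False section_lengths[of k]
    by (cases \<rho>) (auto simp: rot_def rotate_cell_def rotate_section_def rev_nth)
qed

lemma rot_image_colour_class:
  "rot q ` {p \<in> cells. cell_colour k p = i} = {p \<in> cells. cell_colour (k + 10 * q) p = i}"
proof -
  have "p \<in> rot q ` {p \<in> cells. cell_colour k p = i}"
    if "p \<in> cells" "cell_colour (k + 10 * q) p = i" for p
    using that cell_colour_rot[of "rot q p" k q] rot_self[of p q] rot_cells[of p q]
    by (intro image_eqI[of _ _ "rot q p"]) auto
  then show ?thesis by (auto simp: rot_cells cell_colour_rot)
qed

lemma left_half_cells: "UNIV \<times> {1..3} \<subseteq> cells" and right_half_cells: "UNIV \<times> {4..6} \<subseteq> cells"
  by (auto simp: cells_def)

lemma rot_halves: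
  "rot q ` (UNIV \<times> {1..3}) = (if odd q then UNIV \<times> {4..6} else UNIV \<times> {1..3})"
  "rot q ` (UNIV \<times> {4..6}) = (if odd q then UNIV \<times> {1..3} else UNIV \<times> {4..6})"
proof -
  have e: "rotate_cell ` (UNIV \<times> {1..3}) \<subseteq> UNIV \<times> {4..6}"
    "rotate_cell ` (UNIV \<times> {4..6}) \<subseteq> UNIV \<times> {1..3}"
    by (auto simp: rotate_cell_def)
  have "rotate_cell (rotate_cell p) = p" if "p \<in> cells" for p
    using rot_self[OF that, of 1] by (simp add: rot_def)
  then have "p \<in> rotate_cell ` (UNIV \<times> {1..3})" if "p \<in> UNIV \<times> {4..6}" for p
    by (metis e(2) image_eqI image_subset_iff right_half_cells subsetD that)
  moreover have "p \<in> rotate_cell ` (UNIV \<times> {4..6})" if "p \<in> UNIV \<times> {1..3}" for p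
    by (metis \<open>\<And>p. p \<in> cells \<Longrightarrow> rotate_cell (rotate_cell p) = p\<close> e(1) image_eqI
        image_subset_iff left_half_cells subsetD that)
  ultimately have "rotate_cell ` (UNIV \<times> {1..3}) = UNIV \<times> {4..6}"
    "rotate_cell ` (UNIV \<times> {4..6}) = UNIV \<times> {1..3}"
    using e by blast+
  then show "rot q ` (UNIV \<times> {1..3}) = (if odd q then UNIV \<times> {4..6} else UNIV \<times> {1..3})"
    "rot q ` (UNIV \<times> {4..6}) = (if odd q then UNIV \<times> {1..3} else UNIV \<times> {4..6})"
    by (auto simp: rot_def[abs_def] image_iff)
qed

lemma base_cells: "b \<in> blocks \<Longrightarrow> base b \<subseteq> cells"
  unfolding blocks_def using left_half_cells right_half_cells by auto

lemma turn_turn: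
  assumes "base b \<subseteq> cells"
  shows "turn q (turn q' b) = turn (q + q') b"
proof -
  have "rot q ` rot q' ` base b = rot (q + q') ` base b"
    unfolding image_image using assms by (intro image_cong refl rot_rot) blast
  then show ?thesis by (simp add: turn_def)
qed

lemma turn_0 [simp]: "turn 0 b = b"
  by (simp add: turn_def rot_def[abs_def])

lemma turn_blocks:
  assumes "b \<in> blocks"
  shows "turn q b \<in> blocks"
proof -
  from assms consider
    (plain) k i where "\<exists>p\<in>cells. cell_colour k p \<noteq> 4" "{p \<in> cells. cell_colour k p = i} \<noteq> {}"
      "b = (k, {p \<in> cells. cell_colour k p = i}, i)"
  | (four) k S where "\<forall>p\<in>cells. cell_colour k p = 4" "S = UNIV \<times> {1..3} \<or> S = UNIV \<times> {4..6}"
      "b = (k, S, 4)"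
    unfolding blocks_def by blast
  then show ?thesis
  proof cases
    case plain
    then have "turn q b = (k + 10 * q, {p \<in> cells. cell_colour (k + 10 * q) p = i}, i)"
      by (simp add: turn_def rot_image_colour_class)
    moreover have "\<exists>p\<in>cells. cell_colour (k + 10 * q) p \<noteq> 4"
      using plain(1) cell_colour_rot rot_cells by metis
    moreover have "{p \<in> cells. cell_colour (k + 10 * q) p = i} \<noteq> {}"
      using plain(2) unfolding rot_image_colour_class[symmetric] by blast
    ultimately show ?thesis unfolding blocks_def by blast
  next
    case four
    then have "turn q b = (k + 10 * q, rot q ` S, 4)" by (simp add: turn_def)
    moreover have "rot q ` S = UNIV \<times> {1..3} \<or> rot q ` S = UNIV \<times> {4..6}"
      using four(2) rot_halves[of q] by metis
    moreover have "\<forall>p\<in>cells. cell_colour (k + 10 * q) p = 4"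
      using four(1) cell_colour_rot rot_self rot_cells by metis
    ultimately show ?thesis unfolding blocks_def by blast
  qed
qed

section \<open>Classification of the blocks\<close>

lemma section_simps:
  "section_of 0 = ([8,6,6,4,4,4], [8,6,6,4,4,4])"
  "section_of 1 = ([7,7,5,5,2,2], [0,7,5,5,5,2])"
  "section_of 2 = ([8,6,6,4,4,4], [8,6,6,4,4,4])"
  "section_of 3 = ([7,5,5,5,3,3], [7,7,5,5,3,3])"
  "section_of 4 = ([6,6,4,4,4,1], [6,6,4,4,4,1])"
  "section_of 5 = ([5,5,2,2,3,3], [5,5,5,2,3,3])"
  "section_of 6 = ([4,4,4,4,4,4], [4,4,4,4,4,4])"
  "section_of 7 = ([3,3,2,5,5,5], [3,3,2,2,5,5])"
  "section_of 8 = ([1,4,4,4,6,6], [1,4,4,4,6,6])"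
  "section_of 9 = ([3,3,5,5,7,7], [3,3,5,5,5,7])"
  "section_of 10 = ([4,4,4,6,6,8], [4,4,4,6,6,8])"
  by (simp_all add: section_of_def Let_def base_pattern_def rotate_section_def)

lemma cell_colours:
  assumes "1 \<le> k" "k \<le> 10"
  shows "cell_colour k ` cells = set (map snd (filter (\<lambda>x. fst x = k) (zip cube_table colour_table)))"
proof -
  let ?L = "\<lambda>k. map snd (filter (\<lambda>x. fst x = k) (zip cube_table colour_table))"
  let ?P = "\<lambda>k. (\<forall>p\<in>cells. cell_colour k p \<in> set (?L k)) \<and>
    (\<forall>i\<in>set (?L k). \<exists>p\<in>cells. cell_colour k p = i)"
  have "k \<in> set [1..10]" using assms by simp
  then have "k \<in> {1, 2, 3, 4, 5, 6, 7, 8, 9, 10}" by (simp add: upto.simps del: set_upto)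
  moreover have "?P 1" "?P 2" "?P 3" "?P 4" "?P 5" "?P 6" "?P 7" "?P 8" "?P 9" "?P 10"
    by (simp_all add: cells_eq section_simps cube_table_def colour_table_def)
  ultimately have "?P k" by blast
  then show ?thesis by (auto simp del: set_map)
qed

lemma table_lengths: "length cube_table = 30" "length colour_table = 30"
  by (simp_all add: cube_table_def colour_table_def)

lemma cell_colours_nth:
  assumes "1 \<le> k" "k \<le> 10"
  shows "i \<in> cell_colour k ` cells \<longleftrightarrow> (\<exists>r<30. cube_table ! r = k \<and> colour_table ! r = i)"
  unfolding cell_colours[OF assms]
  by (auto simp: in_set_conv_nth table_lengths image_iff Bex_def set_zip)

lemma cube_table_4:
  assumes "r < 30"
  shows "1 \<le> cube_table ! r" "cube_table ! r \<le> 10" "cube_table ! r = 6 \<longleftrightarrow> r = 16 \<or> r = 17"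
proof -
  have "list_all (\<lambda>n. let r = nat n in 1 \<le> cube_table ! r \<and> cube_table ! r \<le> 10 \<and>
      (cube_table ! r = 6 \<longleftrightarrow> r = 16 \<or> r = 17))
    residues"
    by (simp add: cube_table_def)
  from all_residues[OF this, of "int r"] assms
  show "1 \<le> cube_table ! r" "cube_table ! r \<le> 10" "cube_table ! r = 6 \<longleftrightarrow> r = 16 \<or> r = 17"
    by (simp_all add: Let_def)
qed

lemma colour_table_4: "colour_table ! 16 = 4" "colour_table ! 17 = 4"
  by (simp_all add: colour_table_def)

lemma cube_6_colours: "\<forall>p\<in>cells. cell_colour 6 p = 4"
  by (simp add: cells_eq section_simps)

lemma other_cube_colours:
  assumes "1 \<le> k" "k \<le> 10" "k \<noteq> 6"
  shows "\<exists>p\<in>cells. cell_colour k p \<noteq> 4"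
proof -
  have "k \<in> set [1..10]" using assms by simp
  then have "k \<in> {1, 2, 3, 4, 5, 7, 8, 9, 10}"
    using assms(3) by (simp add: upto.simps del: set_upto)
  then have "\<exists>i\<in>cell_colour k ` cells. i \<noteq> 4"
    unfolding cell_colours[OF assms(1,2)]
    by (elim insertE) (simp_all add: cube_table_def colour_table_def)
  then show ?thesis by blast
qed

lemma plain_block:
  assumes "\<exists>p\<in>cells. cell_colour k p \<noteq> 4" "i \<in> cell_colour k ` cells"
  shows "(k, {p \<in> cells. cell_colour k p = i}, i) \<in> blocks"
  using assms unfolding blocks_def by blast

lemma four_block:
  assumes "\<forall>p\<in>cells. cell_colour k p = 4" "S = UNIV \<times> {1..3} \<or> S = UNIV \<times> {4..6}"
  shows "(k, S, 4) \<in> blocks"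
  using assms unfolding blocks_def by blast

lemma base_block_blocks:
  assumes "r < 30"
  shows "base_block r \<in> blocks"
proof (cases "cube_table ! r = 6")
  case True
  with assms have "r = 16 \<or> r = 17" using cube_table_4 by blast
  then have "base_block r = (6, UNIV \<times> {1..3}, 4) \<or> base_block r = (6, UNIV \<times> {4..6}, 4)"
    using True colour_table_4 by (auto simp: base_block_def)
  then show ?thesis using four_block[of 6] cube_6_colours by (elim disjE) simp_all
next
  case False
  with assms have "r \<noteq> 16" "r \<noteq> 17" using cube_table_4 by blast+
  moreover have "\<exists>p\<in>cells. cell_colour (cube_table ! r) p \<noteq> 4"
    using other_cube_colours cube_table_4[OF assms] False by blast
  moreover have "colour_table ! r \<in> cell_colour (cube_table ! r) ` cells"
    using cell_colours_nth cube_table_4[OF assms] assms by blast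
  ultimately show ?thesis using plain_block by (simp add: base_block_def)
qed

lemma low_blocks:
  assumes "b \<in> blocks" "1 \<le> cube b" "cube b \<le> 10"
  shows "\<exists>r<30. b = base_block r"
proof (cases "cube b = 6")
  case True
  then have "b = (6, UNIV \<times> {1..3}, 4) \<or> b = (6, UNIV \<times> {4..6}, 4)"
    using assms(1) cube_6_colours unfolding blocks_def by fastforce
  then have "b = base_block 16 \<or> b = base_block 17"
    using colour_table_4 cube_table_4[of 16] cube_table_4[of 17] by (simp add: base_block_def)
  then obtain r where "b = base_block r" "r = 16 \<or> r = 17" by blast
  then show ?thesis by (intro exI[of _ r]) auto
next
  case False
  with assms other_cube_colours[of "cube b"]
  have b: "base b = {p \<in> cells. cell_colour (cube b) p = colour b}" "base b \<noteq> {}"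
    unfolding blocks_def by auto
  then obtain p where "p \<in> cells" "cell_colour (cube b) p = colour b" by blast
  then have "colour b \<in> cell_colour (cube b) ` cells" by (metis imageI)
  then obtain r where r: "r < 30" "cube_table ! r = cube b" "colour_table ! r = colour b"
    using cell_colours_nth[OF assms(2,3)] by blast
  moreover have "r \<noteq> 16" "r \<noteq> 17" using r(2) False cube_table_4(3)[OF r(1)] by metis+
  ultimately have "b = base_block r" using b by (simp add: base_block_def prod_eq_iff)
  with r show ?thesis by blast
qed

lemma cube_blk [simp]: "cube (blk n) = level n"
  and colour_blk [simp]: "colour (blk n) = colr n"
  by (simp_all add: blk_def turn_def base_block_def level_def colr_def)

lemma blk_blocks: "blk n \<in> blocks"
  unfolding blk_def by (intro turn_blocks base_block_blocks) (simp add: nat_less_iff)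

lemma turn_blk: "turn q (blk n) = blk (n + 30 * q)"
  using turn_turn[OF base_cells[OF base_block_blocks], of "nat (n mod 30)" q "n div 30"]
  by (simp add: blk_def nat_less_iff add.commute)

lemma blocks_eq: "blocks = range blk"
proof (intro equalityI subsetI)
  fix b assume b: "b \<in> blocks"
  \<comment> \<open>Periods begin at cube 1, not at cube 0, hence the subtraction.\<close>
  define q where "q = (cube b - 1) div 10"
  have "1 \<le> cube (turn (-q) b)" "cube (turn (-q) b) \<le> 10"
    using div_mult_mod_eq[of "cube b - 1" 10] pos_mod_bound[of 10 "cube b - 1"]
      pos_mod_sign[of 10 "cube b - 1"] by (simp_all add: turn_def q_def)
  then obtain r where r: "r < 30" "turn (-q) b = base_block r"
    using low_blocks turn_blocks[OF b] by blast
  have "b = turn q (turn (-q) b)" using turn_turn[OF base_cells[OF b]] by simp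
  also have "\<dots> = blk (int r + 30 * q)" unfolding r(2) blk_def using r(1) by simp
  finally show "b \<in> range blk" by blast
qed (auto simp: blk_blocks)

text \<open>A period occupies ten levels, so the level fixes the quotient by 30. Level and colour
  then fix the residue, except that 16 and 17, the two halves of the cube 444444, have to be told
  apart by their bases.\<close>

lemma inj_blk: "inj blk"
proof (rule injI)
  fix n n' assume eq: "blk n = blk n'"
  obtain r q where n: "n = r + 30 * q" and r: "0 \<le> r" "r < 30"
    by (rule obtain_residue)
  obtain r' q' where n': "n' = r' + 30 * q'" and r': "0 \<le> r'" "r' < 30"
    by (rule obtain_residue)
  have "level n = level n'" "colr n = colr n'" using eq by (metis cube_blk, metis colour_blk)
  moreover have "1 \<le> level r" "level r \<le> 10" "1 \<le> level r'" "level r' \<le> 10"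
    using level_bounds[of r] level_bounds[of r'] r r' by simp_all
  moreover from calculation have "q = q'" unfolding n n' level_shift by presburger
  ultimately have q: "q = q'" and lc: "level r = level r'" "colr r = colr r'"
    unfolding n n' by simp_all
  have "\<forall>s\<in>set residues. level r = level s \<longrightarrow> colr r = colr s \<longrightarrow>
      r = s \<or> r = 16 \<and> s = 17 \<or> r = 17 \<and> s = 16"
    using _ r by (rule all_residues) (simp add: table_simps)
  then consider "r = r'" | "r = 16 \<and> r' = 17" | "r = 17 \<and> r' = 16"
    using lc residue_cases[OF r'] by blast
  then show "n = n'"
  proof cases
    case 1
    then show ?thesis using n n' q by simp
  next
    case 2
    then have "rot q ` (UNIV \<times> {1..3}) = rot q ` (UNIV \<times> {4..6})"
      using eq by (simp add: n n' q blk_def base_block_def turn_def)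
    then have "Upper \<in> UNIV \<and> (1::nat) \<in> {4..6}" using rot_halves[of q]
      by (auto simp: set_eq_iff split: if_splits)
    then show ?thesis by simp
  next
    case 3
    then have "rot q ` (UNIV \<times> {1..3}) = rot q ` (UNIV \<times> {4..6})"
      using eq by (simp add: n n' q blk_def base_block_def turn_def)
    then have "Upper \<in> UNIV \<and> (1::nat) \<in> {4..6}" using rot_halves[of q]
      by (auto simp: set_eq_iff split: if_splits)
    then show ?thesis by simp
  qed
qed

lemma blk_eq_iff [simp]: "blk n = blk n' \<longleftrightarrow> n = n'"
  using inj_blk by (auto dest: injD)

lemma base_blk: "n mod 30 \<noteq> 16 \<Longrightarrow> n mod 30 \<noteq> 17 \<Longrightarrow>
    base (blk n) = {p \<in> cells. cell_colour (level n) p = colr n}"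
  "base (blk 16) = UNIV \<times> {1..3}" "base (blk 17) = UNIV \<times> {4..6}"
proof -
  assume "n mod 30 \<noteq> 16" "n mod 30 \<noteq> 17"
  then have "nat (n mod 30) \<noteq> 16" "nat (n mod 30) \<noteq> 17"
    using nat_eq_iff pos_mod_sign[of 30 n] by auto
  then show "base (blk n) = {p \<in> cells. cell_colour (level n) p = colr n}"
    using rot_image_colour_class[of "n div 30" "cube_table ! nat (n mod 30)"]
    by (simp add: blk_def turn_def base_block_def level_def colr_def add.commute)
qed (simp_all add: blk_def turn_def base_block_def rot_def[abs_def])

section \<open>Vertical adjacency of blocks\<close>

lemma directly_below_turn:
  assumes "directly_below c b" "base b \<subseteq> cells"
  shows "directly_below (turn q c) (turn q b)"
proof -
  obtain p where "p \<in> base c" "p \<in> base b" using assms(1) by (auto simp: directly_below_def)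
  then have "rot q p \<in> base (turn q c) \<inter> base (turn q b)" by (simp add: turn_def)
  moreover have "turn q c \<in> blocks" "cube (turn q c) = cube (turn q b) - 1"
    using assms turn_blocks[of c q] by (simp_all add: directly_below_def turn_def)
  ultimately show ?thesis by (auto simp: directly_below_def)
qed

text \<open>Membership of a cell in the base of a block, in a form that can be evaluated. It is only
  used for numbers from -12 to 29, because the next half cubes further down have the numbers -14 and
  -13.\<close>

definition over :: "int \<Rightarrow> cell \<Rightarrow> bool" where
  "over n p = (if n = 16 then snd p \<le> 3 else if n = 17 then 4 \<le> snd p
    else cell_colour (level n) p = colr n)"

lemma over_base:
  assumes "-13 < n" "n < 30"
  shows "base (blk n) = {p \<in> cells. over n p}"
proof -
  consider "n = 16" | "n = 17" | "n \<noteq> 16" "n \<noteq> 17" by blast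
  then show ?thesis
  proof cases
    case 3
    have "n mod 30 = (if n < 0 then n + 30 else n)"
      using assms mod_pos_pos_trivial[of "n + 30" 30] mod_pos_pos_trivial[of n 30]
      by (auto simp: add.commute)
    then have "n mod 30 \<noteq> 16" "n mod 30 \<noteq> 17" using 3 assms by (auto split: if_splits)
    with 3 show ?thesis by (simp add: base_blk(1) over_def[abs_def])
  qed (auto simp: base_blk over_def cells_def)
qed

text \<open>Confronts \<open>depth_table\<close> with the geometry. The search starts at -3 because
  cube 0 consists of the blocks -3, -2 and -1, and a block of the cubes 1 to 10 rests on nothing
  lower.\<close>

definition lowers_correct :: "int \<Rightarrow> bool" where
  "lowers_correct r = list_all (\<lambda>x. x \<in> set (lowers r) \<longleftrightarrow> (if level x = level r - 1 then
      list_ex (\<lambda>p. over x p \<and> over r p) (List.product [Upper, Lower] [1, 2, 3, 4, 5, 6])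
      else False)) ([-3, -2, -1] @ residues)"

lemma lowers_table:
  assumes r: "0 \<le> r" "r < 30" and x: "-3 \<le> x" "x < 30"
  shows "x \<in> set (lowers r) \<longleftrightarrow> level x = level r - 1 \<and> base (blk x) \<inter> base (blk r) \<noteq> {}"
proof -
  have "x \<in> set ([-3, -2, -1] @ residues)"
  proof (cases "0 \<le> x")
    case True
    then show ?thesis using residue_cases[OF True x(2)] by simp
  qed (use x in auto)
  moreover have "lowers_correct r"
    using _ r by (rule all_residues)
      (simp add: lowers_correct_def table_simps period_simps over_def section_simps)
  ultimately have "x \<in> set (lowers r) \<longleftrightarrow> level x = level r - 1 \<and>
      list_ex (\<lambda>p. over x p \<and> over r p) (List.product [Upper, Lower] [1, 2, 3, 4, 5, 6])"
    unfolding lowers_correct_def list_all_iff by (metis (no_types, lifting))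
  also have "list_ex (\<lambda>p. over x p \<and> over r p) (List.product [Upper, Lower] [1, 2, 3, 4, 5, 6])
      \<longleftrightarrow> base (blk x) \<inter> base (blk r) \<noteq> {}"
  proof -
    have "base (blk x) = {p \<in> cells. over x p}" "base (blk r) = {p \<in> cells. over r p}"
      using r x by (simp_all add: over_base)
    then show ?thesis by (simp only: list_ex_iff cells_eq[symmetric]) blast
  qed
  finally show ?thesis .
qed

lemma directly_below_blk: "directly_below c (blk n) \<longleftrightarrow> (\<exists>x\<in>set (lowers n). c = blk x)"
proof -
  obtain r q where n: "n = r + 30 * q" and r: "0 \<le> r" "r < 30"
    by (rule obtain_residue)
  have *: "directly_below (blk x) (blk r) \<longleftrightarrow> x \<in> set (lowers r)" for x
  proof (cases "-3 \<le> x \<and> x < 30")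
    case True
    then show ?thesis using lowers_table[OF r] by (auto simp: directly_below_def blk_blocks)
  next
    case False
    have "x \<notin> set (lowers r)"
    proof -
      have "list_all (\<lambda>r. \<forall>x\<in>set (lowers r). -3 \<le> x \<and> x < 30)
          residues" by (simp add: table_simps)
      from all_residues[OF this r] False show ?thesis by blast
    qed
    moreover have "level x \<noteq> level r - 1"
    proof
      assume lx: "level x = level r - 1"
      obtain s t where x: "x = s + 30 * t" and s: "0 \<le> s" "s < 30"
        by (rule obtain_residue)
      have "1 \<le> level r" "level r \<le> 10" "1 \<le> level s" "level s \<le> 10"
        using level_bounds[of r] level_bounds[of s] r s by simp_all
      with lx have t: "t = 0 \<or> t = -1 \<and> level s = 10" unfolding x by auto
      have "list_all (\<lambda>s. level s = 10 \<longrightarrow> 27 \<le> s)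
          residues" by (simp add: table_simps)
      from all_residues[OF this s] t False s show False unfolding x by auto
    qed
    ultimately show ?thesis by (auto simp: directly_below_def)
  qed
  have "directly_below (blk x) (blk n) \<longleftrightarrow> directly_below (blk (x - 30 * q)) (blk r)" for x
    using directly_below_turn[of "blk (x - 30 * q)" "blk r" q]
      directly_below_turn[of "blk x" "blk n" "-q"] base_cells[OF blk_blocks]
    by (auto simp: turn_blk n)
  then have "directly_below (blk x) (blk n) \<longleftrightarrow> x \<in> set (lowers n)" for x
    unfolding * n by (force simp: image_iff)
  moreover have "c \<in> range blk" if "directly_below c (blk n)"
    using that by (simp add: directly_below_def blocks_eq)
  ultimately show ?thesis by blast
qed

section \<open>Columns as sets of integers\<close>

text \<open>The offset \<open>q\<close> could be absorbed into the set (\<open>col_sh\<close>).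
  Keeping it separate makes equivalence visible: equivalent columns are \<open>col q I\<close> and
  \<open>col q' I\<close> with the same \<open>I\<close> (\<open>congruent_iff\<close>).\<close>

definition col :: "int \<Rightarrow> int set \<Rightarrow> block set" where
  "col q I = (\<lambda>n. blk (n + 30 * q)) ` I"

definition sh :: "int \<Rightarrow> int set \<Rightarrow> int set" where
  "sh q I = (\<lambda>n. n + 30 * q) ` I"

lemma mem_sh: "n \<in> sh q I \<longleftrightarrow> n - 30 * q \<in> I"
  unfolding sh_def by (auto intro: image_eqI[of _ _ "n - 30 * q"])

lemma sh_0 [simp]: "sh 0 I = I" and sh_sh: "sh q (sh k I) = sh (q + k) I"
  by (auto simp: mem_sh algebra_simps)

lemma blk_mem_col [simp]: "blk n \<in> col q I \<longleftrightarrow> n - 30 * q \<in> I"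
  unfolding col_def by (auto intro: image_eqI[of _ _ "n - 30 * q"])

lemma col_sh: "col q (sh k I) = col (q + k) I"
  by (auto simp: col_def sh_def image_image algebra_simps)

lemma col_subset_blocks: "col q I \<subseteq> blocks"
  by (auto simp: col_def blocks_eq)

lemma col_eq_iff: "col q I = col q' I' \<longleftrightarrow> sh q I = sh q' I'"
proof
  assume "col q I = col q' I'"
  then have "n - 30 * q \<in> I \<longleftrightarrow> n - 30 * q' \<in> I'" for n
    by (metis blk_mem_col)
  then show "sh q I = sh q' I'" by (auto simp: mem_sh)
next
  assume "sh q I = sh q' I'"
  then show "col q I = col q' I'" by (metis add_0 col_sh)
qed

lemma col_exhaust:
  assumes "y \<subseteq> blocks"
  shows "\<exists>I. y = col q I"
proof -
  have "b \<in> col q {n. blk (n + 30 * q) \<in> y}" if b: "b \<in> y" for b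
  proof -
    obtain n where "b = blk n" using b assms by (auto simp: blocks_eq)
    then show ?thesis using b by simp
  qed
  then have "y = col q {n. blk (n + 30 * q) \<in> y}"
    by (auto simp: col_def)
  then show ?thesis by blast
qed

lemma insert_col: "insert (blk (b + 30 * q)) (col q I) = col q (insert b I)"
  by (auto simp: col_def)

lemma remove_col: "col q I - {blk (b + 30 * q)} = col q (I - {b})"
  by (auto simp: col_def)

definition closed :: "int set \<Rightarrow> bool" where
  "closed I \<longleftrightarrow> (\<forall>n\<in>I. set (lowers n) \<subseteq> I)"

definition ideal_column :: "int set \<Rightarrow> bool" where
  "ideal_column I \<longleftrightarrow> I \<noteq> {} \<and> bdd_above I \<and> closed I"

text \<open>Here \<open>a\<close> is the hole: for 14 it is the 2-block of cube 5 missing from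
  \<open>S1\<close>, for 16 the left half of cube 6 missing from \<open>S2\<close>.\<close>

definition special :: "int \<Rightarrow> int set" where
  "special a = {..<a} \<union> {a + 1, a + 3}"

definition young_set :: "int set \<Rightarrow> bool" where
  "young_set I \<longleftrightarrow> ideal_column I \<or> (\<exists>k. I = sh k (special 14) \<or> I = sh k (special 16))"

lemma closed_sh [simp]: "closed (sh k I) \<longleftrightarrow> closed I"
proof -
  have "closed (sh k I)" if "closed I" for k and I
    unfolding closed_def
  proof (intro ballI subsetI)
    fix n x assume "n \<in> sh k I" and x: "x \<in> set (lowers n)"
    then have n: "n - 30 * k \<in> I" by (simp add: mem_sh)
    have "lowers n = map (\<lambda>x. x + 30 * k) (lowers (n - 30 * k))"
      using lowers_shift[of "n - 30 * k" k] by simp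
    then have "x - 30 * k \<in> set (lowers (n - 30 * k))" using x by auto
    then show "x \<in> sh k I" using that n by (auto simp: closed_def mem_sh)
  qed
  from this[of I k] this[of "sh k I" "-k"] show ?thesis by (auto simp: sh_sh)
qed

lemma bdd_above_sh [simp]: "bdd_above (sh k I) \<longleftrightarrow> bdd_above I"
proof -
  have "bdd_above (sh k I)" if "bdd_above I" for k and I
  proof -
    obtain M where "\<And>n. n \<in> I \<Longrightarrow> n \<le> M"
      using \<open>bdd_above I\<close> unfolding bdd_above_def by blast
    then show ?thesis by (intro bdd_aboveI[of _ "M + 30 * k"]) (auto simp: sh_def)
  qed
  from this[of I k] this[of "sh k I" "-k"] show ?thesis by (auto simp: sh_sh)
qed

lemma ordinary_col: "ordinary_column (col q I) \<longleftrightarrow> ideal_column I"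
proof -
  have "(\<exists>N. \<forall>b\<in>col q I. cube b \<le> N) \<longleftrightarrow> bdd_above I"
  proof
    assume "\<exists>N. \<forall>b\<in>col q I. cube b \<le> N"
    then obtain N where N: "\<And>n. n \<in> I \<Longrightarrow> level n + 10 * q \<le> N"
      by (auto simp: col_def)
    \<comment> \<open>Ten levels hold thirty numbers, which gives the factor 3; the summand 30
      absorbs the position within a period.\<close>
    have "n \<le> 3 * (N - 10 * q) + 30" if "n \<in> I" for n
    proof -
      obtain r d where n: "n = r + 30 * d" and r: "0 \<le> r" "r < 30"
        by (rule obtain_residue)
      have "0 < level r" using level_bounds(1)[of r] r by simp
      moreover have "level r + 10 * d + 10 * q \<le> N" using N[OF that] unfolding n level_shift .
      moreover note \<open>r < 30\<close>
      ultimately show ?thesis unfolding n by presburger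
    qed
    then show "bdd_above I" by (rule bdd_aboveI)
  next
    assume "bdd_above I"
    then obtain M where M: "\<And>n. n \<in> I \<Longrightarrow> n \<le> M" unfolding bdd_above_def by blast
    have "level n \<le> 10 * (M div 30) + 10" if "n \<in> I" for n
      using level_bounds(2)[of n] zdiv_mono1[OF M[OF that], of 30] by linarith
    then show "\<exists>N. \<forall>b\<in>col q I. cube b \<le> N"
      by (intro exI[of _ "10 * (M div 30) + 10 + 10 * q"]) (auto simp: col_def)
  qed
  moreover have "(\<forall>b\<in>col q I. \<forall>c. directly_below c b \<longrightarrow> c \<in> col q I) \<longleftrightarrow> closed I"
  proof
    assume H: "\<forall>b\<in>col q I. \<forall>c. directly_below c b \<longrightarrow> c \<in> col q I"
    show "closed I" unfolding closed_def
    proof (intro ballI subsetI)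
      fix n x assume n: "n \<in> I" and "x \<in> set (lowers n)"
      then have "directly_below (blk (x + 30 * q)) (blk (n + 30 * q))"
        unfolding directly_below_blk lowers_shift by auto
      moreover have "blk (n + 30 * q) \<in> col q I" using n by simp
      ultimately have "blk (x + 30 * q) \<in> col q I" using H by blast
      then show "x \<in> I" by simp
    qed
  next
    assume "closed I"
    then show "\<forall>b\<in>col q I. \<forall>c. directly_below c b \<longrightarrow> c \<in> col q I"
      by (auto simp: col_def closed_def directly_below_blk)
  qed
  ultimately show ?thesis
    unfolding ordinary_column_def ideal_column_def
    using col_subset_blocks by (auto simp: col_def)
qed

lemma move_turn: "move (10 * q) (odd q) = turn q"
  by (auto simp: move_def turn_def rot_def[abs_def] fun_eq_iff)

lemma turn_col: "turn q ` col k I = col (q + k) I"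
  by (auto simp: col_def image_image turn_blk algebra_simps)

lemma base_blk_3: "base (blk (3 + 30 * q)) = {if odd q then (Upper, 6) else (Lower, 1)}"
proof -
  have "{p \<in> cells. over 3 p} = {(Lower, 1)}"
  proof -
    have "\<forall>p\<in>cells. over 3 p \<longleftrightarrow> p = (Lower, 1)"
      by (simp add: cells_eq over_def table_simps section_simps)
    moreover have "(Lower, 1) \<in> cells" by (simp add: cells_def)
    ultimately show ?thesis by blast
  qed
  then have "base (blk 3) = {(Lower, 1)}" using over_base[of 3] by simp
  then have "base (turn q (blk 3)) = {rot q (Lower, 1)}" by (simp add: turn_def)
  then show ?thesis by (simp add: turn_blk rot_def rotate_cell_def)
qed

lemma colr_0: "colr n = 0 \<Longrightarrow> \<exists>q. n = 3 + 30 * q"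
proof -
  assume c: "colr n = 0"
  obtain r q where n: "n = r + 30 * q" and r: "0 \<le> r" "r < 30"
    by (rule obtain_residue)
  have "colr r = 0 \<longrightarrow> r = 3" using _ r by (rule all_residues) (simp add: table_simps)
  then show ?thesis using c n by auto
qed

text \<open>
  The blocks of colour 0 occur once in every ten cubes and lie over a single cell, so a motion
  that maps one of them to another is determined by its translation part.
\<close>

lemma moves_of_columns:
  assumes "\<And>n. n < N \<Longrightarrow> blk n \<in> y" "move n r ` y \<subseteq> blocks"
  shows "\<exists>q. move n r = turn q"
proof -
  \<comment> \<open>An even index makes the 0-block number \<open>3 + 30 * j\<close> unrotated, and
    the quotient puts it below \<open>N\<close>, hence into \<open>y\<close>.\<close>
  define j where "j = 2 * ((N - 4) div 60)"
  have j: "even j" unfolding j_def by simp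
  have "3 + 30 * j < N" unfolding j_def using div_mult_mod_eq[of "N - 4" 60]
      pos_mod_sign[of 60 "N - 4"] by linarith
  then have "move n r (blk (3 + 30 * j)) \<in> blocks" using assms by blast
  then obtain x where x: "move n r (blk (3 + 30 * j)) = blk x" unfolding blocks_eq by blast
  have "colr x = colour (move n r (blk (3 + 30 * j)))" unfolding x by simp
  then have "colr x = 0" by (simp add: move_def table_simps)
  then obtain q where q: "x = 3 + 30 * q" using colr_0 by blast
  have "level x = cube (move n r (blk (3 + 30 * j)))" unfolding x by simp
  then have n: "n = 10 * (q - j)" unfolding q level_shift
    by (simp add: move_def)
  have "base (blk x) = base (move n r (blk (3 + 30 * j)))" unfolding x by simp
  also have "\<dots> = (if r then rotate_cell ` {(Lower, 1)} else {(Lower, 1)})"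
    using j unfolding move_def base_blk_3 by simp
  finally have "r = odd q" unfolding q base_blk_3
    by (auto simp: rotate_cell_def split: if_splits)
  then have "r = odd (q - j)" using j by simp
  then have "move n r = turn (q - j)"
    unfolding n by (simp add: move_turn[symmetric])
  then show ?thesis by blast
qed

lemma cube_bound_iff: "level n \<le> 4 \<longleftrightarrow> n < 13" "level n \<le> 5 \<longleftrightarrow> n < 16"
  "level n = 5 \<longleftrightarrow> n \<in> {13, 14, 15}" "level n = 6 \<longleftrightarrow> n \<in> {16, 17}"
  "level n = 7 \<longleftrightarrow> n \<in> {18, 19, 20}"
proof -
  obtain r q where n: "n = r + 30 * q" and r: "0 \<le> r" "r < 30"
    by (rule obtain_residue)
  have b: "(level r \<le> 4 \<longleftrightarrow> r < 13) \<and> (level r \<le> 5 \<longleftrightarrow> r < 16) \<and>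
      (level r = 5 \<longleftrightarrow> r \<in> {13, 14, 15}) \<and> (level r = 6 \<longleftrightarrow> r \<in> {16, 17}) \<and>
      (level r = 7 \<longleftrightarrow> r \<in> {18, 19, 20}) \<and> 1 \<le> level r \<and> level r \<le> 10"
    using _ r by (rule all_residues) (simp add: table_simps)
  consider "q = 0" | "q \<le> -1" | "1 \<le> q" by linarith
  then show "level n \<le> 4 \<longleftrightarrow> n < 13" "level n \<le> 5 \<longleftrightarrow> n < 16"
    "level n = 5 \<longleftrightarrow> n \<in> {13, 14, 15}" "level n = 6 \<longleftrightarrow> n \<in> {16, 17}"
    "level n = 7 \<longleftrightarrow> n \<in> {18, 19, 20}"
    using b r unfolding n by (cases; auto)+
qed

lemma half_blocks: "level n = 6 \<and> base (blk n) = UNIV \<times> {4..6} \<longleftrightarrow> n = 17"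
proof -
  have "(Upper, 1) \<in> base (blk 16)" by (simp add: base_blk)
  then have "base (blk 16) \<noteq> UNIV \<times> {4..6}" by auto
  then show ?thesis using base_blk(3) cube_bound_iff(4)[of n] by (metis insert_iff empty_iff)
qed

lemma block_set_eqI:
  assumes "y \<subseteq> blocks" "z \<subseteq> blocks" "\<And>n. blk n \<in> y \<longleftrightarrow> blk n \<in> z"
  shows "y = z"
  using assms unfolding blocks_eq by blast

lemma S1_col: "S1 = col 0 (special 14)" and S2_col: "S2 = col 0 (special 16)"
proof -
  have "level n = 5 \<and> colr n \<in> {5, 3} \<longleftrightarrow> n = 13 \<or> n = 15" for n
    unfolding cube_bound_iff by (auto simp: table_simps)
  then have "blk n \<in> S1 \<longleftrightarrow> n < 13 \<or> (n = 13 \<or> n = 15) \<or> n = 17" for n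
    unfolding S1_def half_blocks[symmetric] cube_bound_iff(1)[symmetric] by (simp add: blk_blocks)
  also have "n < 13 \<or> (n = 13 \<or> n = 15) \<or> n = 17 \<longleftrightarrow> n \<in> special 14" for n
    by (simp add: special_def) linarith
  finally have "blk n \<in> S1 \<longleftrightarrow> n \<in> special 14" for n .
  then show "S1 = col 0 (special 14)"
    by (intro block_set_eqI col_subset_blocks) (auto simp: S1_def)
  have "level n = 7 \<and> colr n = 2 \<longleftrightarrow> n = 19" for n
    unfolding cube_bound_iff by (auto simp: table_simps)
  then have "blk n \<in> S2 \<longleftrightarrow> n < 16 \<or> n = 17 \<or> n = 19" for n
    unfolding S2_def half_blocks[symmetric] cube_bound_iff(2)[symmetric] by (simp add: blk_blocks)
  also have "n < 16 \<or> n = 17 \<or> n = 19 \<longleftrightarrow> n \<in> special 16" for n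
    by (auto simp: special_def)
  finally have "blk n \<in> S2 \<longleftrightarrow> n \<in> special 16" for n .
  then show "S2 = col 0 (special 16)"
    by (intro block_set_eqI col_subset_blocks) (auto simp: S2_def)
qed

text \<open>The hypothesis puts 0-blocks into the column, and these allow only motions of the form
  \<open>turn k\<close>. A motion of this form merely changes the offset.\<close>

lemma congruent_col:
  assumes "\<And>n. n < N \<Longrightarrow> n \<in> I"
  shows "z \<subseteq> blocks \<and> congruent_columns (col q I) z \<longleftrightarrow> (\<exists>k. z = col k I)"
proof
  assume z: "z \<subseteq> blocks \<and> congruent_columns (col q I) z"
  then obtain n r where "z = move n r ` col q I" by (auto simp: congruent_columns_def)
  moreover from this z have "\<exists>k. move n r = turn k"
    using assms moves_of_columns[of "N + 30 * q" "col q I" n r] by simp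
  ultimately show "\<exists>k. z = col k I" using turn_col by metis
next
  assume "\<exists>k. z = col k I"
  then obtain k where k: "z = col k I" by blast
  then have "z = move (10 * (k - q)) (odd (k - q)) ` col q I" by (simp only: move_turn turn_col) simp
  then show "z \<subseteq> blocks \<and> congruent_columns (col q I) z"
    unfolding congruent_columns_def using k col_subset_blocks by blast
qed

lemma young_col: "young_column (col q I) \<longleftrightarrow> young_set I"
proof -
  have "(\<exists>k. col q I = col k J) \<longleftrightarrow> (\<exists>k. I = sh k J)" for J
  proof
    assume "\<exists>k. col q I = col k J"
    then obtain k where "sh q I = sh k J" by (auto simp: col_eq_iff)
    then have "sh (-q) (sh q I) = sh (-q) (sh k J)" by simp
    then show "\<exists>k. I = sh k J" by (auto simp: sh_sh)
  qed (auto simp: col_sh)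
  moreover have "n < 14 \<Longrightarrow> n \<in> special 14" "n < 16 \<Longrightarrow> n \<in> special 16" for n
    by (auto simp: special_def)
  ultimately show ?thesis
    unfolding young_column_def young_set_def ordinary_col S1_col S2_col
    using congruent_col[of 14 "special 14" "col q I" 0] congruent_col[of 16 "special 16" "col q I" 0]
      col_subset_blocks[of q I] by metis
qed

lemma young_column_blocks: "young_column y \<Longrightarrow> y \<subseteq> blocks"
  by (auto simp: young_column_def ordinary_column_def)

lemma young_exhaust:
  assumes "young_column y"
  obtains I where "y = col q I" "young_set I"
  using col_exhaust[OF young_column_blocks[OF assms], of q] assms young_col by metis

section \<open>Coordinates of roots\<close>

text \<open>Eight explicit integers in place of a function, so that contents can be computed and
  compared by rewriting.\<close>

datatype vec = Vec int int int int int int int int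

primrec root_of :: "vec \<Rightarrow> root" where
  "root_of (Vec a1 a2 a3 a4 a5 a6 a7 a8) = (\<lambda>j.
     if j = 1 then a1 else if j = 2 then a2 else if j = 3 then a3 else if j = 4 then a4
     else if j = 5 then a5 else if j = 6 then a6 else if j = 7 then a7 else if j = 8 then a8 else 0)"

definition theta :: root where "theta = root_of (Vec 2 3 4 6 5 4 3 2)"

text \<open>The node 0 acts on classical weights as the negative of the highest root.\<close>

definition node_root :: "nat \<Rightarrow> root" where
  "node_root i = (if i = 0 then - theta else simple_root i)"

definition pairing :: "nat \<Rightarrow> root \<Rightarrow> int" where
  "pairing i \<alpha> = (\<Sum>k=1..8. cartan i k * \<alpha> k)"

text \<open>The change of coordinate \<open>j\<close> when the simple root of node \<open>c\<close>
  is subtracted. For \<open>c = 0\<close> this means adding the highest root, so the coordinate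
  grows by its mark \<open>t\<close>.\<close>

definition drop_by :: "nat \<Rightarrow> nat \<Rightarrow> int \<Rightarrow> int" where
  "drop_by c j t = (if c = 0 then t else if c = j then -1 else 0)"

primrec lower_by :: "nat \<Rightarrow> vec \<Rightarrow> vec" where
  "lower_by c (Vec a1 a2 a3 a4 a5 a6 a7 a8) = Vec (a1 + drop_by c 1 2) (a2 + drop_by c 2 3)
     (a3 + drop_by c 3 4) (a4 + drop_by c 4 6) (a5 + drop_by c 5 5) (a6 + drop_by c 6 4)
     (a7 + drop_by c 7 3) (a8 + drop_by c 8 2)"

text \<open>The rows of the Cartan matrix written out. The first entry has a single term because
  node 0 is joined to node 8 only; equivalently, the highest root is the fundamental weight of node
  8.\<close>

primrec pairings :: "vec \<Rightarrow> int list" where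
  "pairings (Vec a1 a2 a3 a4 a5 a6 a7 a8) =
    [- a8, 2*a1 - a3, 2*a2 - a4, 2*a3 - a1 - a4, 2*a4 - a2 - a3 - a5, 2*a5 - a4 - a6,
     2*a6 - a5 - a7, 2*a7 - a6 - a8, 2*a8 - a7]"

lemma idx_cases: "i \<in> idx \<Longrightarrow> i \<in> {0, 1, 2, 3, 4, 5, 6, 7, 8}"
  by auto

lemma root_eqI:
  fixes \<alpha> \<beta> :: root
  assumes "\<forall>j\<in>{1, 2, 3, 4, 5, 6, 7, 8}. \<alpha> j = \<beta> j"
    and "\<And>j. j \<notin> {1, 2, 3, 4, 5, 6, 7, 8} \<Longrightarrow> \<alpha> j = \<beta> j"
  shows "\<alpha> = \<beta>"
  using assms by blast

lemma root_of_lower_by: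
  assumes "c \<in> idx"
  shows "root_of (lower_by c v) = root_of v - node_root c"
proof (rule root_eqI)
  show "\<forall>j\<in>{1, 2, 3, 4, 5, 6, 7, 8}. root_of (lower_by c v) j = (root_of v - node_root c) j"
    using idx_cases[OF assms]
    by (cases v, elim insertE)
      (simp_all add: node_root_def theta_def simple_root_def drop_by_def)
  show "root_of (lower_by c v) j = (root_of v - node_root c) j"
    if "j \<notin> {1, 2, 3, 4, 5, 6, 7, 8}" for j
    using that idx_cases[OF assms]
    by (cases v, elim insertE) (simp_all add: node_root_def theta_def simple_root_def)
qed

lemma sum_1_8: "(\<Sum>k=1..8. f k) = f 1 + f 2 + f 3 + f 4 + f 5 + f 6 + f 7 + f (8 :: nat)"
  for f :: "nat \<Rightarrow> int"
  by (simp add: eval_nat_numeral)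

lemma cartan_rows:
  "map (cartan 0) [0, 1, 2, 3, 4, 5, 6, 7, 8] = [2, 0, 0, 0, 0, 0, 0, 0, -1]"
  "map (cartan 1) [0, 1, 2, 3, 4, 5, 6, 7, 8] = [0, 2, 0, -1, 0, 0, 0, 0, 0]"
  "map (cartan 2) [0, 1, 2, 3, 4, 5, 6, 7, 8] = [0, 0, 2, 0, -1, 0, 0, 0, 0]"
  "map (cartan 3) [0, 1, 2, 3, 4, 5, 6, 7, 8] = [0, -1, 0, 2, -1, 0, 0, 0, 0]"
  "map (cartan 4) [0, 1, 2, 3, 4, 5, 6, 7, 8] = [0, 0, -1, -1, 2, -1, 0, 0, 0]"
  "map (cartan 5) [0, 1, 2, 3, 4, 5, 6, 7, 8] = [0, 0, 0, 0, -1, 2, -1, 0, 0]"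
  "map (cartan 6) [0, 1, 2, 3, 4, 5, 6, 7, 8] = [0, 0, 0, 0, 0, -1, 2, -1, 0]"
  "map (cartan 7) [0, 1, 2, 3, 4, 5, 6, 7, 8] = [0, 0, 0, 0, 0, 0, -1, 2, -1]"
  "map (cartan 8) [0, 1, 2, 3, 4, 5, 6, 7, 8] = [-1, 0, 0, 0, 0, 0, 0, -1, 2]"
  unfolding list.map list.inject
  by (intro conjI refl; simp add: cartan_def dynkin_edges_def doubleton_eq_iff)+

lemma pairing_root_of:
  assumes "i \<in> idx"
  shows "pairing i (root_of v) = pairings v ! i"
proof (cases v)
  case (Vec a1 a2 a3 a4 a5 a6 a7 a8)
  show ?thesis
    using idx_cases[OF assms] cartan_rows unfolding Vec pairing_def sum_1_8
    by (elim insertE) simp_all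
qed

section \<open>Enumeration of the columns\<close>

definition mem :: "int \<Rightarrow> int list \<Rightarrow> int \<Rightarrow> bool" where
  "mem m T n \<longleftrightarrow> n < m \<or> n \<in> set T"

text \<open>In \<open>bs\<close> the blocks known to be missing are collected: whatever rests on a
  missing block is missing as well. The survivors are the only numbers in \<open>ns\<close> that a
  down-closed set avoiding \<open>bs\<close> can contain.\<close>

primrec unblocked :: "int list \<Rightarrow> int list \<Rightarrow> int list" where
  "unblocked [] bs = []"
| "unblocked (n # ns) bs =
    (if list_ex (\<lambda>x. x \<in> set bs) (lowers n) then unblocked ns (n # bs) else n # unblocked ns bs)"

text \<open>The window has length 30 + 5. \<open>states_ok\<close> verifies that nothing survives in
  its last five places, and since no block reaches down by more than five numbers, such a gap
  excludes everything higher.\<close>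

definition candidates :: "int \<Rightarrow> int list" where
  "candidates m = unblocked (map (\<lambda>d. m + d) (1 # [2..35])) [m]"

primrec extend :: "int \<Rightarrow> int \<Rightarrow> (int list \<times> vec) list \<Rightarrow> (int list \<times> vec) list" where
  "extend m n [] = []"
| "extend m n (s # r) =
    (if list_all (mem m (fst s)) (lowers n)
     then s # (n # fst s, lower_by (colr n) (snd s)) # extend m n r else s # extend m n r)"

text \<open>The blocks below a block have smaller numbers, so one upward scan that branches at every
  block with complete support finds all down-closed sets. Each \<open>T\<close> comes out in
  decreasing order, the order used in \<open>middles\<close>.\<close>

primrec grow :: "int \<Rightarrow> int list \<Rightarrow> (int list \<times> vec) list \<Rightarrow> (int list \<times> vec) list" where
  "grow m [] r = r"
| "grow m (n # ns) r = grow m ns (extend m n r)"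

text \<open>The exceptional entries lead to the special columns:
  \<open>{..<14} \<union> {15}\<close> with 17 added is \<open>S1\<close>, and
  \<open>{..<16} \<union> {17}\<close> with 19 added is \<open>S2\<close>.\<close>

definition adds :: "int \<Rightarrow> int list \<Rightarrow> int list \<Rightarrow> int list" where
  "adds m cs T = filter (\<lambda>n. n \<notin> set T \<and> list_all (mem m T) (lowers n)) (m # cs) @
     (if m = 14 \<and> T = [15] then [17] else if m = 16 \<and> T = [17] then [19] else [])"

text \<open>Below \<open>m\<close> only five blocks can be removable, because every lower one
  carries another block still below \<open>m\<close>. The exceptional entries again lead to special
  columns: \<open>{..<16} \<union> {17}\<close> without 14 is \<open>S1\<close>, and
  \<open>{..<18} \<union> {19}\<close> without 16 is \<open>S2\<close>.\<close>

definition rems :: "int \<Rightarrow> int list \<Rightarrow> int list" where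
  "rems m T = (let xs = T @ [m - 1, m - 2, m - 3, m - 4, m - 5]
     in filter (\<lambda>n. n \<notin> set (concat (map lowers xs))) xs) @
     (if m = 16 \<and> T = [17] then [14] else if m = 18 \<and> T = [19] then [16] else [])"

text \<open>A finite test for equality of \<open>{..<m} \<union> set T\<close> and
  \<open>{..<m'} \<union> set T'\<close>: the two initial segments differ in at most five numbers,
  which are inspected one by one.\<close>

definition same_ideal :: "int \<Rightarrow> int list \<Rightarrow> int \<Rightarrow> int list \<Rightarrow> bool" where
  "same_ideal m T m' T' \<longleftrightarrow> m' \<le> m + 5 \<and> m \<le> m' + 5 \<and>
     list_all (\<lambda>d. (m + d < m' \<longrightarrow> mem m T (m + d)) \<and> (m' + d < m \<longrightarrow> mem m' T' (m' + d)))
       [0, 1, 2, 3, 4] \<and>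
     list_all (mem m T) T' \<and> list_all (mem m' T') T"

definition prefer_add :: "nat \<Rightarrow> int \<Rightarrow> int \<Rightarrow> bool" where
  "prefer_add i b n \<longleftrightarrow>
     (if i = 4 then list_ex (\<lambda>x. colr x = 5) (lowers b) else level n < level b)"

definition prefer_remove :: "nat \<Rightarrow> int \<Rightarrow> int \<Rightarrow> bool" where
  "prefer_remove i b n \<longleftrightarrow>
     (if i = 4 then list_ex (\<lambda>x. colr x = 3) (lowers b) else level b < level n)"

text \<open>
  \<open>Zero i b c m T\<close> describes the column \<open>{..<m} \<union> set T\<close> corresponding to \<open>y\<^sub>i\<close> (to \<open>\<emptyset>\<close> for
  \<open>i = 0\<close>): it is entered by adding \<open>b\<close> and left by adding \<open>c\<close>.
\<close>

datatype middle = Zero nat int int int "int list"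

text \<open>For \<open>i\<close> other than 2 and 4, \<open>c = m\<close> and \<open>b\<close> are
  consecutive i-blocks. The rule adds the higher one first, so \<open>b\<close> is present while
  \<open>c\<close> is still missing. For \<open>i = 4\<close> they are the two halves of cube 6, and
  16 comes first because it lies on a 5-block. For \<open>i = 2\<close> the string runs from
  \<open>S1\<close>, whose hole 14 is filled, to \<open>S2\<close>, where 19 has been added. The
  same two halves of cube 6 thus produce two columns of content zero: \<open>{..<17}\<close> belongs
  to node 4 and \<open>{..<16} \<union> {17}\<close> to node 2.\<close>

definition middles :: "middle list" where
  "middles = [Zero 0 33 3 3 [33, 29, 26, 23, 20, 17, 15, 14, 12, 11, 9, 8, 6, 5],
   Zero 1 21 12 12 [21, 18, 16, 14, 13],
   Zero 2 14 19 16 [17],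
   Zero 3 18 15 15 [18, 16],
   Zero 4 16 17 17 [],
   Zero 5 20 13 13 [20, 17, 15, 14],
   Zero 6 23 10 10 [23, 20, 17, 15, 14, 12, 11],
   Zero 7 26 7 7 [26, 23, 20, 17, 15, 14, 12, 11, 9, 8],
   Zero 8 29 4 4 [29, 26, 23, 20, 17, 15, 14, 12, 11, 9, 8, 6, 5]]"

definition middle_colour :: "middle \<Rightarrow> nat" where
  "middle_colour z = (case z of Zero i b c m T \<Rightarrow> i)"

definition singleton :: "'a list \<Rightarrow> bool" where
  "singleton xs = (case xs of [] \<Rightarrow> False | x # ys \<Rightarrow> ys = [])"

text \<open>
  Here \<open>p\<close> is the pairing of the content of the column \<open>{..<m} \<union> set T\<close> with a coroot, and \<open>A\<close>
  and \<open>R\<close> list its addable and removable blocks of the corresponding colour. The pairings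
  2 and -2 characterise the two ends of the string through the given middle column.
\<close>

primrec step_ok :: "int \<Rightarrow> int list \<Rightarrow> int \<Rightarrow> int list \<Rightarrow> int list \<Rightarrow> middle \<Rightarrow> bool" where
  "step_ok m T p A R (Zero i b c m' T') =
     (if p = 0 then A = [] \<and> R = []
      else if p = 1 then singleton A \<and> R = []
      else if p = -1 then A = [] \<and> singleton R
      else if p = 2 then R = [] \<and> b \<in> set A \<and> list_all (\<lambda>n. n = b \<or> prefer_add i b n) A \<and>
        list_all (\<lambda>n. n = b \<or> \<not> prefer_add i n b) A \<and> \<not> mem m T b \<and> same_ideal m (b # T) m' T'
      else if p = -2 then A = [] \<and> c \<in> set R \<and> list_all (\<lambda>n. n = c \<or> prefer_remove i c n) R \<and>
        list_all (\<lambda>n. n = c \<or> \<not> prefer_remove i n c) R \<and>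
        \<not> mem m' T' c \<and> same_ideal m T m' (c # T')
      else False)"

primrec steps_ok :: "middle list \<Rightarrow> int \<Rightarrow> int list \<Rightarrow> int list \<Rightarrow> int list \<Rightarrow> int list \<Rightarrow> bool" where
  "steps_ok [] m T A R ps = (ps = [])"
| "steps_ok (z # zs) m T A R ps =
    (step_ok m T (hd ps) (filter (\<lambda>n. colr n = middle_colour z) A)
       (filter (\<lambda>n. colr n = middle_colour z) R) z \<and> steps_ok zs m T A R (tl ps))"

text \<open>The distinctness conditions say that no colour has two addable or two removable blocks.
  They concern also the colours whose operators vanish on the column, because
  \<open>reserved\<close> refers to the block choices in these colours.\<close>

primrec is_middle :: "int \<Rightarrow> int list \<Rightarrow> int list \<Rightarrow> int list \<Rightarrow> middle \<Rightarrow> bool" where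
  "is_middle m T A R (Zero i b c m' T') =
    (if m = m' then T = T' \<and> distinct (map colr A) \<and> distinct (map colr R) \<and>
       filter (\<lambda>n. colr n = i) A = [c] \<and> filter (\<lambda>n. colr n = i) R = [b]
     else False)"

text \<open>The upper bounds single out the highest root. The condition on the height
  \<open>h\<close> provides a simple coroot whose pairing has the sign of \<open>h\<close>, the step
  of \<open>contents_induct\<close>.\<close>

primrec vec_ok :: "vec \<Rightarrow> bool" where
  "vec_ok (Vec a1 a2 a3 a4 a5 a6 a7 a8) =
    (a1 \<le> 2 \<and> a2 \<le> 3 \<and> a3 \<le> 4 \<and> a4 \<le> 6 \<and> a5 \<le> 5 \<and> a6 \<le> 4 \<and> a7 \<le> 3 \<and> a8 \<le> 2 \<and>
     (let h = a1 + a2 + a3 + a4 + a5 + a6 + a7 + a8;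
          ps = tl (pairings (Vec a1 a2 a3 a4 a5 a6 a7 a8))
      in if 0 < h then list_ex (\<lambda>p. 0 < p) ps else if h < 0 then list_ex (\<lambda>p. p < 0) ps else False))"

definition column_ok :: "int \<Rightarrow> int list \<Rightarrow> int list \<Rightarrow> int list \<Rightarrow> vec \<Rightarrow> bool" where
  "column_ok m T A R l =
    (if l = Vec 0 0 0 0 0 0 0 0 then list_ex (is_middle m T A R) middles
     else vec_ok l \<and> steps_ok middles m T A R (pairings l))"

definition state_ok :: "int \<Rightarrow> int list \<Rightarrow> int list \<times> vec \<Rightarrow> bool" where
  "state_ok m cs s = column_ok m (fst s) (adds m cs (fst s)) (rems m (fst s)) (snd s)"

definition states_ok :: "int \<Rightarrow> vec \<Rightarrow> int list \<Rightarrow> bool" where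
  "states_ok m l cs \<longleftrightarrow>
     list_all (\<lambda>n. n \<le> m + 30) cs \<and> list_all (state_ok m cs) (grow m cs [([], l)])"

primrec all_states_ok :: "int list \<Rightarrow> vec \<Rightarrow> bool" where
  "all_states_ok [] l = True"
| "all_states_ok (m # ms) l =
    (states_ok m l (candidates m) \<and> all_states_ok ms (lower_by (colr m) l))"

text \<open>The sum of \<open>node_root\<close> over the blocks 0 to 16, which normalises the
  content of \<open>{..<17}\<close>, the middle column of the 4-string, to zero.\<close>

definition start :: vec where
  "start = Vec (-1) (-1) (-2) (-3) (-2) (-2) (-1) (-1)"

lemmas check_simps = table_simps period_simps middles_def column_ok_def middle_colour_def
  singleton_def drop_by_def same_ideal_def mem_def prefer_add_def prefer_remove_def

text \<open>The lists of addable and removable blocks are supplied by hand, as \<open>adds\<close>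
  and \<open>rems\<close> are meant for down-closed sets; \<open>special_represented\<close>
  justifies them.\<close>

lemma special_columns_ok:
  "column_ok 14 [15, 17] [14] [17] (Vec 0 1 0 0 0 0 0 0)"
  "column_ok 16 [17, 19] [16] [19] (Vec 0 (-1) 0 0 0 0 0 0)"
  by (simp_all add: check_simps)

lemma middles_ok: "list_all (\<lambda>z. case z of Zero i b c m T \<Rightarrow>
    list_all (\<lambda>t. m < t \<and> list_all (mem m T) (lowers t)) T \<and> 0 \<le> m \<and> m < 30 \<and>
    distinct T \<and> fold (\<lambda>n. lower_by (colr n)) ([0..m - 1] @ T) start = Vec 0 0 0 0 0 0 0 0) middles"
  by (simp add: check_simps upto.simps start_def)

text \<open>The one large computation. Every ordinary column has a shift whose first missing number
  lies in 0 to 29, so all of them are covered.\<close>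

lemma all_states_ok: "all_states_ok residues start"
  by (simp add: check_simps start_def candidates_def states_ok_def state_ok_def adds_def rems_def)

section \<open>Addable and removable blocks in terms of numbers\<close>

definition ideal :: "int \<Rightarrow> int list \<Rightarrow> int set" where
  "ideal m T = {..<m} \<union> set T"

lemma mem_ideal: "mem m T n \<longleftrightarrow> n \<in> ideal m T"
  by (simp add: mem_def ideal_def)

definition add_set :: "int set \<Rightarrow> int set" where
  "add_set I = {b. b \<notin> I \<and> young_set (insert b I)}"

definition rem_set :: "int set \<Rightarrow> int set" where
  "rem_set I = {b \<in> I. young_set (I - {b})}"

text \<open>Makes the description of a column unique up to the order of \<open>T\<close>:
  \<open>m\<close> is the first missing number, and its range fixes the shift.\<close>

definition normal :: "int \<Rightarrow> int list \<Rightarrow> bool" where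
  "normal m T \<longleftrightarrow> 0 \<le> m \<and> m < 30 \<and> distinct T \<and> (\<forall>t\<in>set T. m < t)"

lemma closedD: "closed I \<Longrightarrow> n \<in> I \<Longrightarrow> x \<in> set (lowers n) \<Longrightarrow> x \<in> I"
  by (auto simp: closed_def)

lemma not_self_lower: "n \<notin> set (lowers n)"
  using lowers_range[of n n] by auto

lemma closed_insert:
  assumes "closed I"
  shows "closed (insert b I) \<longleftrightarrow> set (lowers b) \<subseteq> I"
  using assms not_self_lower[of b] unfolding closed_def by blast

lemma closed_remove:
  assumes "closed I" "b \<in> I"
  shows "closed (I - {b}) \<longleftrightarrow> (\<forall>a\<in>I. b \<notin> set (lowers a))"
  using assms not_self_lower[of b] unfolding closed_def by blast

lemma closed_ideal: "closed (ideal m T) \<longleftrightarrow> (\<forall>t\<in>set T. set (lowers t) \<subseteq> ideal m T)"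
  using lowers_range unfolding closed_def ideal_def by fastforce

lemma bdd_above_ideal [simp]: "bdd_above (ideal m T)"
  by (simp add: ideal_def bdd_above_finite)

lemma ideal_nonempty [simp]: "ideal m T \<noteq> {}"
  by (auto simp: ideal_def)

lemma ideal_column_ideal [simp]: "ideal_column (ideal m T) \<longleftrightarrow> closed (ideal m T)"
  by (simp add: ideal_column_def)

lemma ideal_column_insert:
  assumes "ideal_column I"
  shows "ideal_column (insert b I) \<longleftrightarrow> set (lowers b) \<subseteq> I"
  using assms closed_insert unfolding ideal_column_def by auto

lemma ideal_column_remove:
  assumes "ideal_column I" "b \<in> I"
  shows "ideal_column (I - {b}) \<longleftrightarrow> (\<forall>a\<in>I. b \<notin> set (lowers a))"
proof -
  \<comment> \<open>A block below \<open>b\<close> survives the removal, so the set cannot become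
    empty.\<close>
  obtain x where "x \<in> set (lowers b)" using lowers_nonempty[of b] by fastforce
  then have "x \<in> I - {b}" using assms lowers_range[of x b] by (auto simp: ideal_column_def closed_def)
  moreover have "bdd_above (I - {b})"
    using assms(1) bdd_above_mono[of I "I - {b}"] by (simp add: ideal_column_def Diff_subset)
  ultimately show ?thesis using closed_remove[of I b] assms unfolding ideal_column_def by blast
qed

lemma special_ideal: "special a = ideal a [a + 1, a + 3]"
  by (simp add: special_def ideal_def)

text \<open>Both special columns lack a block below one of their topmost blocks.\<close>

lemma special_lowers:
  assumes "a \<in> {14, 16}"
  shows "set (lowers (a + 3)) = {a, a + 1}" "set (lowers (a + 1)) \<subseteq> {..<a}"
  using assms by (auto simp: table_simps)

lemma special_block:
  assumes "closed I" "a \<in> {14, 16}" "a + 3 + 30 * k \<in> I"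
  shows "a + 30 * k \<in> I"
proof -
  have "a + 30 * k \<in> set (lowers (a + 3 + 30 * k))"
    using special_lowers(1)[OF assms(2)] by simp
  then show ?thesis using closedD[OF assms(1,3)] by blast
qed

text \<open>The hole lies below the block a + 3. A down-closed set without the hole cannot contain
  that block, so it must be the one just inserted.\<close>

lemma special_add:
  assumes "closed I" "a \<in> {14, 16}"
  shows "b \<notin> I \<and> insert b I = sh k (special a) \<longleftrightarrow> b = a + 3 + 30 * k \<and> I = sh k (ideal a [a + 1])"
proof
  assume H: "b \<notin> I \<and> insert b I = sh k (special a)"
  have "a + 3 + 30 * k \<in> insert b I" "a + 30 * k \<notin> insert b I"
    using H by (simp_all add: mem_sh special_def)
  then have b: "b = a + 3 + 30 * k" using special_block[OF assms, of k] by auto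
  have "I = insert b I - {b}" using H by blast
  also have "\<dots> = sh k (special a) - {b}" by (simp only: conjunct2[OF H])
  also have "\<dots> = sh k (ideal a [a + 1])"
    unfolding b by (auto simp: mem_sh special_ideal ideal_def)
  finally show "b = a + 3 + 30 * k \<and> I = sh k (ideal a [a + 1])" using b by simp
qed (auto simp: mem_sh special_ideal ideal_def)

text \<open>The down-closed set contains a + 3 and therefore also the block below it, so the hole
  must be what was removed.\<close>

lemma special_remove:
  assumes "closed I" "a \<in> {14, 16}"
  shows "b \<in> I \<and> I - {b} = sh k (special a) \<longleftrightarrow>
    b = a + 30 * k \<and> I = sh k (ideal (a + 2) [a + 3])"
proof
  assume H: "b \<in> I \<and> I - {b} = sh k (special a)"
  have "a + 3 + 30 * k \<in> I - {b}" "a + 30 * k \<notin> I - {b}"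
    using H by (simp_all add: mem_sh special_def)
  then have b: "b = a + 30 * k" using special_block[OF assms, of k] by auto
  have "I = insert b (I - {b})" using H by blast
  also have "\<dots> = insert b (sh k (special a))" by (simp only: conjunct2[OF H])
  also have "\<dots> = sh k (ideal (a + 2) [a + 3])"
    unfolding b by (auto simp: mem_sh special_ideal ideal_def)
  finally show "b = a + 30 * k \<and> I = sh k (ideal (a + 2) [a + 3])" using b by simp
qed (auto simp: mem_sh special_ideal ideal_def)

text \<open>On both sides the least missing number is determined by the set, and the rest by what
  lies above it.\<close>

lemma ideal_eq_shift:
  assumes eq: "ideal m T = sh k (ideal m' T')"
    and T: "\<forall>t\<in>set T. m < t" and T': "\<forall>t\<in>set T'. m' < t"
  shows "m = m' + 30 * k" "set T = (\<lambda>t. t + 30 * k) ` set T'"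
proof -
  have mem: "n < m \<or> n \<in> set T \<longleftrightarrow> n - 30 * k < m' \<or> n - 30 * k \<in> set T'" for n
    using eq by (auto simp: set_eq_iff mem_sh ideal_def)
  show m: "m = m' + 30 * k" using mem[of m] mem[of "m' + 30 * k"] T T' by force
  have "t \<in> set T \<longleftrightarrow> t - 30 * k \<in> set T'" for t using mem[of t] T T' m by force
  then show "set T = (\<lambda>t. t + 30 * k) ` set T'"
    unfolding sh_def[symmetric] by (simp add: set_eq_iff mem_sh)
qed

lemma ideal_eq_normal:
  assumes "ideal m T = sh k (ideal m' T')" "normal m T" "0 \<le> m'" "m' < 30" "\<forall>t\<in>set T'. m' < t"
  shows "k = 0" "m = m'" "set T = set T'"
proof -
  have "m = m' + 30 * k" "set T = (\<lambda>t. t + 30 * k) ` set T'"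
    using ideal_eq_shift assms unfolding normal_def by metis+
  moreover have "0 \<le> m" "m < 30" using assms(2) by (simp_all add: normal_def)
  ultimately show "k = 0" using assms(3,4) by presburger
  moreover note \<open>m = m' + 30 * k\<close> \<open>set T = (\<lambda>t. t + 30 * k) ` set T'\<close>
  ultimately show "m = m'" "set T = set T'" by simp_all
qed

lemma distinct_singleton_set: "distinct T \<Longrightarrow> set T = {x} \<Longrightarrow> T = [x]"
  by (cases T; cases "tl T") auto

lemma ideal_eq_singleton:
  assumes "normal m T" "0 \<le> a" "a < 30"
  shows "ideal m T = sh k (ideal a [a + 1]) \<longleftrightarrow> k = 0 \<and> m = a \<and> T = [a + 1]"
proof
  assume "ideal m T = sh k (ideal a [a + 1])"
  from ideal_eq_normal[OF this assms] have "k = 0" "m = a" "set T = {a + 1}" by auto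
  moreover have "distinct T" using assms(1) by (simp add: normal_def)
  ultimately show "k = 0 \<and> m = a \<and> T = [a + 1]"
    using distinct_singleton_set by simp
qed simp

text \<open>All neighbours of a special column are therefore ordinary. Filling the hole leaves one
  block above the first gap, where a special column has two. Otherwise the hole stays the first gap,
  the shift is zero because 14 and 16 differ by less than 30, and there is no room for a further
  block.\<close>

lemma special_pair:
  assumes b: "b \<notin> special a" and a: "a \<in> {14, 16}" "a' \<in> {14, 16}"
  shows "insert b (special a) \<noteq> sh k (special a')"
proof
  assume eq: "insert b (special a) = sh k (special a')"
  show False
  proof (cases "b = a")
    case True
    have "insert b (special a) = ideal (a + 2) [a + 3]"
      using True by (auto simp: special_def ideal_def)
    then have "ideal (a + 2) [a + 3] = sh k (ideal a' [a' + 1, a' + 3])"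
      using eq special_ideal by simp
    then have "set [a + 3] = (\<lambda>t. t + 30 * k) ` set [a' + 1, a' + 3]"
      by (rule ideal_eq_shift(2)) auto
    then show False by auto
  next
    case False
    then have less: "a < b" using b by (auto simp: special_def)
    have e: "ideal a [b, a + 1, a + 3] = sh k (ideal a' [a' + 1, a' + 3])"
      using eq unfolding special_ideal by (auto simp: ideal_def)
    from ideal_eq_shift[OF e] less
    have s: "a = a' + 30 * k" "set [b, a + 1, a + 3] = (\<lambda>t. t + 30 * k) ` set [a' + 1, a' + 3]"
      by auto
    have "k = 0" using s(1) a by auto
    then have "b \<in> {a + 1, a + 3}" using s by auto
    then show False using b by (simp add: special_def)
  qed
qed

lemma special_pair_remove:
  assumes "b \<in> special a" "a \<in> {14, 16}" "a' \<in> {14, 16}"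
  shows "special a - {b} \<noteq> sh k (special a')"
proof
  assume "special a - {b} = sh k (special a')"
  then have eq: "special a = insert b (sh k (special a'))" and b: "b \<notin> sh k (special a')"
    using assms(1) by blast+
  have "sh (- k) (special a) = insert (b - 30 * k) (special a')" unfolding eq
    by (auto simp: mem_sh)
  moreover have "b - 30 * k \<notin> special a'" using b by (simp add: mem_sh)
  ultimately show False using special_pair[OF _ assms(3,2)] by metis
qed

lemma young_set_special: "a \<in> {14, 16} \<Longrightarrow> young_set (special a)"
  using sh_0 unfolding young_set_def by blast

lemma add_set_special:
  assumes a: "a \<in> {14, 16}"
  shows "add_set (special a) = {a}"
proof (intro equalityI subsetI)
  fix b assume "b \<in> add_set (special a)"
  then have b: "b \<notin> special a" "closed (insert b (special a))"
    using special_pair[OF _ a] unfolding add_set_def young_set_def ideal_column_def by blast+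
  have "a \<in> insert b (special a)"
    using special_block[OF b(2) a, of 0] by (simp add: special_def)
  then show "b \<in> {a}" by (simp add: special_def)
next
  fix b assume "b \<in> {a}"
  moreover have "insert a (special a) = ideal (a + 2) [a + 3]"
    by (auto simp: special_def ideal_def)
  moreover have "closed (ideal (a + 2) [a + 3])"
    unfolding closed_ideal using special_lowers(1)[OF a] by (simp add: ideal_def)
  ultimately show "b \<in> add_set (special a)"
    by (simp add: add_set_def young_set_def) (simp add: special_def)
qed

lemma rem_set_special:
  assumes a: "a \<in> {14, 16}"
  shows "rem_set (special a) = {a + 3}"
proof (intro equalityI subsetI)
  fix b assume "b \<in> rem_set (special a)"
  then have b: "b \<in> special a" "closed (special a - {b})"
    using special_pair_remove[OF _ a] unfolding rem_set_def young_set_def ideal_column_def by blast+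
  have "a \<notin> special a - {b}" by (simp add: special_def)
  then have "a + 3 \<notin> special a - {b}" using special_block[OF b(2) a, of 0] by auto
  then show "b \<in> {a + 3}" by (simp add: special_def)
next
  fix b assume "b \<in> {a + 3}"
  moreover have "special a - {a + 3} = ideal a [a + 1]"
    by (auto simp: special_def ideal_def)
  moreover have "closed (ideal a [a + 1])"
    unfolding closed_ideal using special_lowers(2)[OF a] by (auto simp: ideal_def)
  ultimately show "b \<in> rem_set (special a)"
    by (simp add: rem_set_def young_set_def) (simp add: special_def)
qed

section \<open>Completeness of the enumeration\<close>

lemma unblocked_complete:
  assumes "closed I"
  shows "\<forall>b\<in>set bs. b \<notin> I \<Longrightarrow> n \<in> set ns \<Longrightarrow> n \<in> I \<Longrightarrow> n \<in> set (unblocked ns bs)"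
proof (induction ns arbitrary: bs)
  case (Cons a ns)
  show ?case
  proof (cases "list_ex (\<lambda>x. x \<in> set bs) (lowers a)")
    case True
    then have "a \<notin> I" using closedD[OF assms] Cons.prems(1) by (auto simp: list_ex_iff)
    then show ?thesis using Cons True by auto
  next
    case False
    then show ?thesis using Cons by auto
  qed
qed simp

lemma set_unblocked: "set (unblocked ns bs) \<subseteq> set ns"
  by (induction ns arbitrary: bs) auto

lemma sorted_unblocked: "sorted_wrt (<) ns \<Longrightarrow> sorted_wrt (<) (unblocked ns bs)"
proof (induction ns arbitrary: bs)
  case (Cons a ns)
  then show ?case using set_unblocked[of ns bs] by auto
qed simp

lemma window_eq: "map (\<lambda>d. m + d) (1 # [2..35]) = [m + 1..m + 35]"
proof -
  have "map (\<lambda>d. m + d) [1..35] = [m + 1..m + 35]"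
    by (rule nth_equalityI) simp_all
  then show ?thesis by (simp add: upto.simps[of 1 35])
qed

lemma candidates_complete:
  assumes "closed I" "m \<notin> I" "n \<in> I" "m < n" "n \<le> m + 35"
  shows "n \<in> set (candidates m)"
  unfolding candidates_def window_eq
  using assms by (intro unblocked_complete[of I]) auto

lemma candidates_range: "n \<in> set (candidates m) \<Longrightarrow> m < n"
  and candidates_sorted: "sorted_wrt (<) (candidates m)"
  unfolding candidates_def window_eq
  using set_unblocked[of "[m + 1..m + 35]" "[m]"] sorted_unblocked by auto

lemma mem_adds:
  assumes n: "normal m T" and c: "closed (ideal m T)" and b: "\<forall>t\<in>set T. t \<le> m + 30"
  shows "set (adds m (candidates m) T) = add_set (ideal m T)"
proof -
  let ?I = "ideal m T"
  have col: "ideal_column ?I" using c by simp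
  have m: "m \<notin> ?I" using n by (auto simp: normal_def ideal_def)
  have reg: "n \<in> set (filter (\<lambda>n. n \<notin> set T \<and> list_all (mem m T) (lowers n)) (m # candidates m))
      \<longleftrightarrow> n \<notin> ?I \<and> set (lowers n) \<subseteq> ?I" (is "?L \<longleftrightarrow> ?R") for n
  proof -
    have L: "?L \<longleftrightarrow> (n = m \<or> n \<in> set (candidates m)) \<and> n \<notin> set T \<and> set (lowers n) \<subseteq> ?I"
      by (simp only: set_filter mem_Collect_eq list.set insert_iff list_all_iff Ball_def mem_ideal subset_iff)
    show ?thesis
    proof
      assume ?L
      then show ?R unfolding L using candidates_range[of n m] by (fastforce simp: ideal_def)
    next
      assume r: ?R
      have "n = m \<or> n \<in> set (candidates m)"
      proof (cases "n = m")
        case False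
        with r have "m < n" by (auto simp: ideal_def)
        \<comment> \<open>An addable block rests on a block of the column. The latter has number at
          most m + 30, so the window of \<open>candidates\<close> contains the former.\<close>
        obtain x where x: "x \<in> set (lowers n)" using lowers_nonempty[of n] by fastforce
        then have "x \<in> ?I" using r by blast
        then have "x \<le> m + 30" using b by (auto simp: ideal_def)
        then have "n \<le> m + 35" using lowers_range[OF x] by simp
        then show ?thesis using \<open>m < n\<close> m r closed_insert[OF c, of n] False
          by (intro disjI2 candidates_complete[of "insert n ?I"]) auto
      qed simp
      then show ?L unfolding L using r by (auto simp: ideal_def)
    qed
  qed
  note eqs = ideal_eq_singleton[OF n]
  have "n \<in> add_set ?I \<longleftrightarrow> (n \<notin> ?I \<and> set (lowers n) \<subseteq> ?I) \<or> (n = 17 \<and> m = 14 \<and> T = [15]) \<or>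
      (n = 19 \<and> m = 16 \<and> T = [17])" for n
  proof -
    have "n \<in> add_set ?I \<longleftrightarrow> (n \<notin> ?I \<and> set (lowers n) \<subseteq> ?I) \<or>
        (\<exists>k. n \<notin> ?I \<and> insert n ?I = sh k (special 14)) \<or> (\<exists>k. n \<notin> ?I \<and> insert n ?I = sh k (special 16))"
      unfolding add_set_def young_set_def ideal_column_insert[OF col] by blast
    then show ?thesis using special_add[OF c, of 14] special_add[OF c, of 16]
      eqs[of 14] eqs[of 16] by auto
  qed
  moreover have "n \<in> set (if m = 14 \<and> T = [15] then [17] else if m = 16 \<and> T = [17] then [19] else [])
      \<longleftrightarrow> (n = 17 \<and> m = 14 \<and> T = [15]) \<or> (n = 19 \<and> m = 16 \<and> T = [17])" for n :: int
    by auto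
  ultimately show ?thesis
    unfolding adds_def set_append set_eq_iff Un_iff reg by blast
qed

lemma mem_rems:
  assumes n: "normal m T" and c: "closed (ideal m T)"
  shows "set (rems m T) = rem_set (ideal m T)"
proof -
  let ?I = "ideal m T" and ?xs = "T @ [m - 1, m - 2, m - 3, m - 4, m - 5]"
  have col: "ideal_column ?I" using c by simp
  have xs: "x \<in> set ?xs \<longleftrightarrow> x \<in> ?I \<and> m - 5 \<le> x" for x
    using n by (auto simp: ideal_def normal_def)
  have reg: "x \<in> set (filter (\<lambda>n. n \<notin> set (concat (map lowers ?xs))) ?xs)
      \<longleftrightarrow> x \<in> ?I \<and> (\<forall>a\<in>?I. x \<notin> set (lowers a))" (is "?L \<longleftrightarrow> ?R") for x
  proof -
    have L: "?L \<longleftrightarrow> x \<in> set ?xs \<and> (\<forall>a\<in>set ?xs. x \<notin> set (lowers a))"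
      by (simp only: set_filter mem_Collect_eq set_concat set_map) blast
    show ?thesis
    proof
      assume ?L
      then have l: "x \<in> ?I" "m - 5 \<le> x" "\<forall>a\<in>set ?xs. x \<notin> set (lowers a)"
        unfolding L xs by blast+
      have "x \<notin> set (lowers a)" if a: "a \<in> ?I" for a
      proof (cases "m - 5 \<le> a")
        case True
        then show ?thesis using l(3) a xs by blast
      next
        case False
        then show ?thesis using lowers_range[of x a] l(2) by linarith
      qed
      then show ?R using l(1) by blast
    next
      assume r: ?R
      obtain a where a: "x < a" "a \<le> x + 5" "x \<in> set (lowers a)" using uppers_exist[of x] by blast
      then have "\<not> a < m" using r by (auto simp: ideal_def)
      then have "x \<in> set ?xs" using r xs a(2) by simp
      then show ?L unfolding L using r xs by blast
    qed
  qed
  note eqs = ideal_eq_singleton[OF n]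
  have "x \<in> rem_set ?I \<longleftrightarrow> (x \<in> ?I \<and> (\<forall>a\<in>?I. x \<notin> set (lowers a))) \<or>
      (x = 14 \<and> m = 16 \<and> T = [17]) \<or> (x = 16 \<and> m = 18 \<and> T = [19])" for x
  proof -
    have "x \<in> rem_set ?I \<longleftrightarrow> (x \<in> ?I \<and> (\<forall>a\<in>?I. x \<notin> set (lowers a))) \<or>
        (\<exists>k. x \<in> ?I \<and> ?I - {x} = sh k (special 14)) \<or> (\<exists>k. x \<in> ?I \<and> ?I - {x} = sh k (special 16))"
      unfolding rem_set_def young_set_def using ideal_column_remove[OF col] by blast
    then show ?thesis using special_remove[OF c, of 14] special_remove[OF c, of 16]
      eqs[of 16] eqs[of 18] by auto
  qed
  moreover have "x \<in> set (if m = 16 \<and> T = [17] then [14] else if m = 18 \<and> T = [19] then [16] else [])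
      \<longleftrightarrow> (x = 14 \<and> m = 16 \<and> T = [17]) \<or> (x = 16 \<and> m = 18 \<and> T = [19])" for x :: int
    by auto
  ultimately show ?thesis
    unfolding rems_def Let_def set_append set_eq_iff Un_iff reg by blast
qed

text \<open>Up to m + 35 the computed candidates decide. A block beyond that rests on one at most
  five lower, which is still above m + 30 and excluded by induction.\<close>

lemma vanishing_above:
  assumes c: "closed I" and x: "x \<notin> I" and m: "x = m + 30 * k" "0 \<le> m" "m < 30"
    and n: "x + 30 < n"
  shows "n \<notin> I"
proof -
  have cand: "list_all (\<lambda>n. n \<le> m + 30) (candidates m)"
  proof -
    have "\<exists>l. states_ok m l (candidates m)" if "all_states_ok ms v" "m \<in> set ms" for ms v
      using that by (induction ms arbitrary: v) auto
    then show ?thesis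
      using all_states_ok residue_cases[OF m(2,3)] unfolding states_ok_def by blast
  qed
  define J where "J = sh (-k) I"
  have J: "closed J" "m \<notin> J" using c x m(1) unfolding J_def closed_sh by (simp_all add: mem_sh)
  have "\<not> (m + 30 < j \<and> j \<in> J)" for j
  proof (induction "nat (j - m)" arbitrary: j rule: less_induct)
    case less
    show ?case
    proof
      assume j: "m + 30 < j \<and> j \<in> J"
      show False
      proof (cases "j \<le> m + 35")
        case True
        then have "j \<in> set (candidates m)" using candidates_complete[OF J, of j] j by simp
        then show False using cand j by (auto simp: list_all_iff)
      next
        case False
        obtain y where y: "y \<in> set (lowers j)" using lowers_nonempty[of j] by fastforce
        then have "y \<in> J" "j - 5 \<le> y" "y < j"
          using closedD[OF J(1)] j lowers_range[OF y] by auto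
        then show False using less[of y] False by simp
      qed
    qed
  qed
  from this[of "n - 30 * k"] show ?thesis using n m(1) by (simp add: J_def mem_sh)
qed

text \<open>A least missing number exists: below \<open>y - 30\<close>, for any \<open>y\<close> in
  the set, nothing can be missing by \<open>vanishing_above\<close>, so the search is confined to a
  finite interval.\<close>

lemma ideal_column_missing:
  assumes "ideal_column I"
  obtains x where "x \<notin> I" "{..<x} \<subseteq> I"
proof -
  obtain y where y: "y \<in> I" using assms by (auto simp: ideal_column_def)
  obtain M where M: "\<forall>n\<in>I. n \<le> M"
    using assms by (auto simp: ideal_column_def bdd_above_def)
  have low: "n \<in> I" if "n < y - 30" for n
  proof (rule ccontr)
    assume "n \<notin> I"
    moreover obtain r q where "n = r + 30 * q" "0 \<le> r" "r < 30" by (rule obtain_residue)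
    ultimately show False
      using vanishing_above[of I n r q y] that y assms by (auto simp: ideal_column_def)
  qed
  define A where "A = {y - 31..M + 1} - I"
  have "M + 1 \<in> A" using M y unfolding A_def by force
  moreover have "finite A" by (simp add: A_def)
  ultimately have min: "Min A \<in> A" "\<And>a. a \<in> A \<Longrightarrow> Min A \<le> a" by (auto intro: Min_in)
  show ?thesis
  proof (rule that[of "Min A"])
    show "Min A \<notin> I" using min(1) by (simp add: A_def)
    show "{..<Min A} \<subseteq> I"
    proof
      fix n assume n: "n \<in> {..<Min A}"
      show "n \<in> I"
      proof (rule ccontr)
        assume "n \<notin> I"
        moreover from this have "y - 31 \<le> n" using low[of n] by force
        moreover have "n \<le> M + 1" using n min(2)[OF \<open>M + 1 \<in> A\<close>] by simp
        ultimately have "n \<in> A" by (simp add: A_def)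
        then show False using min(2) n by force
      qed
    qed
  qed
qed

lemma set_extend: "s \<in> set r \<Longrightarrow> s \<in> set (extend m n r)"
  by (induction r) auto

lemma extend_new:
  "(T, l) \<in> set r \<Longrightarrow> list_all (mem m T) (lowers n) \<Longrightarrow>
     (n # T, lower_by (colr n) l) \<in> set (extend m n r)"
  by (induction r) auto

lemma extend_cases:
  "s \<in> set (extend m n r) \<Longrightarrow> s \<in> set r \<or> (\<exists>T l. (T, l) \<in> set r \<and>
     list_all (mem m T) (lowers n) \<and> s = (n # T, lower_by (colr n) l))"
proof (induction r)
  case (Cons u r)
  then show ?case by (cases u) (auto split: if_splits)
qed simp

text \<open>Follow the branch that takes a number exactly when it lies in \<open>I\<close>. As the
  scan goes upwards, the support of the next block has been decided before, so this branch is never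
  refused.\<close>

lemma grow_complete:
  assumes c: "closed I" and m: "m \<notin> I"
  shows "sorted_wrt (<) ns \<Longrightarrow> (T0, l0) \<in> set r \<Longrightarrow> set T0 \<subseteq> I \<Longrightarrow>
    I \<inter> {m..} \<subseteq> set T0 \<union> set ns \<Longrightarrow> \<exists>T l. (T, l) \<in> set (grow m ns r) \<and> set T0 \<subseteq> set T \<and>
    set T \<subseteq> I \<and> I \<inter> {m..} \<subseteq> set T"
proof (induction ns arbitrary: r T0 l0)
  case (Cons n ns)
  show ?case
  proof (cases "n \<in> I")
    case True
    have "list_all (mem m T0) (lowers n)"
      unfolding list_all_iff mem_def
    proof
      fix x assume x: "x \<in> set (lowers n)"
      then have "x \<in> I" using closedD[OF c True] by blast
      moreover have "x \<notin> set (n # ns)" using Cons.prems(1) lowers_range[OF x] by force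
      ultimately show "x < m \<or> x \<in> set T0" using Cons.prems(4) by force
    qed
    from extend_new[OF Cons.prems(2) this]
    have "\<exists>T l. (T, l) \<in> set (grow m ns (extend m n r)) \<and> set (n # T0) \<subseteq> set T \<and>
        set T \<subseteq> I \<and> I \<inter> {m..} \<subseteq> set T"
      using True Cons.prems by (intro Cons.IH) auto
    then show ?thesis by auto
  next
    case False
    then have "\<exists>T l. (T, l) \<in> set (grow m ns (extend m n r)) \<and> set T0 \<subseteq> set T \<and>
        set T \<subseteq> I \<and> I \<inter> {m..} \<subseteq> set T"
      using Cons.prems by (intro Cons.IH[OF _ set_extend[OF Cons.prems(2)]]) auto
    then show ?thesis by simp
  qed
qed auto

section \<open>Contents\<close>

text \<open>
  The weight of a column is, up to the null root, a constant minus the sum of the simple roots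
  of its blocks. Truncating the infinite sum at a multiple of 30 makes it well defined, because
  every 30 consecutive blocks add up to the null root.
\<close>

definition content_from :: "int \<Rightarrow> int set \<Rightarrow> root" where
  "content_from k I = root_of start - (\<Sum>n \<in> I \<inter> {30 * k..}. node_root (colr n))"

definition content_set :: "int set \<Rightarrow> root" where
  "content_set I = content_from (SOME k. {..<30 * k} \<subseteq> I) I"

definition content :: "block set \<Rightarrow> root" where
  "content y = content_set {n. blk n \<in> y}"

lemma root_of_fold:
  "root_of (fold (\<lambda>n. lower_by (colr n)) ns v) =
     root_of v - sum_list (map (\<lambda>n. node_root (colr n)) ns)"
  by (induction ns arbitrary: v) (simp_all add: root_of_lower_by[OF colr_idx] algebra_simps)

text \<open>The null root vanishes: the colours 1 to 8 contribute the highest root and the single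
  0-block contributes its negative. It is verified by folding one period, which returns
  \<open>start\<close> to itself.\<close>

lemma period_sum: "(\<Sum>n\<in>{30 * k..<30 * (k + 1)}. node_root (colr n)) = 0"
proof -
  have "fold (\<lambda>n. lower_by (colr n)) [0..29] start = start"
    by (simp add: upto.simps table_simps start_def drop_by_def)
  with root_of_fold[of "[0..29]" start]
  have "sum_list (map (\<lambda>n. node_root (colr n)) [0..29]) = 0" by (metis diff_self diff_diff_eq2
        add_diff_cancel_left' cancel_comm_monoid_add_class.diff_cancel diff_eq_eq add_cancel_left_right)
  moreover have "sum_list (map (\<lambda>n. node_root (colr n)) [0..29]) =
      (\<Sum>n\<in>{0..29}. node_root (colr n))"
    by (simp add: sum_list_distinct_conv_sum_set)
  moreover have "(\<Sum>n\<in>{30 * k..<30 * (k + 1)}. node_root (colr n)) =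
      (\<Sum>n\<in>{0..29}. node_root (colr n))"
    by (rule sum.reindex_bij_witness[of _ "\<lambda>n. n + 30 * k" "\<lambda>n. n - 30 * k"])
      (use colr_shift[of "n - 30 * k" k for n] in auto)
  ultimately show ?thesis by simp
qed

lemma finite_tail: "bdd_above I \<Longrightarrow> finite (I \<inter> {a :: int..})"
proof -
  assume "bdd_above I"
  then obtain M where "\<forall>n\<in>I. n \<le> M" unfolding bdd_above_def by blast
  then have "I \<inter> {a..} \<subseteq> {a..M}" by auto
  then show ?thesis by (rule finite_subset) simp
qed

lemma content_from_mono:
  assumes b: "bdd_above I" and "k \<le> k'"
  shows "{..<30 * k'} \<subseteq> I \<Longrightarrow> content_from k I = content_from k' I"
  using \<open>k \<le> k'\<close>
proof (induction k' rule: int_ge_induct)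
  case (step k')
  have "I \<inter> {30 * k'..} = {30 * k'..<30 * (k' + 1)} \<union> I \<inter> {30 * (k' + 1)..}"
    using step.prems by auto
  moreover have "{30 * k'..<30 * (k' + 1)} \<inter> (I \<inter> {30 * (k' + 1)..}) = {}" by auto
  ultimately have "(\<Sum>n \<in> I \<inter> {30 * k'..}. node_root (colr n)) =
      (\<Sum>n\<in>{30 * k'..<30 * (k' + 1)}. node_root (colr n)) +
      (\<Sum>n \<in> I \<inter> {30 * (k' + 1)..}. node_root (colr n))"
    using finite_tail[OF b] by (simp add: sum.union_disjoint)
  then have "content_from k' I = content_from (k' + 1) I"
    unfolding period_sum content_from_def by simp
  moreover have "{..<30 * k'} \<subseteq> I" using step.prems by auto
  ultimately show ?case using step.IH by simp
qed simp

lemma content_set_eq: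
  assumes "bdd_above I" "{..<30 * k} \<subseteq> I"
  shows "content_set I = content_from k I"
proof -
  have "{..<30 * (SOME k. {..<30 * k} \<subseteq> I)} \<subseteq> I"
    using someI[of "\<lambda>k. {..<30 * k} \<subseteq> I"] assms(2) by blast
  then show ?thesis unfolding content_set_def
    using content_from_mono[OF assms(1)] assms(2) by (metis linear)
qed

lemma content_from_sh: "content_from (k + q) (sh q I) = content_from k I"
proof -
  have "(\<Sum>n \<in> sh q I \<inter> {30 * (k + q)..}. node_root (colr n)) =
      (\<Sum>n \<in> I \<inter> {30 * k..}. node_root (colr n))"
    by (rule sum.reindex_bij_witness[of _ "\<lambda>n. n + 30 * q" "\<lambda>n. n - 30 * q"])
      (use colr_shift[of "n - 30 * q" q for n] in \<open>auto simp: mem_sh\<close>)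
  then show ?thesis by (simp add: content_from_def)
qed

lemma content_col:
  assumes "bdd_above I" "{..<30 * k} \<subseteq> I"
  shows "content (col q I) = content_from k I"
proof -
  have "{n. blk n \<in> col q I} = sh q I" by (auto simp: mem_sh)
  moreover have "{..<30 * (k + q)} \<subseteq> sh q I"
    using subsetD[OF assms(2)] by (auto simp: mem_sh)
  ultimately show ?thesis using content_set_eq[of "sh q I" "k + q"] assms(1) content_from_sh
    by (simp add: content_def)
qed

lemma content_from_insert:
  assumes "bdd_above I" "b \<notin> I" "30 * k \<le> b"
  shows "content_from k (insert b I) = content_from k I - node_root (colr b)"
proof -
  have "insert b I \<inter> {30 * k..} = insert b (I \<inter> {30 * k..})" using assms(3) by auto
  then show ?thesis
    using finite_tail[OF assms(1), of "30 * k"] assms(2) by (simp add: content_from_def algebra_simps)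
qed

lemma content_insert:
  assumes "bdd_above I" "{..<30 * k} \<subseteq> I" "b \<notin> I"
  shows "content (col q (insert b I)) = content (col q I) - node_root (colr b)"
proof -
  have "30 * k \<le> b" using assms(2,3) by force
  moreover have "{..<30 * k} \<subseteq> insert b I" using assms(2) by blast
  moreover have "bdd_above (insert b I)" using assms(1) by simp
  ultimately show ?thesis
    using content_col assms content_from_insert by metis
qed

section \<open>The columns up to translation\<close>

definition base_content :: "int \<Rightarrow> root" where
  "base_content m = content_from 0 {..<m}"

lemma base_content_step: "0 \<le> m \<Longrightarrow> base_content (m + 1) = base_content m - node_root (colr m)"
proof -
  assume "0 \<le> m"
  moreover have "{..<m + 1} = insert m {..<m}" by auto
  ultimately show ?thesis unfolding base_content_def using content_from_insert[of "{..<m}" m 0]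
    by simp
qed

lemma states_okD:
  "all_states_ok ms l \<Longrightarrow> ms = [a..b] \<Longrightarrow> root_of l = base_content a \<Longrightarrow> 0 \<le> a \<Longrightarrow> m \<in> set ms \<Longrightarrow>
     \<exists>l'. root_of l' = base_content m \<and> states_ok m l' (candidates m)"
proof (induction ms arbitrary: l a)
  case (Cons n ns)
  then have n: "n = a" "ns = [a + 1..b]"
    by (metis list.distinct(1) list.inject upto.simps)+
  show ?case
  proof (cases "m = n")
    case True
    then show ?thesis using Cons.prems n by auto
  next
    case False
    moreover have "root_of (lower_by (colr a) l) = base_content (a + 1)"
      using Cons.prems(3,4) base_content_step root_of_lower_by[OF colr_idx] by simp
    ultimately show ?thesis using Cons.IH[of "lower_by (colr n) l" "a + 1"] Cons.prems n by simp
  qed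
qed simp

lemma normal_states_ok:
  assumes "0 \<le> m" "m < 30"
  obtains l where "root_of l = base_content m" "states_ok m l (candidates m)"
proof -
  have "residues = [0..29 :: int]"
    by (simp add: upto.simps)
  moreover have "root_of start = base_content 0"
  proof -
    have "{..<0} \<inter> {0 :: int..} = {}" by auto
    then show ?thesis by (simp add: base_content_def content_from_def)
  qed
  ultimately show ?thesis
    using states_okD[OF all_states_ok, of 0 29 m] residue_cases[OF assms] that by auto
qed

definition sound_state :: "int \<Rightarrow> int list \<times> vec \<Rightarrow> bool" where
  "sound_state m s \<longleftrightarrow> distinct (fst s) \<and> (\<forall>t\<in>set (fst s). m < t) \<and> closed (ideal m (fst s)) \<and>
     root_of (snd s) = content_from 0 (ideal m (fst s))"

lemma grow_sound:
  assumes "0 \<le> m"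
  shows "distinct ns \<Longrightarrow> \<forall>n\<in>set ns. m < n \<and> n \<le> N \<Longrightarrow>
    \<forall>s\<in>set r. sound_state m s \<and> set (fst s) \<inter> set ns = {} \<and> (\<forall>t\<in>set (fst s). t \<le> N) \<Longrightarrow>
    s \<in> set (grow m ns r) \<Longrightarrow> sound_state m s \<and> (\<forall>t\<in>set (fst s). t \<le> N)"
proof (induction ns arbitrary: r)
  case (Cons n ns)
  have "sound_state m u \<and> set (fst u) \<inter> set ns = {} \<and> (\<forall>t\<in>set (fst u). t \<le> N)"
    if u: "u \<in> set (extend m n r)" for u
    using extend_cases[OF u]
  proof (elim disjE exE conjE)
    assume "u \<in> set r"
    then show ?thesis using Cons.prems(3) by auto
  next
    fix T l assume 2: "(T, l) \<in> set r" "list_all (mem m T) (lowers n)"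
      "u = (n # T, lower_by (colr n) l)"
    have T: "sound_state m (T, l)" "set T \<inter> set (n # ns) = {}" "\<forall>t\<in>set T. t \<le> N"
      using bspec[OF Cons.prems(3) 2(1)] by simp_all
    have n: "m < n" "n \<le> N" "n \<notin> ideal m T" "n \<notin> set ns"
      using Cons.prems(1,2) T(2) by (auto simp: ideal_def)
    have ins: "ideal m (n # T) = insert n (ideal m T)" by (auto simp: ideal_def)
    have "closed (ideal m (n # T))"
      unfolding ins using closed_insert T(1) 2(2)
      by (auto simp: sound_state_def list_all_iff mem_ideal)
    moreover have "root_of (lower_by (colr n) l) = content_from 0 (ideal m (n # T))"
      unfolding ins using content_from_insert[of "ideal m T" n 0] n assms T(1)
      by (simp add: root_of_lower_by[OF colr_idx] sound_state_def)
    ultimately show ?thesis using T n 2(3) by (auto simp: sound_state_def ideal_def)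
  qed
  then show ?case using Cons.IH[of "extend m n r"] Cons.prems by simp
qed auto

text \<open>The interface between the enumeration and the rest: a column in normal form together
  with its neighbours \<open>A\<close> and \<open>R\<close>, its content \<open>l\<close> and the
  outcome of the check.\<close>

definition represents :: "int \<Rightarrow> int list \<Rightarrow> int list \<Rightarrow> int list \<Rightarrow> vec \<Rightarrow> bool" where
  "represents m T A R l \<longleftrightarrow> normal m T \<and> young_set (ideal m T) \<and>
     root_of l = content_from 0 (ideal m T) \<and> set A = add_set (ideal m T) \<and>
     set R = rem_set (ideal m T) \<and> column_ok m T A R l"

lemma ideal_column_represented:
  assumes "ideal_column I"
  shows "\<exists>k m T A R l. I = sh k (ideal m T) \<and> represents m T A R l"
proof -
  obtain x where x: "x \<notin> I" "{..<x} \<subseteq> I" by (rule ideal_column_missing[OF assms])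
  obtain m k where xm: "x = m + 30 * k" and m: "0 \<le> m" "m < 30" by (rule obtain_residue)
  define J where "J = sh (-k) I"
  have J: "closed J" "m \<notin> J" "{..<m} \<subseteq> J"
    using assms x(1) subsetD[OF x(2)] xm unfolding J_def closed_sh
    by (auto simp: mem_sh ideal_column_def)
  obtain l0 where l0: "root_of l0 = base_content m" "states_ok m l0 (candidates m)"
    by (rule normal_states_ok[OF m])
  have "n \<in> set (candidates m)" if n: "n \<in> J" "m \<le> n" for n
  proof -
    have "m < n" using n J(2) by (cases "m = n") auto
    moreover have "n \<le> m + 30"
      using vanishing_above[OF J(1,2), of m 0 n] m n(1) by force
    ultimately show ?thesis using candidates_complete[OF J(1,2) n(1)] by simp
  qed
  then have "\<exists>T l. (T, l) \<in> set (grow m (candidates m) [([], l0)]) \<and> set [] \<subseteq> set T \<and>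
      set T \<subseteq> J \<and> J \<inter> {m..} \<subseteq> set T"
    by (intro grow_complete[OF J(1,2) candidates_sorted, of "[]" l0]) auto
  then obtain T l where T: "(T, l) \<in> set (grow m (candidates m) [([], l0)])"
    "set T \<subseteq> J" "J \<inter> {m..} \<subseteq> set T" by blast
  have "closed (ideal m [])" by (simp add: closed_ideal)
  then have "sound_state m ([], l0)"
    using l0(1) by (simp add: sound_state_def ideal_def base_content_def)
  moreover have "distinct (candidates m)" "\<forall>n\<in>set (candidates m). m < n \<and> n \<le> m + 30"
    using candidates_sorted strict_sorted_iff candidates_range l0(2)
    by (auto simp: states_ok_def list_all_iff)
  ultimately have s: "sound_state m (T, l)" "\<forall>t\<in>set T. t \<le> m + 30"
    using grow_sound[OF m(1), of "candidates m" "m + 30" "[([], l0)]" "(T, l)"] T(1) by auto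
  have norm: "normal m T" and cl: "closed (ideal m T)"
    using s m by (auto simp: normal_def sound_state_def)
  have "state_ok m (candidates m) (T, l)"
    using l0(2) T(1) by (auto simp: states_ok_def list_all_iff)
  then have "represents m T (adds m (candidates m) T) (rems m T) l"
    using s norm cl mem_adds[OF norm cl s(2)] mem_rems[OF norm cl]
    by (simp add: represents_def state_ok_def sound_state_def young_set_def)
  moreover have "J = ideal m T" using T J(3) by (force simp: ideal_def)
  then have "I = sh k (ideal m T)" unfolding J_def[symmetric]
    by (metis J_def add.right_inverse sh_0 sh_sh)
  ultimately show ?thesis by blast
qed

lemma content_from_ideal:
  assumes "distinct T" "\<forall>t\<in>set T. m < t" "0 \<le> m"
  shows "content_from 0 (ideal m T) =
    root_of (fold (\<lambda>n. lower_by (colr n)) ([0..m - 1] @ T) start)"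
proof -
  have "ideal m T \<inter> {30 * 0..} = set ([0..m - 1] @ T)" using assms by (auto simp: ideal_def)
  moreover have "distinct ([0..m - 1] @ T)" using assms by auto
  ultimately show ?thesis
    unfolding content_from_def root_of_fold by (metis sum_list_distinct_conv_sum_set)
qed

lemma special_represented:
  "represents 14 [15, 17] [14] [17] (Vec 0 1 0 0 0 0 0 0)"
  "represents 16 [17, 19] [16] [19] (Vec 0 (-1) 0 0 0 0 0 0)"
proof -
  show "represents 14 [15, 17] [14] [17] (Vec 0 1 0 0 0 0 0 0)"
    using special_columns_ok(1) young_set_special[of 14] add_set_special[of 14] rem_set_special[of 14]
      content_from_ideal[of "[15, 17]" 14]
    by (simp add: represents_def normal_def special_ideal upto.simps table_simps start_def drop_by_def)
  show "represents 16 [17, 19] [16] [19] (Vec 0 (-1) 0 0 0 0 0 0)"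
    using special_columns_ok(2) young_set_special[of 16] add_set_special[of 16] rem_set_special[of 16]
      content_from_ideal[of "[17, 19]" 16]
    by (simp add: represents_def normal_def special_ideal upto.simps table_simps start_def drop_by_def)
qed

theorem young_represented:
  assumes "young_column y"
  obtains q m T A R l where "y = col q (ideal m T)" "represents m T A R l"
proof -
  obtain I where I: "y = col 0 I" "young_set I" by (rule young_exhaust[OF assms])
  then consider "ideal_column I" | k where "I = sh k (special 14)" | k where "I = sh k (special 16)"
    unfolding young_set_def by blast
  then show ?thesis
  proof cases
    case 1
    then show ?thesis using ideal_column_represented that I(1) col_sh by metis
  next
    case 2
    then show ?thesis using special_represented(1) special_ideal[of 14, simplified] that I(1) col_sh by metis
  next
    case 3
    then show ?thesis using special_represented(2) special_ideal[of 16, simplified] that I(1) col_sh by metis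
  qed
qed

section \<open>The operators on columns\<close>

lemma addable_col: "addable i (col q I) = (\<lambda>b. blk (b + 30 * q)) ` {b \<in> add_set I. colr b = i}"
proof (rule block_set_eqI)
  show "addable i (col q I) \<subseteq> blocks" by (auto simp: addable_def)
  show "(\<lambda>b. blk (b + 30 * q)) ` {b \<in> add_set I. colr b = i} \<subseteq> blocks" by (auto simp: blocks_eq)
  fix n
  have "blk n \<in> (\<lambda>b. blk (b + 30 * q)) ` {b \<in> add_set I. colr b = i} \<longleftrightarrow>
      n - 30 * q \<in> add_set I \<and> colr (n - 30 * q) = i"
    by (auto intro: image_eqI[of _ _ "n - 30 * q"])
  moreover have "colr (n - 30 * q) = colr n" using colr_shift[of "n - 30 * q" q] by simp
  ultimately show "blk n \<in> addable i (col q I) \<longleftrightarrow>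
      blk n \<in> (\<lambda>b. blk (b + 30 * q)) ` {b \<in> add_set I. colr b = i}"
    using insert_col[of "n - 30 * q" q I] young_col
    by (auto simp: addable_def add_set_def blk_blocks)
qed

lemma removable_col: "removable i (col q I) = (\<lambda>b. blk (b + 30 * q)) ` {b \<in> rem_set I. colr b = i}"
proof (rule block_set_eqI)
  show "removable i (col q I) \<subseteq> blocks" using col_subset_blocks by (auto simp: removable_def)
  show "(\<lambda>b. blk (b + 30 * q)) ` {b \<in> rem_set I. colr b = i} \<subseteq> blocks" by (auto simp: blocks_eq)
  fix n
  have "blk n \<in> (\<lambda>b. blk (b + 30 * q)) ` {b \<in> rem_set I. colr b = i} \<longleftrightarrow>
      n - 30 * q \<in> rem_set I \<and> colr (n - 30 * q) = i"
    by (auto intro: image_eqI[of _ _ "n - 30 * q"])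
  moreover have "colr (n - 30 * q) = colr n" using colr_shift[of "n - 30 * q" q] by simp
  ultimately show "blk n \<in> removable i (col q I) \<longleftrightarrow>
      blk n \<in> (\<lambda>b. blk (b + 30 * q)) ` {b \<in> rem_set I. colr b = i}"
    using remove_col[of q I "n - 30 * q"] young_col
    by (auto simp: removable_def rem_set_def)
qed

lemma on_top_of_blk: "on_top_of i (blk n) \<longleftrightarrow> (\<exists>x\<in>set (lowers n). colr x = i)"
  unfolding on_top_of_def directly_below_blk by (metis colour_blk)

lemma prefer_add_blk: "prefer_add i b n \<longleftrightarrow> (if i = 4 then on_top_of 5 (blk (b + 30 * q))
    else cube (blk (n + 30 * q)) < cube (blk (b + 30 * q)))"
  and prefer_remove_blk: "prefer_remove i b n \<longleftrightarrow> (if i = 4 then on_top_of 3 (blk (b + 30 * q))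
    else cube (blk (b + 30 * q)) < cube (blk (n + 30 * q)))"
  by (auto simp: prefer_add_def prefer_remove_def on_top_of_blk list_ex_iff)

text \<open>Uniqueness needs that no rival wins against \<open>b\<close>, separately from
  \<open>b\<close> winning against all of them: for \<open>i = 4\<close> the criterion is a property
  of one block, and two blocks could both have it.\<close>

lemma add_choice_unique:
  assumes "b \<in> addable i y"
    and "\<And>c. c \<in> addable i y \<Longrightarrow> c \<noteq> b \<Longrightarrow> if i = 4 then on_top_of 5 b else cube c < cube b"
    and "\<And>c. c \<in> addable i y \<Longrightarrow> c \<noteq> b \<Longrightarrow> \<not> (if i = 4 then on_top_of 5 c else cube b < cube c)"
  shows "add_choice i y = b"
  unfolding add_choice_def
proof (rule the_equality)
  fix c assume c: "c \<in> addable i y \<and> (\<forall>d\<in>addable i y. d \<noteq> c \<longrightarrow>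
    (if i = 4 then on_top_of 5 c else cube d < cube c))"
  show "c = b"
  proof (rule ccontr)
    assume ne: "c \<noteq> b"
    show False
      by (rule notE[OF assms(3)[OF conjunct1[OF c] ne]
            conjunct2[OF c, rule_format, OF assms(1) ne[symmetric]]])
  qed
qed (use assms(1,2) in simp)

lemma remove_choice_unique:
  assumes "b \<in> removable i y"
    and "\<And>c. c \<in> removable i y \<Longrightarrow> c \<noteq> b \<Longrightarrow> if i = 4 then on_top_of 3 b else cube b < cube c"
    and "\<And>c. c \<in> removable i y \<Longrightarrow> c \<noteq> b \<Longrightarrow> \<not> (if i = 4 then on_top_of 3 c else cube c < cube b)"
  shows "remove_choice i y = b"
  unfolding remove_choice_def
proof (rule the_equality)
  fix c assume c: "c \<in> removable i y \<and> (\<forall>d\<in>removable i y. d \<noteq> c \<longrightarrow>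
    (if i = 4 then on_top_of 3 c else cube c < cube d))"
  show "c = b"
  proof (rule ccontr)
    assume ne: "c \<noteq> b"
    show False
      by (rule notE[OF assms(3)[OF conjunct1[OF c] ne]
            conjunct2[OF c, rule_format, OF assms(1) ne[symmetric]]])
  qed
qed (use assms(1,2) in simp)

lemma add_block_singleton: "addable i y = {b} \<Longrightarrow> add_block i y = Some (insert b y)"
  using add_choice_unique[of b i y] by (simp add: add_block_def)

lemma remove_block_singleton: "removable i y = {b} \<Longrightarrow> remove_block i y = Some (y - {b})"
  using remove_choice_unique[of b i y] by (simp add: remove_block_def)

lemma same_ideal_eq:
  assumes "same_ideal m T m' T'"
  shows "ideal m T = ideal m' T'"
proof -
  have d: "d \<in> set [0, 1, 2, 3, 4]" if "0 \<le> d" "d < 5" for d :: int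
    using that by simp presburger
  have a: "m' \<le> m + 5" "m \<le> m' + 5"
    "\<And>d. d \<in> set [0, 1, 2, 3, 4] \<Longrightarrow> m + d < m' \<Longrightarrow> m + d \<in> ideal m T"
    "\<And>d. d \<in> set [0, 1, 2, 3, 4] \<Longrightarrow> m' + d < m \<Longrightarrow> m' + d \<in> ideal m' T'"
    "set T' \<subseteq> ideal m T" "set T \<subseteq> ideal m' T'"
    using assms unfolding same_ideal_def list_all_iff mem_ideal by blast+
  have "x \<in> ideal m' T'" if "x < m" for x
  proof (cases "x < m'")
    case True
    then show ?thesis by (simp add: ideal_def)
  next
    case False
    then have "x - m' \<in> set [0, 1, 2, 3, 4]" using that a(2) by (intro d) simp_all
    from a(4)[OF this] that show ?thesis by simp
  qed
  moreover have "x \<in> ideal m T" if "x < m'" for x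
  proof (cases "x < m")
    case True
    then show ?thesis by (simp add: ideal_def)
  next
    case False
    then have "x - m \<in> set [0, 1, 2, 3, 4]" using that a(1) by (intro d) simp_all
    from a(3)[OF this] that show ?thesis by simp
  qed
  ultimately show ?thesis using a(5,6) by (auto simp: ideal_def)
qed

section \<open>The columns of content zero\<close>

primrec middle_set :: "middle \<Rightarrow> int set" where "middle_set (Zero i b c m T) = ideal m T"
primrec enter :: "middle \<Rightarrow> int" where "enter (Zero i b c m T) = b"
primrec leave :: "middle \<Rightarrow> int" where "leave (Zero i b c m T) = c"
primrec middle_start :: "middle \<Rightarrow> int" where "middle_start (Zero i b c m T) = m"

definition middle_column :: "nat \<Rightarrow> int \<Rightarrow> block set" where
  "middle_column i q = col q (middle_set (middles ! i))"

lemma length_middles: "length middles = 9"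
  by (simp add: middles_def)

lemma middle_colour_nth: "i \<in> idx \<Longrightarrow> middle_colour (middles ! i) = i"
  by (drule idx_cases, elim insertE) (simp_all add: middles_def middle_colour_def)

lemma middle_start_inj:
  "i \<in> idx \<Longrightarrow> j \<in> idx \<Longrightarrow> middle_start (middles ! i) = middle_start (middles ! j) \<Longrightarrow> i = j"
proof -
  assume ij: "i \<in> idx" "j \<in> idx" "middle_start (middles ! i) = middle_start (middles ! j)"
  have "distinct (map middle_start middles)" by (simp add: middles_def)
  then show ?thesis using ij nth_eq_iff_index_eq[of "map middle_start middles" i j] length_middles
    by simp
qed

lemma middle_cases:
  assumes "i \<in> idx"
  obtains b c m T where "middles ! i = Zero i b c m T" "closed (ideal m T)" "0 \<le> m" "m < 30"
    "\<forall>t\<in>set T. m < t" "content_from 0 (ideal m T) = 0"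
proof -
  obtain j b c m T where z: "middles ! i = Zero j b c m T" by (cases "middles ! i")
  have "j = i" using middle_colour_nth[OF assms] z by (simp add: middle_colour_def)
  have "middles ! i \<in> set middles" using assms length_middles by (intro nth_mem) simp
  then have ok: "\<forall>t\<in>set T. m < t \<and> list_all (mem m T) (lowers t)" "0 \<le> m" "m < 30" "distinct T"
    "fold (\<lambda>n. lower_by (colr n)) ([0..m - 1] @ T) start = Vec 0 0 0 0 0 0 0 0"
    using middles_ok z unfolding list_all_iff by auto
  have "content_from 0 (ideal m T) = root_of (Vec 0 0 0 0 0 0 0 0)"
    using content_from_ideal[of T m] ok by simp
  also have "\<dots> = 0" by (rule root_eqI) simp_all
  finally show ?thesis
    using that[of b c m T] z \<open>j = i\<close> ok by (simp add: closed_ideal list_all_iff mem_ideal subset_iff)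
qed

text \<open>The nine first missing numbers are different residues modulo 30, so no shift can
  identify two of these columns.\<close>

lemma middle_column_inj:
  assumes "i \<in> idx" "j \<in> idx" "middle_column i q = middle_column j q'"
  shows "i = j"
proof -
  obtain b c m T where i: "middles ! i = Zero i b c m T" "0 \<le> m" "m < 30" "\<forall>t\<in>set T. m < t"
    using middle_cases[OF assms(1)] by metis
  obtain b' c' m' T' where j: "middles ! j = Zero j b' c' m' T'" "0 \<le> m'" "m' < 30"
    "\<forall>t\<in>set T'. m' < t"
    using middle_cases[OF assms(2)] by metis
  have "sh q (ideal m T) = sh q' (ideal m' T')"
    using assms(3) i(1) j(1) by (simp add: middle_column_def col_eq_iff)
  then have "sh (-q) (sh q (ideal m T)) = sh (-q) (sh q' (ideal m' T'))" by simp
  then have "ideal m T = sh (q' - q) (ideal m' T')" by (simp add: sh_sh)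
  then have "m = m' + 30 * (q' - q)" using ideal_eq_shift(1) i j by blast
  then have "m = m'" using i(2,3) j(2,3) by presburger
  then show ?thesis using middle_start_inj assms i(1) j(1) by simp
qed

lemma young_middle: "i \<in> idx \<Longrightarrow> young_column (middle_column i q)"
  by (erule middle_cases) (simp add: middle_column_def young_col young_set_def)

lemma ideal_tail: "0 \<le> m \<Longrightarrow> {..<30 * (0::int)} \<subseteq> ideal m T"
  by (auto simp: ideal_def)

lemma content_middle: "i \<in> idx \<Longrightarrow> content (middle_column i q) = 0"
  by (erule middle_cases) (simp add: middle_column_def content_col[OF bdd_above_ideal ideal_tail])

lemma representsD:
  assumes "represents m T A R l"
  shows "content (col q (ideal m T)) = root_of l"
    and "addable i (col q (ideal m T)) = (\<lambda>b. blk (b + 30 * q)) ` set (filter (\<lambda>n. colr n = i) A)"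
    and "removable i (col q (ideal m T)) = (\<lambda>b. blk (b + 30 * q)) ` set (filter (\<lambda>n. colr n = i) R)"
    and "column_ok m T A R l"
  using assms content_col[OF bdd_above_ideal ideal_tail, of m]
  unfolding represents_def addable_col removable_col normal_def by auto

lemma root_of_eq_0: "root_of v = 0 \<longleftrightarrow> v = Vec 0 0 0 0 0 0 0 0"
proof
  assume "root_of v = 0"
  then have "\<forall>j\<in>{1, 2, 3, 4, 5, 6, 7, 8}. root_of v j = 0" by simp
  then show "v = Vec 0 0 0 0 0 0 0 0" by (cases v) simp
next
  assume "v = Vec 0 0 0 0 0 0 0 0"
  then show "root_of v = 0" by (intro root_eqI) simp_all
qed

lemma steps_okD:
  "steps_ok zs m T A R ps \<Longrightarrow> length ps = length zs \<Longrightarrow> j < length zs \<Longrightarrow>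
     step_ok m T (ps ! j) (filter (\<lambda>n. colr n = middle_colour (zs ! j)) A)
       (filter (\<lambda>n. colr n = middle_colour (zs ! j)) R) (zs ! j)"
proof (induction zs arbitrary: ps j)
  case (Cons z zs)
  then obtain p ps' where "ps = p # ps'" by (cases ps) auto
  then show ?case using Cons by (cases j) auto
qed simp

text \<open>The last two claims matter for colours other than \<open>i\<close>: a column of content
  zero can have addable blocks of those colours too, and the description in
  \<open>add_choice\<close> must still denote one of them.\<close>

lemma zero_column:
  assumes "young_column y" "content y = 0"
  obtains i q where "i \<in> idx" "y = middle_column i q"
    "addable i y = {blk (leave (middles ! i) + 30 * q)}"
    "removable i y = {blk (enter (middles ! i) + 30 * q)}"
    "\<And>j b c. b \<in> addable j y \<Longrightarrow> c \<in> addable j y \<Longrightarrow> b = c"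
    "\<And>j b c. b \<in> removable j y \<Longrightarrow> c \<in> removable j y \<Longrightarrow> b = c"
proof -
  obtain q m T A R l where y: "y = col q (ideal m T)" and r: "represents m T A R l"
    by (rule young_represented[OF assms(1)])
  have "l = Vec 0 0 0 0 0 0 0 0" using assms(2) representsD(1)[OF r, of q] y root_of_eq_0 by simp
  then have "list_ex (is_middle m T A R) middles"
    using representsD(4)[OF r] by (simp add: column_ok_def)
  then obtain z where "z \<in> set middles" "is_middle m T A R z" unfolding list_ex_iff by blast
  then obtain i where i: "i < 9" "is_middle m T A R (middles ! i)"
    by (metis in_set_conv_nth length_middles)
  then have "i \<in> idx" by simp
  then obtain b c m' T' where z: "middles ! i = Zero i b c m' T'" using middle_cases by metis
  have ok: "m = m'" "T = T'" "distinct (map colr A)" "distinct (map colr R)"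
    "filter (\<lambda>n. colr n = i) A = [c]" "filter (\<lambda>n. colr n = i) R = [b]"
    using i(2) unfolding z by (simp_all split: if_splits)
  show ?thesis
  proof (rule that[OF \<open>i \<in> idx\<close>, of q])
    show "y = middle_column i q" using y ok z by (simp add: middle_column_def)
    show "addable i y = {blk (leave (middles ! i) + 30 * q)}"
      "removable i y = {blk (enter (middles ! i) + 30 * q)}"
      unfolding y representsD(2,3)[OF r] ok(5,6) z by simp_all
    have inj: "inj_on colr (set A)" "inj_on colr (set R)" using ok(3,4) by (simp_all add: distinct_map)
    show "b = c" if "b \<in> addable j y" "c \<in> addable j y" for j b c
      using that inj(1) unfolding y representsD(2)[OF r] by (auto dest: inj_onD)
    show "b = c" if "b \<in> removable j y" "c \<in> removable j y" for j b c
      using that inj(2) unfolding y representsD(3)[OF r] by (auto dest: inj_onD)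
  qed
qed

lemma singleton_iff: "singleton xs \<longleftrightarrow> (\<exists>x. xs = [x])"
  by (cases xs) (auto simp: singleton_def)

context
  fixes y i
  assumes y: "young_column y" and nz: "content y \<noteq> 0" and i: "i \<in> idx"
begin

lemma obtain_step:
  obtains q m T As Rs l b c m' T' where "y = col q (ideal m T)" "middles ! i = Zero i b c m' T'"
    "vec_ok l" "content y = root_of l"
    "addable i y = (\<lambda>b. blk (b + 30 * q)) ` set As"
    "removable i y = (\<lambda>b. blk (b + 30 * q)) ` set Rs"
    "step_ok m T (pairing i (content y)) As Rs (Zero i b c m' T')"
proof -
  obtain q m T A R l where rep: "y = col q (ideal m T)" "represents m T A R l"
    by (rule young_represented[OF y])
  obtain b c m' T' where z: "middles ! i = Zero i b c m' T'" using middle_cases[OF i] by metis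
  have l: "content y = root_of l" using representsD(1)[OF rep(2)] rep(1) by simp
  then have v: "vec_ok l" and st: "steps_ok middles m T A R (pairings l)"
    using representsD(4)[OF rep(2)] nz root_of_eq_0[of l] by (auto simp: column_ok_def)
  have "length (pairings l) = length middles" by (cases l) (simp add: length_middles)
  from steps_okD[OF st this, of i]
  have "step_ok m T (pairing i (content y)) (filter (\<lambda>n. colr n = i) A)
      (filter (\<lambda>n. colr n = i) R) (Zero i b c m' T')"
    unfolding length_middles middle_colour_nth[OF i] l pairing_root_of[OF i] z
    using i by (simp add: middle_colour_def del: step_ok.simps)
  then show ?thesis
    using that[OF rep(1) z v l] representsD(2,3)[OF rep(2), of i q] rep(1) by blast
qed

lemma pairing_bounds: "pairing i (content y) \<in> {-2, -1, 0, 1, 2}"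
  by (rule obtain_step) (auto split: if_splits)

lemma no_addable: "pairing i (content y) \<le> 0 \<Longrightarrow> addable i y = {}"
  by (rule obtain_step) (simp split: if_splits)

lemma no_removable: "0 \<le> pairing i (content y) \<Longrightarrow> removable i y = {}"
  by (rule obtain_step) (simp split: if_splits)

lemma one_addable: "pairing i (content y) = 1 \<Longrightarrow> \<exists>b. addable i y = {b}"
  by (rule obtain_step) (auto simp: singleton_iff simp del: split_paired_Ex)

lemma one_removable: "pairing i (content y) = -1 \<Longrightarrow> \<exists>b. removable i y = {b}"
  by (rule obtain_step) (auto simp: singleton_iff simp del: split_paired_Ex)

text \<open>The column begins an i-string of length two. The last claim determines it up to a shift,
  which is the base case of \<open>same_content_congruent\<close>.\<close>

lemma enter_middle:
  assumes "pairing i (content y) = 2"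
  obtains q where "add_block i y = Some (middle_column i q)" "add_choice i y \<in> addable i y"
    "y = col q (middle_set (middles ! i) - {enter (middles ! i)})"
proof -
  obtain q m T As Rs l b c m' T' where o: "y = col q (ideal m T)" "middles ! i = Zero i b c m' T'"
    "addable i y = (\<lambda>b. blk (b + 30 * q)) ` set As"
    "removable i y = (\<lambda>b. blk (b + 30 * q)) ` set Rs"
    "step_ok m T (pairing i (content y)) As Rs (Zero i b c m' T')"
    by (rule obtain_step)
  have s: "b \<in> set As" "\<forall>n\<in>set As. n = b \<or> prefer_add i b n"
    "\<forall>n\<in>set As. n = b \<or> \<not> prefer_add i n b" "b \<notin> ideal m T" "same_ideal m (b # T) m' T'"
    using o(5) unfolding assms by (simp_all add: list_all_iff mem_ideal)
  note add = o(3)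
  have ch: "add_choice i y = blk (b + 30 * q)"
  proof (rule add_choice_unique)
    show "blk (b + 30 * q) \<in> addable i y" using s(1) add by blast
    fix x assume "x \<in> addable i y" "x \<noteq> blk (b + 30 * q)"
    then obtain n where n: "x = blk (n + 30 * q)" "n \<in> set As" "n \<noteq> b" using add by auto
    then have "prefer_add i b n" "\<not> prefer_add i n b" using s(2,3) by blast+
    then show "if i = 4 then on_top_of 5 (blk (b + 30 * q)) else cube x < cube (blk (b + 30 * q))"
      "\<not> (if i = 4 then on_top_of 5 x else cube (blk (b + 30 * q)) < cube x)"
      unfolding n(1) prefer_add_blk[symmetric] by blast+
  qed
  have M: "middle_set (middles ! i) = insert b (ideal m T)"
    using same_ideal_eq[OF s(5)] by (auto simp: o(2) ideal_def)
  show ?thesis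
  proof (rule that[of q])
    show "add_choice i y \<in> addable i y" using s(1) add ch by blast
    then show "add_block i y = Some (middle_column i q)"
      unfolding add_block_def ch middle_column_def M using insert_col o(1) by auto
    show "y = col q (middle_set (middles ! i) - {enter (middles ! i)})"
      unfolding M using s(4) o(1) by (simp add: o(2))
  qed
qed

lemma leave_middle:
  assumes "pairing i (content y) = -2"
  obtains q where "remove_block i y = Some (middle_column i q)"
    "remove_choice i y \<in> removable i y"
    "y = col q (insert (leave (middles ! i)) (middle_set (middles ! i)))"
proof -
  obtain q m T As Rs l b c m' T' where o: "y = col q (ideal m T)" "middles ! i = Zero i b c m' T'"
    "addable i y = (\<lambda>b. blk (b + 30 * q)) ` set As"
    "removable i y = (\<lambda>b. blk (b + 30 * q)) ` set Rs"
    "step_ok m T (pairing i (content y)) As Rs (Zero i b c m' T')"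
    by (rule obtain_step)
  have s: "c \<in> set Rs" "\<forall>n\<in>set Rs. n = c \<or> prefer_remove i c n"
    "\<forall>n\<in>set Rs. n = c \<or> \<not> prefer_remove i n c" "c \<notin> ideal m' T'" "same_ideal m T m' (c # T')"
    using o(5) unfolding assms by (simp_all add: list_all_iff mem_ideal)
  note rem = o(4)
  have ch: "remove_choice i y = blk (c + 30 * q)"
  proof (rule remove_choice_unique)
    show "blk (c + 30 * q) \<in> removable i y" using s(1) rem by blast
    fix x assume "x \<in> removable i y" "x \<noteq> blk (c + 30 * q)"
    then obtain n where n: "x = blk (n + 30 * q)" "n \<in> set Rs" "n \<noteq> c" using rem by auto
    then have "prefer_remove i c n" "\<not> prefer_remove i n c" using s(2,3) by blast+
    then show "if i = 4 then on_top_of 3 (blk (c + 30 * q)) else cube (blk (c + 30 * q)) < cube x"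
      "\<not> (if i = 4 then on_top_of 3 x else cube x < cube (blk (c + 30 * q)))"
      unfolding n(1) prefer_remove_blk[symmetric] by blast+
  qed
  have M: "ideal m T - {c} = middle_set (middles ! i)"
    using same_ideal_eq[OF s(5)] s(4) by (auto simp: o(2) ideal_def)
  show ?thesis
  proof (rule that[of q])
    show "remove_choice i y \<in> removable i y" using s(1) rem ch by blast
    then show "remove_block i y = Some (middle_column i q)"
      unfolding remove_block_def ch middle_column_def M[symmetric] using remove_col o(1) by auto
    have "insert c (middle_set (middles ! i)) = ideal m T"
      using same_ideal_eq[OF s(5)] by (auto simp: o(2) ideal_def)
    then show "y = col q (insert (leave (middles ! i)) (middle_set (middles ! i)))"
      using o(1) by (simp add: o(2))
  qed
qed

lemma content_le_theta: "content y j \<le> theta j"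
proof -
  obtain l where "vec_ok l" "content y = root_of l" by (rule obtain_step)
  then show ?thesis by (cases l) (auto simp: theta_def)
qed

lemma content_height:
  defines "h \<equiv> \<Sum>j=1..8. content y j"
  shows "h \<noteq> 0" "0 < h \<Longrightarrow> \<exists>j\<in>{1..8}. 0 < pairing j (content y)"
    "h < 0 \<Longrightarrow> \<exists>j\<in>{1..8}. pairing j (content y) < 0"
proof -
  obtain l where l: "vec_ok l" "content y = root_of l" by (rule obtain_step)
  have h: "vec_ok l \<Longrightarrow> h \<noteq> 0 \<and> (0 < h \<longrightarrow> list_ex (\<lambda>p. 0 < p) (tl (pairings l))) \<and>
      (h < 0 \<longrightarrow> list_ex (\<lambda>p. p < 0) (tl (pairings l)))"
    unfolding h_def l(2) sum_1_8 by (cases l) (simp add: Let_def split: if_splits)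
  have tl: "x \<in> set (tl (pairings l)) \<Longrightarrow> \<exists>j\<in>{1..8}. x = pairing j (content y)" for x
  proof -
    assume "x \<in> set (tl (pairings l))"
    moreover have len: "length (pairings l) = 9" by (cases l) simp
    ultimately obtain k where k: "k < 8" "x = pairings l ! Suc k"
      unfolding in_set_conv_nth by (auto simp: nth_tl)
    then show ?thesis
      using pairing_root_of[of "Suc k" l] l(2) by (intro bexI[of _ "Suc k"]) auto
  qed
  show "h \<noteq> 0" using h l(1) by simp
  show "\<exists>j\<in>{1..8}. 0 < pairing j (content y)" if "0 < h"
    using h l(1) that tl unfolding list_ex_iff by metis
  show "\<exists>j\<in>{1..8}. pairing j (content y) < 0" if "h < 0"
    using h l(1) that tl unfolding list_ex_iff by metis
qed

end

section \<open>Pairings and the effect of single blocks on the content\<close>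

lemma pairing_diff: "pairing i (\<alpha> - \<beta>) = pairing i \<alpha> - pairing i \<beta>"
  and pairing_add: "pairing i (\<alpha> + \<beta>) = pairing i \<alpha> + pairing i \<beta>"
  and pairing_minus: "pairing i (- \<alpha>) = - pairing i \<alpha>"
  and pairing_0: "pairing i 0 = 0"
  by (simp_all add: pairing_def algebra_simps sum.distrib sum_subtractf sum_negf)

lemma pairing_theta:
  assumes "i \<in> idx"
  shows "pairing i theta = - cartan i 0"
proof -
  have "pairing i theta = pairings (Vec 2 3 4 6 5 4 3 2) ! i"
    unfolding theta_def by (rule pairing_root_of[OF assms])
  also have "\<dots> = - cartan i 0"
    using idx_cases[OF assms] cartan_rows by (elim insertE) simp_all
  finally show ?thesis .
qed

lemma pairing_node_root:
  assumes "i \<in> idx" "j \<in> idx"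
  shows "pairing i (node_root j) = cartan i j"
proof (cases "j = 0")
  case True
  then show ?thesis using pairing_theta[OF assms(1)] by (simp add: node_root_def pairing_minus)
next
  case False
  then have "j \<in> {1..8}" using assms(2) by auto
  moreover have "(\<Sum>k=1..8. cartan i k * simple_root j k) =
      (\<Sum>k=1..8. if k = j then cartan i k else 0)"
    by (intro sum.cong refl) (simp add: simple_root_def)
  ultimately show ?thesis using False by (simp add: node_root_def pairing_def)
qed

lemma pairing_self: "i \<in> idx \<Longrightarrow> pairing i (node_root i) = 2"
  by (simp add: pairing_node_root cartan_def)

lemma node_root_nonzero: "i \<in> idx \<Longrightarrow> node_root i \<noteq> 0"
  using pairing_self pairing_0 by fastforce

lemma addable_young: "b \<in> addable i y \<Longrightarrow> young_column (insert b y)"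
  and removable_young: "b \<in> removable i y \<Longrightarrow> young_column (y - {b})"
  and addable_removable: "young_column y \<Longrightarrow> b \<in> addable i y \<Longrightarrow> b \<in> removable i (insert b y)"
  and removable_addable: "young_column y \<Longrightarrow> b \<in> removable i y \<Longrightarrow> b \<in> addable i (y - {b})"
  using young_column_blocks[of y] by (auto simp: addable_def removable_def insert_absorb)

lemma content_add:
  assumes "young_column y" "b \<in> addable i y"
  shows "content (insert b y) = content y - node_root i"
proof -
  obtain q m T A R l where y: "y = col q (ideal m T)" and r: "represents m T A R l"
    by (rule young_represented[OF assms(1)])
  obtain n where n: "b = blk (n + 30 * q)" "n \<in> add_set (ideal m T)" "colr n = i"
    using assms(2) unfolding y addable_col by auto
  have "n \<notin> ideal m T" "0 \<le> m"
    using n(2) r by (auto simp: add_set_def represents_def normal_def)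
  then show ?thesis
    using content_insert[OF bdd_above_ideal ideal_tail, of m n T q] n(3)
    unfolding y n(1) insert_col by simp
qed

lemma content_remove:
  assumes "young_column y" "b \<in> removable i y"
  shows "content (y - {b}) = content y + node_root i"
proof -
  have "b \<in> y" using assms(2) by (simp add: removable_def)
  then show ?thesis
    using content_add[OF removable_young[OF assms(2)] removable_addable[OF assms]]
    by (simp add: insert_absorb)
qed

lemma add_choice_addable:
  assumes y: "young_column y" and i: "i \<in> idx" and ne: "addable i y \<noteq> {}"
  shows "add_choice i y \<in> addable i y"
proof -
  have sing: ?thesis if "addable i y = {b}" for b
    using add_choice_unique[of b i y] that by simp
  show ?thesis
  proof (cases "content y = 0")
    case True
    then obtain b where "addable i y = {b}"
      using zero_column[OF y True] ne by (metis equals0I insertI1 is_singletonI' is_singleton_the_elem)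
    then show ?thesis by (rule sing)
  next
    case False
    then have "pairing i (content y) \<in> {1, 2}"
      using pairing_bounds[OF y False i] no_addable[OF y False i] ne by auto
    then show ?thesis
      using one_addable[OF y False i] enter_middle[OF y False i] sing by blast
  qed
qed

lemma remove_choice_removable:
  assumes y: "young_column y" and i: "i \<in> idx" and ne: "removable i y \<noteq> {}"
  shows "remove_choice i y \<in> removable i y"
proof -
  have sing: ?thesis if "removable i y = {b}" for b
    using remove_choice_unique[of b i y] that by simp
  show ?thesis
  proof (cases "content y = 0")
    case True
    then obtain b where "removable i y = {b}"
      using zero_column[OF y True] ne by (metis equals0I insertI1 is_singletonI' is_singleton_the_elem)
    then show ?thesis by (rule sing)
  next
    case False
    then have "pairing i (content y) \<in> {-1, -2}"
      using pairing_bounds[OF y False i] no_removable[OF y False i] ne by auto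
    then show ?thesis
      using one_removable[OF y False i] leave_middle[OF y False i] sing by blast
  qed
qed

lemma add_blockD:
  assumes "young_column y" "i \<in> idx" "add_block i y = Some z"
  shows "add_choice i y \<in> addable i y" "z = insert (add_choice i y) y" "young_column z"
    "content z = content y - node_root i" "removable i z \<noteq> {}"
proof -
  show 1: "add_choice i y \<in> addable i y"
    using assms add_choice_addable by (auto simp: add_block_def split: if_splits)
  show 2: "z = insert (add_choice i y) y"
    using assms(3) by (auto simp: add_block_def split: if_splits)
  show "young_column z" "content z = content y - node_root i" "removable i z \<noteq> {}"
    using addable_young[OF 1] content_add[OF assms(1) 1] addable_removable[OF assms(1) 1]
    unfolding 2 by auto
qed

lemma remove_blockD:
  assumes "young_column y" "i \<in> idx" "remove_block i y = Some z"
  shows "remove_choice i y \<in> removable i y" "z = y - {remove_choice i y}" "young_column z"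
    "content z = content y + node_root i" "addable i z \<noteq> {}"
proof -
  show 1: "remove_choice i y \<in> removable i y"
    using assms remove_choice_removable by (auto simp: remove_block_def split: if_splits)
  show 2: "z = y - {remove_choice i y}"
    using assms(3) by (auto simp: remove_block_def split: if_splits)
  show "young_column z" "content z = content y + node_root i" "addable i z \<noteq> {}"
    using removable_young[OF 1] content_remove[OF assms(1) 1] removable_addable[OF assms(1) 1]
    unfolding 2 by auto
qed

text \<open>An added block can be taken away again and a removed one put back, so a reserved column
  has both an addable and a removable i-block. For nonzero content the sign of the pairing excludes
  one of them.\<close>

lemma not_reserved:
  assumes y: "young_column y" "content y \<noteq> 0" and i: "i \<in> idx"
  shows "\<not> reserved i y"
proof
  assume "reserved i y"
  then have "addable i y \<noteq> {} \<and> removable i y \<noteq> {}"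
    using add_blockD(5) remove_blockD(5) i unfolding reserved_def by metis
  then show False using no_addable[OF y i] no_removable[OF y i] by linarith
qed

text \<open>A nonzero shift would move the first missing number.\<close>

lemma sh_inj:
  assumes "young_set I" "sh q I = sh q' I"
  shows "q = q'"
proof -
  have "young_column (col 0 I)" using assms(1) young_col by blast
  then obtain k m T A R l where "col 0 I = col k (ideal m T)" and r: "represents m T A R l"
    by (rule young_represented)
  then have I: "I = sh k (ideal m T)" by (simp add: col_eq_iff)
  have "sh (- q - k) (sh q I) = sh (- q - k) (sh q' I)" using assms(2) by simp
  then have "ideal m T = sh (q' - q) (ideal m T)" unfolding I sh_sh by simp
  moreover have "\<forall>t\<in>set T. m < t" using r by (simp add: represents_def normal_def)
  ultimately have "m = m + 30 * (q' - q)" using ideal_eq_shift(1) by blast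
  then show ?thesis by simp
qed

lemma middle_column_props:
  assumes "i \<in> idx"
  shows "addable i (middle_column i q) = {blk (leave (middles ! i) + 30 * q)}"
    "removable i (middle_column i q) = {blk (enter (middles ! i) + 30 * q)}"
proof -
  obtain j k where j: "j \<in> idx" "middle_column i q = middle_column j k"
    "addable j (middle_column i q) = {blk (leave (middles ! j) + 30 * k)}"
    "removable j (middle_column i q) = {blk (enter (middles ! j) + 30 * k)}"
    using zero_column[OF young_middle content_middle] assms by metis
  then have ij: "j = i" using middle_column_inj assms by metis
  then have "q = k"
    using j(2) sh_inj[of "middle_set (middles ! i)" q k] young_middle[OF assms, of q]
    by (simp add: middle_column_def col_eq_iff young_col)
  then show "addable i (middle_column i q) = {blk (leave (middles ! i) + 30 * q)}"
    "removable i (middle_column i q) = {blk (enter (middles ! i) + 30 * q)}"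
    using j(3,4) ij by simp_all
qed

text \<open>A column that one i-step takes to content zero has content plus or minus the simple root
  of node \<open>i\<close>, so its pairing is 2 or -2, and there the step is known to end in the
  middle column of colour \<open>i\<close>.\<close>

lemma reserved_middle:
  assumes i: "i \<in> idx" and j: "j \<in> idx"
  shows "reserved i (middle_column j q) \<longleftrightarrow> i = j"
proof
  assume "reserved i (middle_column j q)"
  then consider z where "young_column z" "add_block i z = Some (middle_column j q)"
    | z where "young_column z" "remove_block i z = Some (middle_column j q)"
    unfolding reserved_def by blast
  then show "i = j"
  proof cases
    case 1
    have "content z = node_root i"
      using add_blockD(4)[OF 1(1) i 1(2)] content_middle[OF j, of q] by simp
    then have "content z \<noteq> 0" "pairing i (content z) = 2"
      using node_root_nonzero[OF i] pairing_self[OF i] by simp_all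
    then obtain k where "add_block i z = Some (middle_column i k)"
      using enter_middle[OF 1(1) _ i] by metis
    then have "middle_column i k = middle_column j q" using 1(2) by simp
    then show ?thesis by (rule middle_column_inj[OF i j])
  next
    case 2
    have "content z = - node_root i"
      using remove_blockD(4)[OF 2(1) i 2(2)] content_middle[OF j, of q]
      by (simp add: eq_neg_iff_add_eq_0)
    then have "content z \<noteq> 0" "pairing i (content z) = -2"
      using node_root_nonzero[OF i] pairing_self[OF i] by (simp_all add: pairing_minus)
    then obtain k where "remove_block i z = Some (middle_column i k)"
      using leave_middle[OF 2(1) _ i] by metis
    then have "middle_column i k = middle_column j q" using 2(2) by simp
    then show ?thesis by (rule middle_column_inj[OF i j])
  qed
next
  assume "i = j"
  let ?e = "enter (middles ! j)" and ?M = "middle_set (middles ! j)"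
  \<comment> \<open>Undo the entering step. From the resulting column the choice rule leads to the
    middle column with some offset k, and \<open>sh_inj\<close> shows that it is the original
    one.\<close>
  define z where "z = middle_column j q - {blk (?e + 30 * q)}"
  have e: "blk (?e + 30 * q) \<in> removable j (middle_column j q)"
    unfolding middle_column_props(2)[OF j] by simp
  have z: "young_column z" "content z = node_root j"
    using removable_young[OF e] content_remove[OF young_middle[OF j] e] content_middle[OF j, of q]
    unfolding z_def by simp_all
  then have "content z \<noteq> 0" "pairing j (content z) = 2"
    using node_root_nonzero[OF j] pairing_self[OF j] by simp_all
  then obtain k where k: "add_block j z = Some (middle_column j k)" "z = col k (?M - {?e})"
    using enter_middle[OF z(1) _ j] by metis
  have zq: "z = col q (?M - {?e})" by (simp add: z_def middle_column_def remove_col)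
  then have "young_set (?M - {?e})" using z(1) young_col by simp
  moreover have "sh k (?M - {?e}) = sh q (?M - {?e})" using zq k(2) by (simp add: col_eq_iff)
  ultimately have "k = q" by (rule sh_inj)
  then show "reserved i (middle_column j q)"
    unfolding reserved_def \<open>i = j\<close> middle_column_props(1)[OF j] using z(1) k(1) by blast
qed

section \<open>The labelling of columns by vertices\<close>

definition middle_vertex :: "nat \<Rightarrow> b8" where
  "middle_vertex i = (if i = 0 then Empty else Y i)"

definition vertex :: "block set \<Rightarrow> b8" where
  "vertex y = (if content y = 0
     then middle_vertex (THE i. i \<in> idx \<and> (\<exists>q. y = middle_column i q)) else X (content y))"

lemma vertex_middle:
  assumes "i \<in> idx"
  shows "vertex (middle_column i q) = middle_vertex i"
proof -
  have "(THE j. j \<in> idx \<and> (\<exists>k. middle_column i q = middle_column j k)) = i"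
    by (rule the_equality) (use assms middle_column_inj in metis)+
  then show ?thesis using content_middle[OF assms] by (simp add: vertex_def)
qed

text \<open>With \<open>down\<close>, the arrows of \<open>B8\<close> expressed by pairings alone
  and uniformly in node 0 and the others. Columns and roots are each compared with this form, by
  \<open>vertex_column_e\<close> and \<open>B8_e_up\<close>.\<close>

fun up :: "nat \<Rightarrow> b8 \<Rightarrow> b8 option" where
  "up i (X \<alpha>) = (if pairing i \<alpha> = -1 then Some (X (\<alpha> + node_root i))
     else if pairing i \<alpha> = -2 then Some (middle_vertex i) else None)"
| "up i (Y j) = (if i = j then Some (X (node_root i)) else None)"
| "up i Empty = (if i = 0 then Some (X (node_root i)) else None)"

fun down :: "nat \<Rightarrow> b8 \<Rightarrow> b8 option" where
  "down i (X \<alpha>) = (if pairing i \<alpha> = 1 then Some (X (\<alpha> - node_root i))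
     else if pairing i \<alpha> = 2 then Some (middle_vertex i) else None)"
| "down i (Y j) = (if i = j then Some (X (- node_root i)) else None)"
| "down i Empty = (if i = 0 then Some (X (- node_root i)) else None)"

lemma up_middle: "up i (middle_vertex j) = (if i = j then Some (X (node_root i)) else None)"
  and down_middle: "down i (middle_vertex j) = (if i = j then Some (X (- node_root i)) else None)"
  by (simp_all add: middle_vertex_def)

lemma middle_vertex_X: "middle_vertex i \<noteq> X \<alpha>"
  and middle_vertex_inj: "middle_vertex i = middle_vertex j \<longleftrightarrow> i = j"
  by (simp_all add: middle_vertex_def)

text \<open>At pairing 1 the new content has pairing -1, so it is nonzero and labels the new vertex.
  At pairing 2 the content becomes zero, and the choice rule identifies the middle column.\<close>

lemma vertex_column_f:
  assumes y: "young_column y" and i: "i \<in> idx"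
  shows "map_option vertex (column_f i y) = down i (vertex y)"
proof (cases "content y = 0")
  case True
  obtain j q where j: "j \<in> idx" "y = middle_column j q" by (rule zero_column[OF y True])
  show ?thesis
  proof (cases "i = j")
    case True
    have "\<not> (\<exists>k\<in>idx - {i}. reserved k y)" using reserved_middle j True by auto
    then have "column_f i y = add_block i y" by (simp add: column_f_def)
    moreover obtain b where "addable i y = {b}" using middle_column_props(1)[OF j(1)] j(2) True by blast
    then obtain z where z: "add_block i y = Some z" using add_block_singleton by blast
    moreover have "content z = - node_root i"
      using add_blockD(4)[OF y i z] content_middle j by simp
    then have "vertex z = X (- node_root i)" using node_root_nonzero[OF i] by (simp add: vertex_def)
    ultimately show ?thesis using True j vertex_middle by (simp add: down_middle)
  next
    case False
    then have "\<exists>k\<in>idx - {i}. reserved k y"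
      using reserved_middle[OF j(1) j(1)] j by (intro bexI[of _ j]) auto
    then have "column_f i y = None" by (simp add: column_f_def)
    then show ?thesis using False j vertex_middle by (simp add: down_middle)
  qed
next
  case False
  have c: "column_f i y = add_block i y" using not_reserved[OF y False] by (simp add: column_f_def)
  have v: "vertex y = X (content y)" using False by (simp add: vertex_def)
  consider "pairing i (content y) \<le> 0" | "pairing i (content y) = 1" | "pairing i (content y) = 2"
    using pairing_bounds[OF y False i] by force
  then show ?thesis
  proof cases
    case 1
    then show ?thesis using no_addable[OF y False i] by (simp add: c v add_block_def)
  next
    case 2
    then obtain b where "addable i y = {b}" using one_addable[OF y False i] by blast
    then obtain z where z: "add_block i y = Some z" using add_block_singleton by blast
    have "content z = content y - node_root i" by (rule add_blockD(4)[OF y i z])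
    moreover from this have "pairing i (content z) = -1"
      using 2 pairing_self[OF i] by (simp add: pairing_diff)
    then have "content z \<noteq> 0" by (auto simp: pairing_0)
    then have "vertex z = X (content z)" by (simp add: vertex_def)
    ultimately show ?thesis using 2 z by (simp add: c v)
  next
    case 3
    then obtain q where "add_block i y = Some (middle_column i q)"
      using enter_middle[OF y False i] by metis
    then show ?thesis using 3 vertex_middle[OF i] by (simp add: c v)
  qed
qed

lemma vertex_column_e:
  assumes y: "young_column y" and i: "i \<in> idx"
  shows "map_option vertex (column_e i y) = up i (vertex y)"
proof (cases "content y = 0")
  case True
  obtain j q where j: "j \<in> idx" "y = middle_column j q" by (rule zero_column[OF y True])
  show ?thesis
  proof (cases "i = j")
    case True
    have "\<not> (\<exists>k\<in>idx - {i}. reserved k y)" using reserved_middle j True by auto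
    then have "column_e i y = remove_block i y" by (simp add: column_e_def)
    moreover obtain b where "removable i y = {b}"
      using middle_column_props(2)[OF j(1)] j(2) True by blast
    then obtain z where z: "remove_block i y = Some z" using remove_block_singleton by blast
    moreover have "content z = node_root i"
      using remove_blockD(4)[OF y i z] content_middle j by simp
    then have "vertex z = X (node_root i)" using node_root_nonzero[OF i] by (simp add: vertex_def)
    ultimately show ?thesis using True j vertex_middle by (simp add: up_middle)
  next
    case False
    then have "\<exists>k\<in>idx - {i}. reserved k y"
      using reserved_middle[OF j(1) j(1)] j by (intro bexI[of _ j]) auto
    then have "column_e i y = None" by (simp add: column_e_def)
    then show ?thesis using False j vertex_middle by (simp add: up_middle)
  qed
next
  case False
  have c: "column_e i y = remove_block i y" using not_reserved[OF y False] by (simp add: column_e_def)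
  have v: "vertex y = X (content y)" using False by (simp add: vertex_def)
  consider "0 \<le> pairing i (content y)" | "pairing i (content y) = -1" | "pairing i (content y) = -2"
    using pairing_bounds[OF y False i] by force
  then show ?thesis
  proof cases
    case 1
    then show ?thesis using no_removable[OF y False i] by (simp add: c v remove_block_def)
  next
    case 2
    then obtain b where "removable i y = {b}" using one_removable[OF y False i] by blast
    then obtain z where z: "remove_block i y = Some z" using remove_block_singleton by blast
    have "content z = content y + node_root i" by (rule remove_blockD(4)[OF y i z])
    moreover from this have "pairing i (content z) = 1"
      using 2 pairing_self[OF i] by (simp add: pairing_add)
    then have "content z \<noteq> 0" by (auto simp: pairing_0)
    then have "vertex z = X (content z)" by (simp add: vertex_def)
    ultimately show ?thesis using 2 z by (simp add: c v)
  next
    case 3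
    then obtain q where "remove_block i y = Some (middle_column i q)"
      using leave_middle[OF y False i] by metis
    then show ?thesis using 3 vertex_middle[OF i] by (simp add: c v)
  qed
qed

lemma young_column_f: "young_column y \<Longrightarrow> i \<in> idx \<Longrightarrow> column_f i y = Some z \<Longrightarrow> young_column z"
  and young_column_e: "young_column y \<Longrightarrow> i \<in> idx \<Longrightarrow> column_e i y = Some z \<Longrightarrow> young_column z"
proof -
  assume y: "young_column y" "i \<in> idx"
  show "young_column z" if "column_f i y = Some z"
  proof -
    have "add_block i y = Some z" using that by (metis column_f_def option.distinct(1))
    then show ?thesis by (rule add_blockD(3)[OF y])
  qed
  show "young_column z" if "column_e i y = Some z"
  proof -
    have "remove_block i y = Some z" using that by (metis column_e_def option.distinct(1))
    then show ?thesis by (rule remove_blockD(3)[OF y])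
  qed
qed

section \<open>Equivalent columns have equal labels\<close>

lemma young_low: "young_column (col q I) \<Longrightarrow> \<exists>N. \<forall>n<N. n \<in> I"
proof -
  assume "young_column (col q I)"
  then obtain k m T A R l where "col q I = col k (ideal m T)" and r: "represents m T A R l"
    by (rule young_represented)
  then have "sh (-q) (sh q I) = sh (-q) (sh k (ideal m T))" by (simp add: col_eq_iff)
  then have "I = sh (k - q) (ideal m T)" by (simp add: sh_sh)
  then have "n \<in> I" if "n < m + 30 * (k - q)" for n using that by (simp add: mem_sh ideal_def)
  then show ?thesis by blast
qed

lemma congruent_iff:
  assumes "young_column y" "young_column z"
  shows "congruent_columns y z \<longleftrightarrow> (\<exists>I q q'. y = col q I \<and> z = col q' I)"
proof -
  have *: "congruent_columns (col q I) z \<longleftrightarrow> (\<exists>k. z = col k I)" if "young_column (col q I)" for q I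
    using young_low[OF that] congruent_col[of _ I z q] young_column_blocks[OF assms(2)] by blast
  obtain I where "y = col 0 I" by (rule young_exhaust[OF assms(1)])
  then show ?thesis using * assms(1) by metis
qed

lemma content_shift:
  assumes "young_column (col q I)"
  shows "content (col q' I) = content (col q I)"
proof -
  obtain k m T A R l where "col q I = col k (ideal m T)" and r: "represents m T A R l"
    by (rule young_represented[OF assms])
  then have "sh (-q) (sh q I) = sh (-q) (sh k (ideal m T))" by (simp add: col_eq_iff)
  then have "I = sh (k - q) (ideal m T)" by (simp add: sh_sh)
  then show ?thesis using representsD(1)[OF r] by (simp add: col_sh)
qed

lemma vertex_congruent:
  assumes y: "young_column y" and z: "young_column z" and "congruent_columns y z"
  shows "vertex y = vertex z"
proof -
  obtain I q q' where I: "y = col q I" "z = col q' I" using assms congruent_iff by blast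
  then have c: "content z = content y" using content_shift y by metis
  show ?thesis
  proof (cases "content y = 0")
    case True
    obtain j k where j: "j \<in> idx" "y = middle_column j k" by (rule zero_column[OF y True])
    then have "sh q I = sh k (middle_set (middles ! j))"
      using I(1) by (simp add: middle_column_def col_eq_iff)
    then have "sh (q' - q) (sh q I) = sh (q' - q) (sh k (middle_set (middles ! j)))" by simp
    then have "z = middle_column j (q' - q + k)"
      unfolding I(2) middle_column_def col_eq_iff sh_sh by simp
    then show ?thesis using j vertex_middle by simp
  next
    case False
    then show ?thesis using c by (simp add: vertex_def)
  qed
qed

section \<open>Roots as contents of columns\<close>

definition contents :: "root set" where
  "contents = {content y | y. young_column y \<and> content y \<noteq> 0}"

lemma contents_cases:
  assumes "\<alpha> \<in> contents"
  obtains y where "young_column y" "content y = \<alpha>" "\<alpha> \<noteq> 0"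
  using assms by (auto simp: contents_def)

lemma contentsI: "young_column y \<Longrightarrow> content y \<noteq> 0 \<Longrightarrow> content y \<in> contents"
  by (auto simp: contents_def)

lemma contents_pairing: "\<alpha> \<in> contents \<Longrightarrow> i \<in> idx \<Longrightarrow> pairing i \<alpha> \<in> {-2, -1, 0, 1, 2}"
  using pairing_bounds by (auto elim!: contents_cases)

lemma contents_down:
  assumes "\<alpha> \<in> contents" "i \<in> idx" "pairing i \<alpha> = 1"
  shows "\<alpha> - node_root i \<in> contents"
proof -
  obtain y where y: "young_column y" "content y = \<alpha>" "\<alpha> \<noteq> 0" by (rule contents_cases[OF assms(1)])
  then obtain b where "b \<in> addable i y" using one_addable[OF y(1) _ assms(2)] assms(3) by auto
  then have "young_column (insert b y)" "content (insert b y) = \<alpha> - node_root i"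
    using addable_young content_add y by auto
  moreover have "pairing i (\<alpha> - node_root i) \<noteq> 0"
    using assms pairing_self by (simp add: pairing_diff)
  then have "\<alpha> - node_root i \<noteq> 0" by (metis pairing_0)
  ultimately show ?thesis using contentsI by metis
qed

lemma contents_up:
  assumes "\<alpha> \<in> contents" "i \<in> idx" "pairing i \<alpha> = -1"
  shows "\<alpha> + node_root i \<in> contents"
proof -
  obtain y where y: "young_column y" "content y = \<alpha>" "\<alpha> \<noteq> 0" by (rule contents_cases[OF assms(1)])
  then obtain b where "b \<in> removable i y" using one_removable[OF y(1) _ assms(2)] assms(3) by auto
  then have "young_column (y - {b})" "content (y - {b}) = \<alpha> + node_root i"
    using removable_young content_remove y by auto
  moreover have "pairing i (\<alpha> + node_root i) \<noteq> 0"
    using assms pairing_self by (simp add: pairing_add)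
  then have "\<alpha> + node_root i \<noteq> 0" by (metis pairing_0)
  ultimately show ?thesis using contentsI by metis
qed

lemma node_root_contents:
  assumes i: "i \<in> idx"
  shows "node_root i \<in> contents" "- node_root i \<in> contents"
proof -
  let ?y = "middle_column i 0"
  obtain b where b: "b \<in> removable i ?y" using middle_column_props(2)[OF i] by blast
  obtain c where c: "c \<in> addable i ?y" using middle_column_props(1)[OF i] by blast
  have "content (?y - {b}) = node_root i" "content (insert c ?y) = - node_root i"
    using content_remove[OF young_middle[OF i] b] content_add[OF young_middle[OF i] c]
      content_middle[OF i] by simp_all
  then show "node_root i \<in> contents" "- node_root i \<in> contents"
    using removable_young[OF b] addable_young[OF c] node_root_nonzero[OF i]
    unfolding contents_def by (metis (mono_tags, lifting) mem_Collect_eq, metis (mono_tags, lifting)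
        mem_Collect_eq neg_equal_0_iff_equal)
qed

text \<open>One step at pairing 2 or -2 ends in a middle column, whose content is zero.\<close>

lemma contents_extreme:
  assumes "\<alpha> \<in> contents" "i \<in> idx"
  shows "pairing i \<alpha> = 2 \<Longrightarrow> \<alpha> = node_root i" "pairing i \<alpha> = -2 \<Longrightarrow> \<alpha> = - node_root i"
proof -
  obtain y where y: "young_column y" "content y = \<alpha>" "\<alpha> \<noteq> 0" by (rule contents_cases[OF assms(1)])
  show "\<alpha> = node_root i" if p: "pairing i \<alpha> = 2"
  proof -
    obtain q where "add_block i y = Some (middle_column i q)"
      using enter_middle[OF y(1) _ assms(2)] y p by metis
    from add_blockD(4)[OF y(1) assms(2) this] show ?thesis
      using y(2) content_middle[OF assms(2)] by simp
  qed
  show "\<alpha> = - node_root i" if p: "pairing i \<alpha> = -2"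
  proof -
    obtain q where "remove_block i y = Some (middle_column i q)"
      using leave_middle[OF y(1) _ assms(2)] y p by metis
    from remove_blockD(4)[OF y(1) assms(2) this] show ?thesis
      using y(2) content_middle[OF assms(2)] by (simp add: eq_neg_iff_add_eq_0)
  qed
qed

lemma zero_not_content: "0 \<notin> contents"
  by (simp add: contents_def)

text \<open>Turns the condition of \<open>arrow\<close> that two elements are roots into a pairing.
  Pairing 0 would make the difference the negative simple root, hence \<alpha> zero; pairing 2 would
  make the difference zero. Negative values would put the pairing of the difference below
  -2.\<close>

lemma contents_difference:
  assumes "\<alpha> \<in> contents" "i \<in> idx" "\<alpha> - node_root i \<in> contents"
  shows "pairing i \<alpha> = 1"
proof -
  have p: "pairing i (\<alpha> - node_root i) = pairing i \<alpha> - 2"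
    using pairing_self[OF assms(2)] by (simp add: pairing_diff)
  have "pairing i \<alpha> \<noteq> 0"
  proof
    assume "pairing i \<alpha> = 0"
    then have "\<alpha> - node_root i = - node_root i"
      using contents_extreme(2)[OF assms(3,2)] p by simp
    then show False using assms(1) zero_not_content by simp
  qed
  moreover have "pairing i \<alpha> \<noteq> 2"
    using contents_extreme(1)[OF assms(1,2)] assms(3) zero_not_content by auto
  moreover have "pairing i \<alpha> - 2 \<in> {-2, -1, 0, 1, 2}" "pairing i \<alpha> \<in> {-2, -1, 0, 1, 2}"
    using contents_pairing[OF assms(3,2)] contents_pairing[OF assms(1,2)] p by simp_all
  ultimately show ?thesis by auto
qed

lemma reflect_eq: "reflect i \<alpha> = (\<lambda>j. \<alpha> j - pairing i \<alpha> * simple_root i j)"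
  by (simp add: reflect_def pairing_def)

text \<open>At pairing 1 or -1 a simple reflection is the addition or removal of one block; at 2 or
  -2 it exchanges the simple root with its negative.\<close>

lemma roots_contents: "\<alpha> \<in> roots \<Longrightarrow> \<alpha> \<in> contents"
proof (induction rule: roots.induct)
  case (simple i)
  then show ?case using node_root_contents(1)[of i] by (simp add: node_root_def)
next
  case (reflect \<alpha> i)
  have i: "i \<in> idx" "node_root i = simple_root i" using reflect.hyps by (auto simp: node_root_def)
  consider "pairing i \<alpha> = 0" | "pairing i \<alpha> = 1" | "pairing i \<alpha> = -1" | "pairing i \<alpha> = 2"
    | "pairing i \<alpha> = -2"
    using contents_pairing[OF reflect.IH i(1)] by blast
  then show ?case
  proof cases
    case 1
    then show ?thesis using reflect.IH by (simp add: reflect_eq)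
  next
    case 2
    then have "reflect i \<alpha> = \<alpha> - node_root i" by (auto simp: reflect_eq i(2))
    then show ?thesis using contents_down[OF reflect.IH i(1) 2] by metis
  next
    case 3
    then have "reflect i \<alpha> = \<alpha> + node_root i" by (auto simp: reflect_eq i(2))
    then show ?thesis using contents_up[OF reflect.IH i(1) 3] by metis
  next
    case 4
    then have "reflect i \<alpha> = - node_root i"
      using contents_extreme(1)[OF reflect.IH i(1)] by (auto simp: reflect_eq i(2) fun_eq_iff)
    then show ?thesis using node_root_contents(2)[OF i(1)] by metis
  next
    case 5
    then have "reflect i \<alpha> = node_root i"
      using contents_extreme(2)[OF reflect.IH i(1)] by (auto simp: reflect_eq i(2) fun_eq_iff)
    then show ?thesis using node_root_contents(1)[OF i(1)] by metis
  qed
qed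

definition height :: "root \<Rightarrow> int" where
  "height \<alpha> = (\<Sum>j=1..8. \<alpha> j)"

lemma height_node: "i \<in> {1..8} \<Longrightarrow> height (\<alpha> - node_root i) = height \<alpha> - 1"
  "i \<in> {1..8} \<Longrightarrow> height (\<alpha> + node_root i) = height \<alpha> + 1"
  by (simp_all add: height_def node_root_def simple_root_def sum_subtractf sum.distrib)

text \<open>
  Every root of positive height that is not simple has a simple coroot pairing to 1 with it, so
  induction on the absolute value of the height reaches the simple roots and their negatives.
\<close>

lemma contents_induct [consumes 1, case_names simple negative lower raise]:
  assumes \<alpha>: "\<alpha> \<in> contents"
    and simple: "\<And>i. i \<in> {1..8} \<Longrightarrow> P (node_root i)"
    and negative: "\<And>i. i \<in> {1..8} \<Longrightarrow> P (- node_root i)"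
    and lower: "\<And>\<alpha> i. \<alpha> \<in> contents \<Longrightarrow> i \<in> {1..8} \<Longrightarrow> pairing i \<alpha> = 1 \<Longrightarrow>
      P (\<alpha> - node_root i) \<Longrightarrow> P \<alpha>"
    and raise: "\<And>\<alpha> i. \<alpha> \<in> contents \<Longrightarrow> i \<in> {1..8} \<Longrightarrow> pairing i \<alpha> = -1 \<Longrightarrow>
      P (\<alpha> + node_root i) \<Longrightarrow> P \<alpha>"
  shows "P \<alpha>"
  using \<alpha>
proof (induction "nat \<bar>height \<alpha>\<bar>" arbitrary: \<alpha> rule: less_induct)
  case less
  have nz: "height \<beta> \<noteq> 0" if "\<beta> \<in> contents" for \<beta>
    using contents_cases[OF that] content_height(1)[of _ 0] unfolding height_def by force
  obtain y where y: "young_column y" "content y = \<alpha>" "\<alpha> \<noteq> 0" by (rule contents_cases[OF less.prems])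
  have "content y \<noteq> 0" "(0 :: nat) \<in> idx" using y by simp_all
  note ht = content_height[OF y(1) this, unfolded y(2), folded height_def]
  show ?case
  proof (cases "0 < height \<alpha>")
    case True
    then obtain j where j: "j \<in> {1..8}" "0 < pairing j \<alpha>" using ht(2) by blast
    then have ji: "j \<in> idx" by auto
    consider "pairing j \<alpha> = 1" | "pairing j \<alpha> = 2"
      using contents_pairing[OF less.prems ji] j(2) by auto
    then show ?thesis
    proof cases
      case 1
      have c: "\<alpha> - node_root j \<in> contents" by (rule contents_down[OF less.prems ji 1])
      have "height (\<alpha> - node_root j) = height \<alpha> - 1" by (rule height_node(1)[OF j(1)])
      then have "nat \<bar>height (\<alpha> - node_root j)\<bar> < nat \<bar>height \<alpha>\<bar>" using True by simp
      then show ?thesis using lower[OF less.prems j(1) 1] less.hyps c by blast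
    next
      case 2
      then show ?thesis using contents_extreme(1)[OF less.prems ji] simple[OF j(1)] by simp
    qed
  next
    case False
    then have neg: "height \<alpha> < 0" using ht(1) by simp
    then obtain j where j: "j \<in> {1..8}" "pairing j \<alpha> < 0" using ht(3) by blast
    then have ji: "j \<in> idx" by auto
    consider "pairing j \<alpha> = -1" | "pairing j \<alpha> = -2"
      using contents_pairing[OF less.prems ji] j(2) by auto
    then show ?thesis
    proof cases
      case 1
      have c: "\<alpha> + node_root j \<in> contents" by (rule contents_up[OF less.prems ji 1])
      have "height (\<alpha> + node_root j) = height \<alpha> + 1" by (rule height_node(2)[OF j(1)])
      then have "nat \<bar>height (\<alpha> + node_root j)\<bar> < nat \<bar>height \<alpha>\<bar>" using neg by simp
      then show ?thesis using raise[OF less.prems j(1) 1] less.hyps c by blast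
    next
      case 2
      then show ?thesis using contents_extreme(2)[OF less.prems ji] negative[OF j(1)] by simp
    qed
  qed
qed

lemma contents_roots: "\<alpha> \<in> contents \<Longrightarrow> \<alpha> \<in> roots"
proof (induction rule: contents_induct)
  case (simple i)
  then show ?case using roots.simple by (simp add: node_root_def)
next
  case (negative i)
  have "pairing i (node_root i) = 2" using negative by (intro pairing_self) auto
  then have "reflect i (simple_root i) = - node_root i"
    using negative by (auto simp: reflect_eq node_root_def)
  then show ?case using roots.reflect[OF roots.simple] negative by metis
next
  case (lower \<alpha> i)
  have "i \<in> idx" using lower by auto
  then have "pairing i (\<alpha> - node_root i) = -1"
    using lower pairing_self by (simp add: pairing_diff)
  then have "reflect i (\<alpha> - node_root i) = \<alpha>"
    using lower by (auto simp: reflect_eq node_root_def)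
  then show ?case using roots.reflect[OF lower.IH] lower.hyps by metis
next
  case (raise \<alpha> i)
  have "i \<in> idx" using raise by auto
  then have "pairing i (\<alpha> + node_root i) = 1"
    using raise pairing_self by (simp add: pairing_add)
  then have "reflect i (\<alpha> + node_root i) = \<alpha>"
    using raise by (auto simp: reflect_eq node_root_def)
  then show ?case using roots.reflect[OF raise.IH] raise.hyps by metis
qed

lemma roots_eq: "roots = contents"
  using roots_contents contents_roots by blast

lemma highest_root_eq: "highest_root = theta"
proof -
  have "theta \<in> roots"
    using node_root_contents(2)[of 0] by (simp add: roots_eq node_root_def)
  moreover have le: "\<beta> j \<le> theta j" if "\<beta> \<in> roots" for \<beta> j
    using that content_le_theta[of _ 0] unfolding roots_eq contents_def by auto
  ultimately show ?thesis
    unfolding highest_root_def by (intro the_equality) (auto intro!: ext antisym)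
qed

text \<open>For a simple root or its negative, the neighbouring middle column fixes the column. In
  the inductive step, one block of colour \<open>i\<close> is added to (or removed from) both
  columns, the results agree up to a shift, and the block to be undone is unique there.\<close>

lemma same_content_congruent:
  assumes "\<alpha> \<in> contents" "young_column y" "young_column z" "content y = \<alpha>" "content z = \<alpha>"
  shows "\<exists>I q q'. y = col q I \<and> z = col q' I"
  using assms
proof (induction arbitrary: y z rule: contents_induct)
  case (simple i)
  then have i: "i \<in> idx" by auto
  have nz: "content y \<noteq> 0" "content z \<noteq> 0" "pairing i (content y) = 2" "pairing i (content z) = 2"
    using simple node_root_nonzero[OF i] pairing_self[OF i] by simp_all
  show ?case
    using enter_middle[OF simple.prems(1) nz(1) i nz(3)] enter_middle[OF simple.prems(2) nz(2) i nz(4)]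
    by metis
next
  case (negative i)
  then have i: "i \<in> idx" by auto
  have nz: "content y \<noteq> 0" "content z \<noteq> 0" "pairing i (content y) = -2" "pairing i (content z) = -2"
    unfolding negative.prems(3,4) pairing_minus pairing_self[OF i]
    using node_root_nonzero[OF i] by (metis neg_equal_0_iff_equal)+
  show ?case
    using leave_middle[OF negative.prems(1) nz(1) i nz(3)] leave_middle[OF negative.prems(2) nz(2) i nz(4)]
    by metis
next
  case (lower \<alpha> i)
  then have i: "i \<in> idx" by auto
  have nz: "content y \<noteq> 0" "content z \<noteq> 0"
    using lower.hyps(1) lower.prems zero_not_content by metis+
  obtain b where b: "addable i y = {b}"
    using one_addable[OF lower.prems(1) nz(1) i] lower by auto
  obtain c where c: "addable i z = {c}"
    using one_addable[OF lower.prems(2) nz(2) i] lower by auto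
  have y': "young_column (insert b y)" "content (insert b y) = \<alpha> - node_root i"
    using addable_young[of b i y] content_add[OF lower.prems(1), of b i] b lower.prems by auto
  have z': "young_column (insert c z)" "content (insert c z) = \<alpha> - node_root i"
    using addable_young[of c i z] content_add[OF lower.prems(2), of c i] c lower.prems by auto
  obtain I q q' where I: "insert b y = col q I" "insert c z = col q' I"
    using lower.IH[OF y'(1) z'(1) y'(2) z'(2)] by blast
  have p: "pairing i (\<alpha> - node_root i) = -1"
    using lower.hyps(3) pairing_self[OF i] by (simp add: pairing_diff)
  then have "\<alpha> - node_root i \<noteq> 0" by (metis pairing_0 zero_neq_neg_one)
  then obtain b' c' where "removable i (insert b y) = {b'}" "removable i (insert c z) = {c'}"
    using one_removable[OF y'(1) _ i] one_removable[OF z'(1) _ i] y'(2) z'(2) p by auto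
  moreover have "b \<in> removable i (insert b y)" "c \<in> removable i (insert c z)"
    using addable_removable lower.prems(1,2) b c by auto
  ultimately have r: "removable i (insert b y) = {b}" "removable i (insert c z) = {c}" by auto
  \<comment> \<open>This set depends on \<open>I\<close> only, so \<open>b\<close> and
    \<open>c\<close> are the same number \<open>n\<close> placed at the two offsets.\<close>
  define R where "R = {n \<in> rem_set I. colr n = i}"
  have R: "(\<lambda>n. blk (n + 30 * q)) ` R = {b}" "(\<lambda>n. blk (n + 30 * q')) ` R = {c}"
    using r unfolding I removable_col R_def by simp_all
  then obtain n where n: "n \<in> R" by blast
  have "blk (n + 30 * q) \<in> {b}" unfolding R(1)[symmetric] using n by (rule imageI)
  moreover have "blk (n + 30 * q') \<in> {c}" unfolding R(2)[symmetric] using n by (rule imageI)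
  ultimately have "b = blk (n + 30 * q)" "c = blk (n + 30 * q')" by simp_all
  moreover have "b \<notin> y" "c \<notin> z" using b c by (auto simp: addable_def)
  ultimately have "y = col q (I - {n})" "z = col q' (I - {n})"
    using I remove_col[of q I n] remove_col[of q' I n] by (metis Diff_insert_absorb)+
  then show ?case by blast
next
  case (raise \<alpha> i)
  then have i: "i \<in> idx" by auto
  have nz: "content y \<noteq> 0" "content z \<noteq> 0"
    using raise.hyps(1) raise.prems zero_not_content by metis+
  obtain b where b: "removable i y = {b}"
    using one_removable[OF raise.prems(1) nz(1) i] raise by auto
  obtain c where c: "removable i z = {c}"
    using one_removable[OF raise.prems(2) nz(2) i] raise by auto
  have y': "young_column (y - {b})" "content (y - {b}) = \<alpha> + node_root i"
    using removable_young[of b i y] content_remove[OF raise.prems(1), of b i] b raise.prems by auto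
  have z': "young_column (z - {c})" "content (z - {c}) = \<alpha> + node_root i"
    using removable_young[of c i z] content_remove[OF raise.prems(2), of c i] c raise.prems by auto
  obtain I q q' where I: "y - {b} = col q I" "z - {c} = col q' I"
    using raise.IH[OF y'(1) z'(1) y'(2) z'(2)] by blast
  have p: "pairing i (\<alpha> + node_root i) = 1"
    using raise.hyps(3) pairing_self[OF i] by (simp add: pairing_add)
  then have "\<alpha> + node_root i \<noteq> 0" by (metis pairing_0 zero_neq_one)
  then obtain b' c' where "addable i (y - {b}) = {b'}" "addable i (z - {c}) = {c'}"
    using one_addable[OF y'(1) _ i] one_addable[OF z'(1) _ i] y'(2) z'(2) p by auto
  moreover have "b \<in> addable i (y - {b})" "c \<in> addable i (z - {c})"
    using removable_addable raise.prems(1,2) b c by auto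
  ultimately have r: "addable i (y - {b}) = {b}" "addable i (z - {c}) = {c}" by auto
  define R where "R = {n \<in> add_set I. colr n = i}"
  have R: "(\<lambda>n. blk (n + 30 * q)) ` R = {b}" "(\<lambda>n. blk (n + 30 * q')) ` R = {c}"
    using r unfolding I addable_col R_def by simp_all
  then obtain n where n: "n \<in> R" by blast
  have "blk (n + 30 * q) \<in> {b}" unfolding R(1)[symmetric] using n by (rule imageI)
  moreover have "blk (n + 30 * q') \<in> {c}" unfolding R(2)[symmetric] using n by (rule imageI)
  ultimately have "b = blk (n + 30 * q)" "c = blk (n + 30 * q')" by simp_all
  moreover have "b \<in> y" "c \<in> z" using b c by (auto simp: removable_def)
  ultimately have "y = col q (insert n I)" "z = col q' (insert n I)"
    using I insert_col[of n q I] insert_col[of n q' I] by (metis insert_Diff)+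
  then show ?case by blast
qed

lemma vertex_eq_iff:
  assumes y: "young_column y" and z: "young_column z"
  shows "vertex y = vertex z \<longleftrightarrow> congruent_columns y z"
proof
  assume eq: "vertex y = vertex z"
  show "congruent_columns y z"
  proof (cases "content y = 0")
    case True
    obtain i q where i: "i \<in> idx" "y = middle_column i q" by (rule zero_column[OF y True])
    then have vz: "vertex z = middle_vertex i" using eq vertex_middle by simp
    then have "content z = 0" using middle_vertex_X unfolding vertex_def by metis
    obtain j q' where j: "j \<in> idx" "z = middle_column j q'"
      by (rule zero_column[OF z \<open>content z = 0\<close>])
    then have "j = i" using vz vertex_middle middle_vertex_inj by metis
    then show ?thesis unfolding congruent_iff[OF y z] using i j by (auto simp: middle_column_def)
  next
    case False
    then have "content z = content y"
      using eq middle_vertex_X unfolding vertex_def by (metis b8.inject(1))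
    moreover have "content y \<in> contents" using y False by (auto simp: contents_def)
    ultimately show ?thesis unfolding congruent_iff[OF y z]
      using same_content_congruent[OF _ y z] by blast
  qed
qed (rule vertex_congruent[OF y z])

section \<open>The crystal of roots\<close>

lemma in_carrier_B8 [simp]:
  "X \<alpha> \<in> carrier B8 \<longleftrightarrow> \<alpha> \<in> roots" "Y j \<in> carrier B8 \<longleftrightarrow> j \<in> {1..8}" "Empty \<in> carrier B8"
  by (auto simp: B8_def)

lemma middle_vertex_carrier: "i \<in> idx \<Longrightarrow> middle_vertex i \<in> carrier B8"
  by (auto simp: middle_vertex_def)

lemma carrier_cases:
  assumes "b \<in> carrier B8"
  obtains \<alpha> where "b = X \<alpha>" "\<alpha> \<in> contents" | j where "b = middle_vertex j" "j \<in> idx"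
  using assms
proof (cases b)
  case (Y j)
  then show ?thesis using assms that(2)[of j] by (auto simp: middle_vertex_def)
next
  case Empty
  then show ?thesis using that(2)[of 0] by (auto simp: middle_vertex_def)
qed (use that(1) in \<open>auto simp: roots_eq\<close>)

lemma down_iff_up:
  assumes i: "i \<in> idx"
  shows "b \<in> carrier B8 \<and> down i b = Some b' \<longleftrightarrow> b' \<in> carrier B8 \<and> up i b' = Some b"
proof
  assume b: "b \<in> carrier B8 \<and> down i b = Some b'"
  then show "b' \<in> carrier B8 \<and> up i b' = Some b"
  proof (elim conjE carrier_cases)
    fix \<alpha> assume d: "down i b = Some b'" "b = X \<alpha>" "\<alpha> \<in> contents"
    then consider "pairing i \<alpha> = 1" "b' = X (\<alpha> - node_root i)"
      | "pairing i \<alpha> = 2" "b' = middle_vertex i" by (auto split: if_splits)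
    then show ?thesis
    proof cases
      case 1
      then have "pairing i (\<alpha> - node_root i) = -1" using pairing_self[OF i] by (simp add: pairing_diff)
      then show ?thesis using 1 contents_down[OF d(3) i] d(2) by (simp add: roots_eq del: minus_apply)
    next
      case 2
      then show ?thesis
        using contents_extreme(1)[OF d(3) i] d(2) middle_vertex_carrier[OF i] by (simp add: up_middle)
    qed
  next
    fix j assume d: "down i b = Some b'" "b = middle_vertex j" "j \<in> idx"
    then have "j = i" "b' = X (- node_root i)" by (auto simp: down_middle split: if_splits)
    moreover have "pairing i (- node_root i) = -2" by (simp only: pairing_minus pairing_self[OF i])
    ultimately show ?thesis
      using d node_root_contents(2)[OF i] by (simp add: roots_eq)
  qed
next
  assume b: "b' \<in> carrier B8 \<and> up i b' = Some b"
  then show "b \<in> carrier B8 \<and> down i b = Some b'"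
  proof (elim conjE carrier_cases)
    fix \<alpha> assume d: "up i b' = Some b" "b' = X \<alpha>" "\<alpha> \<in> contents"
    then consider "pairing i \<alpha> = -1" "b = X (\<alpha> + node_root i)"
      | "pairing i \<alpha> = -2" "b = middle_vertex i" by (auto split: if_splits)
    then show ?thesis
    proof cases
      case 1
      then have "pairing i (\<alpha> + node_root i) = 1" using pairing_self[OF i] by (simp add: pairing_add)
      then show ?thesis using 1 contents_up[OF d(3) i] d(2) by (simp add: roots_eq)
    next
      case 2
      then show ?thesis
        using contents_extreme(2)[OF d(3) i] d(2) middle_vertex_carrier[OF i] by (simp add: down_middle)
    qed
  next
    fix j assume d: "up i b' = Some b" "b' = middle_vertex j" "j \<in> idx"
    then have "j = i" "b = X (node_root i)" by (auto simp: up_middle split: if_splits)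
    then show ?thesis
      using d node_root_contents(1)[OF i] pairing_self[OF i] by (simp add: roots_eq)
  qed
qed

lemma node_root_0: "node_root 0 = - theta"
  and node_root_simple: "i \<in> {1..8} \<Longrightarrow> node_root i = simple_root i"
  by (auto simp: node_root_def)

lemma arrow_iff:
  assumes i: "i \<in> idx"
  shows "arrow i b b' \<longleftrightarrow> b \<in> carrier B8 \<and> down i b = Some b'"
proof
  assume "arrow i b b'"
  then show "b \<in> carrier B8 \<and> down i b = Some b'"
  proof cases
    case (1 \<alpha>)
    then have "pairing i \<alpha> = 1"
      using contents_difference[of \<alpha> i] i by (simp add: roots_eq node_root_simple)
    then show ?thesis using 1 by (simp add: node_root_simple)
  next
    case 2
    then show ?thesis using pairing_self[OF i] roots.simple[of i] node_root_simple[of i]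
      by (simp add: middle_vertex_def)
  next
    case 3
    then show ?thesis using node_root_simple[of i] by simp
  next
    case (4 \<alpha>)
    have e: "\<alpha> - node_root 0 = \<alpha> + highest_root" by (simp add: node_root_0 highest_root_eq)
    have c: "\<alpha> \<in> contents" "\<alpha> + highest_root \<in> contents" using 4 by (simp_all add: roots_eq)
    then have "pairing 0 \<alpha> = 1" unfolding e[symmetric] using contents_difference[of \<alpha> 0] by simp
    then show ?thesis using 4 e by simp
  next
    case 5
    have "node_root 0 = - highest_root" by (simp add: node_root_0 highest_root_eq)
    then show ?thesis
      using 5 pairing_self[of 0] node_root_contents(1)[of 0] by (simp add: middle_vertex_def roots_eq)
  next
    case 6
    have "- node_root 0 = highest_root" by (simp add: node_root_0 highest_root_eq)
    then show ?thesis using 6 by simp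
  qed
next
  assume b: "b \<in> carrier B8 \<and> down i b = Some b'"
  then show "arrow i b b'"
  proof (elim conjE carrier_cases)
    fix \<alpha> assume d: "down i b = Some b'" "b = X \<alpha>" "\<alpha> \<in> contents"
    then consider "pairing i \<alpha> = 1" "b' = X (\<alpha> - node_root i)"
      | "pairing i \<alpha> = 2" "b' = middle_vertex i" by (auto split: if_splits)
    then show ?thesis
    proof cases
      case 1
      have c: "\<alpha> - node_root i \<in> contents" by (rule contents_down[OF d(3) i 1(1)])
      show ?thesis
      proof (cases "i = 0")
        case False
        then have s: "i \<in> {1..8}" using i by auto
        then show ?thesis
          using arrow.intros(1)[OF s, of \<alpha>] c d(2,3) 1(2) node_root_simple[OF s]
          by (simp add: roots_eq)
      next
        case True
        have e: "\<alpha> - node_root 0 = \<alpha> + highest_root" by (simp add: node_root_0 highest_root_eq)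
        have n: "node_root 0 = - highest_root" "- node_root 0 = highest_root"
          by (simp_all add: node_root_0 highest_root_eq)
        \<comment> \<open>The 0-arrows between roots must avoid plus and minus the highest root.
          These pair to 2 or -2 with the coroot of node 0, whereas the ends of the present arrow
          pair to 1 and -1.\<close>
        have p: "pairing 0 (node_root 0) = 2" "pairing 0 (- node_root 0) = -2"
          using pairing_self[of 0] by (simp_all only: pairing_minus) simp_all
        have "pairing 0 (\<alpha> - node_root 0) = -1" "pairing 0 \<alpha> = 1"
          using 1(1) p True by (simp_all add: pairing_diff)
        then have "\<alpha> - node_root 0 \<notin> {node_root 0, - node_root 0}"
          "\<alpha> \<notin> {node_root 0, - node_root 0}" using p by auto
        then show ?thesis
          using arrow.intros(4)[of \<alpha>] c d(2,3) 1(2) True unfolding n e by (auto simp: roots_eq e)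
      qed
    next
      case 2
      then have "\<alpha> = node_root i" using contents_extreme(1)[OF d(3) i] by simp
      then show ?thesis
        using 2 d(2) i arrow.intros(2)[of i] arrow.intros(5) node_root_simple[of i] node_root_0
          highest_root_eq by (cases "i = 0") (auto simp: middle_vertex_def)
    qed
  next
    fix j assume d: "down i b = Some b'" "b = middle_vertex j" "j \<in> idx"
    then have "j = i" "b' = X (- node_root i)" by (auto simp: down_middle split: if_splits)
    then show ?thesis
      using d i arrow.intros(3)[of i] arrow.intros(6) node_root_simple[of i] node_root_0
        highest_root_eq by (cases "i = 0") (auto simp: middle_vertex_def)
  qed
qed

lemma B8_f_down:
  assumes "i \<in> idx" "b \<in> carrier B8"
  shows "B8_f i b = down i b"
  unfolding B8_f_def arrow_iff[OF assms(1)] using assms(2) by (cases "down i b") auto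

lemma B8_e_up:
  assumes "i \<in> idx" "b \<in> carrier B8"
  shows "B8_e i b = up i b"
  unfolding B8_e_def arrow_iff[OF assms(1)] down_iff_up[OF assms(1)]
  using assms(2) by (cases "up i b") auto

section \<open>String lengths\<close>

abbreviation iterates :: "('a \<Rightarrow> 'a option) \<Rightarrow> 'a \<Rightarrow> nat set" where
  "iterates g b \<equiv> {m. ((\<lambda>x. Option.bind x g) ^^ m) (Some b) \<noteq> None}"

lemma iterate_Suc:
  "((\<lambda>x. Option.bind x g) ^^ Suc m) (Some b) = ((\<lambda>x. Option.bind x g) ^^ m) (g b)"
  by (simp only: funpow_Suc_right comp_apply bind.bind_lunit)

lemma iterate_None: "((\<lambda>x. Option.bind x g) ^^ m) None = None" for g :: "'a \<Rightarrow> 'a option"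
  by (induction m) simp_all

lemma string_length_None:
  assumes "g b = None"
  shows "string_length g b = 0"
proof -
  have "iterates g b = {0}"
  proof (intro equalityI subsetI)
    fix m assume "m \<in> iterates g b"
    then show "m \<in> {0}"
      by (cases m) (simp_all only: mem_Collect_eq iterate_Suc assms iterate_None singletonI simp_thms)
  qed simp
  then show ?thesis by (simp add: string_length_def)
qed

text \<open>Finiteness is carried along because \<open>string_length\<close> is a
  \<open>Max\<close>, which means nothing for an infinite set.\<close>

lemma string_length_Some:
  assumes "g b = Some c" and fin: "finite (iterates g c)"
  shows "string_length g b = Suc (string_length g c)"
    "finite (iterates g b)"
proof -
  let ?S = "iterates g"
  have "m \<in> ?S b \<longleftrightarrow> m \<in> insert 0 (Suc ` ?S c)" for m
  proof (cases m)
    case (Suc k)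
    have "Suc k \<in> ?S b \<longleftrightarrow> k \<in> ?S c" by (simp only: mem_Collect_eq iterate_Suc assms(1))
    then show ?thesis using Suc by (simp only:) blast
  qed simp
  then have S: "?S b = insert 0 (Suc ` ?S c)" by blast
  show "finite (?S b)" unfolding S using fin by simp
  have "0 \<in> ?S c" by simp
  then have "?S c \<noteq> {}" by blast
  then have "Max (Suc ` ?S c) = Suc (Max (?S c))"
    using fin mono_Max_commute[of Suc "?S c"] by (simp add: mono_Suc)
  moreover have "Max (?S b) = Max (Suc ` ?S c)"
    unfolding S using fin \<open>?S c \<noteq> {}\<close> by (subst Max_insert) auto
  ultimately show "string_length g b = Suc (string_length g c)"
    by (simp add: string_length_def)
qed

lemma finite_string:
  assumes "g b = None \<or> (\<exists>c. g b = Some c \<and> (g c = None \<or> (\<exists>d. g c = Some d \<and> g d = None)))"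
  shows "finite (iterates g b)"
proof -
  have 0: "finite (iterates g b)" if "g b = None" for b
  proof (rule finite_subset)
    show "iterates g b \<subseteq> {0}"
    proof
      fix m assume "m \<in> iterates g b"
      then show "m \<in> {0}"
        by (cases m) (simp_all only: mem_Collect_eq iterate_Suc that iterate_None singletonI simp_thms)
    qed
  qed simp
  from assms show ?thesis
  proof (elim disjE exE conjE)
    fix c assume c: "g b = Some c" "g c = None"
    show ?thesis by (rule string_length_Some(2)[of g, OF c(1) 0[OF c(2)]])
  next
    fix c d assume c: "g b = Some c" "g c = Some d" "g d = None"
    show ?thesis
      by (rule string_length_Some(2)[of g, OF c(1) string_length_Some(2)[of g, OF c(2) 0[OF c(3)]]])
  qed (rule 0)
qed

text \<open>Applied to pass from \<open>B8_f\<close> and \<open>B8_e\<close> to \<open>down\<close>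
  and \<open>up\<close>, from columns to vertices, and from \<open>down\<close> to \<open>up\<close>
  by negation.\<close>

lemma string_transfer:
  assumes closed: "\<And>x x'. x \<in> S \<Longrightarrow> g x = Some x' \<Longrightarrow> x' \<in> S"
    and map: "\<And>x. x \<in> S \<Longrightarrow> map_option h (g x) = g' (h x)"
    and x: "x \<in> S"
  shows "iterates g' (h x) = iterates g x"
    and "string_length g' (h x) = string_length g x"
proof -
  have "((\<lambda>x. Option.bind x g') ^^ m) (Some (h x)) \<noteq> None \<longleftrightarrow>
      ((\<lambda>x. Option.bind x g) ^^ m) (Some x) \<noteq> None" for m
    using x
  proof (induction m arbitrary: x)
    case (Suc m)
    show ?case
    proof (cases "g x")
      case None
      then have "g' (h x) = None" using map[OF Suc.prems] by simp
      then show ?thesis using None by (simp only: iterate_Suc iterate_None simp_thms)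
    next
      case (Some x')
      then have "g' (h x) = Some (h x')" using map[OF Suc.prems] by simp
      then show ?thesis
        using Some Suc.IH[OF closed[OF Suc.prems Some]] by (simp only: iterate_Suc)
    qed
  qed simp
  then show "iterates g' (h x) = iterates g x" by blast
  then show "string_length g' (h x) = string_length g x" by (simp only: string_length_def)
qed

lemma down_string:
  assumes "b \<in> carrier B8" "i \<in> idx"
  shows "finite (iterates (down i) b)"
    and "string_length (down i) b = (case b of X \<alpha> \<Rightarrow> nat (pairing i \<alpha>) | _ \<Rightarrow> if b = middle_vertex i then 1 else 0)"
proof -
  have neg: "down i (X (- node_root i)) = None"
  proof -
    have "pairing i (- node_root i) = -2" by (simp only: pairing_minus pairing_self[OF assms(2)])
    then show ?thesis by (simp only: down.simps) simp
  qed
  have mid: "string_length (down i) (middle_vertex i) = 1"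
    "down i (middle_vertex i) = Some (X (- node_root i))"
    using string_length_Some(1)[of "down i" "middle_vertex i" "X (- node_root i)"]
      string_length_None[of "down i", OF neg] finite_string[of "down i" "X (- node_root i)"] neg
    by (simp_all add: down_middle)
  have *: "finite (iterates (down i) b) \<and>
    string_length (down i) b = (case b of X \<alpha> \<Rightarrow> nat (pairing i \<alpha>) | _ \<Rightarrow> if b = middle_vertex i then 1 else 0)"
    using assms(1)
  proof (cases rule: carrier_cases)
    case (1 \<alpha>)
    consider "pairing i \<alpha> \<le> 0" | "pairing i \<alpha> = 1" | "pairing i \<alpha> = 2"
      using contents_pairing[OF 1(2) assms(2)] by force
    then show ?thesis
    proof cases
      case a: 1
      then have n: "down i b = None" using 1 by simp
      then have "string_length (down i) b = 0" by (rule string_length_None)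
      then show ?thesis using finite_string[of "down i" b] n a 1 by simp
    next
      case a: 2
      have "pairing i (\<alpha> - node_root i) = -1" using a pairing_self[OF assms(2)] by (simp add: pairing_diff)
      then have n: "down i b = Some (X (\<alpha> - node_root i))" "down i (X (\<alpha> - node_root i)) = None"
        using a 1 by simp_all
      then have "string_length (down i) (X (\<alpha> - node_root i)) = 0" by (intro string_length_None)
      then have "string_length (down i) b = 1"
        using string_length_Some(1)[of "down i", OF n(1) finite_string] n(2) by simp
      moreover have "finite (iterates (down i) b)"
        by (rule finite_string) (use n in simp)
      ultimately show ?thesis using a 1 by simp
    next
      case a: 3
      then have "down i b = Some (middle_vertex i)" using 1 by simp
      then show ?thesis
        using string_length_Some(1)[of "down i" b "middle_vertex i"] mid neg finite_string[of "down i"] a 1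
        by simp
    qed
  next
    case (2 j)
    show ?thesis
    proof (cases "i = j")
      case True
      then show ?thesis using mid neg 2 finite_string[of "down i" b]
        by (auto simp: middle_vertex_def split: b8.splits)
    next
      case False
      then have n: "down i b = None" using 2 by (simp add: down_middle)
      then have "string_length (down i) b = 0" by (rule string_length_None)
      then show ?thesis using finite_string[of "down i" b] n False 2
        by (auto simp: middle_vertex_def split: b8.splits if_splits)
    qed
  qed
  then show "finite (iterates (down i) b)"
    "string_length (down i) b = (case b of X \<alpha> \<Rightarrow> nat (pairing i \<alpha>) | _ \<Rightarrow> if b = middle_vertex i then 1 else 0)"
    by blast+
qed

text \<open>Negating the roots reverses all arrows, so the lengths of upward strings follow from
  those of downward strings.\<close>

primrec opposite :: "b8 \<Rightarrow> b8" where
  "opposite (X \<alpha>) = X (- \<alpha>)" | "opposite (Y j) = Y j" | "opposite Empty = Empty"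

lemma opposite_opposite: "opposite (opposite b) = b"
  by (cases b) simp_all

lemma minus_root: "\<alpha> \<in> roots \<Longrightarrow> - \<alpha> \<in> roots"
proof (induction rule: roots.induct)
  case (simple i)
  then have "node_root i = simple_root i" "i \<in> idx" by (auto simp: node_root_simple)
  then show ?case using node_root_contents(2)[of i] unfolding roots_eq by metis
next
  case (reflect \<alpha> i)
  have "reflect i (- \<alpha>) = - reflect i \<alpha>"
    unfolding reflect_eq pairing_minus by (simp add: fun_eq_iff)
  then show ?case using roots.reflect[OF reflect.IH reflect.hyps(2)] by metis
qed

lemma opposite_carrier: "b \<in> carrier B8 \<Longrightarrow> opposite b \<in> carrier B8"
  using minus_root by (cases b) simp_all

lemma opposite_down: "map_option opposite (down i b) = up i (opposite b)"
proof (cases b)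
  case (X \<alpha>)
  then show ?thesis by (simp add: pairing_minus middle_vertex_def)
qed simp_all

lemma up_string:
  assumes "b \<in> carrier B8" "i \<in> idx"
  shows "finite (iterates (up i) b)"
    and "string_length (up i) b =
      (case b of X \<alpha> \<Rightarrow> nat (- pairing i \<alpha>) | _ \<Rightarrow> if b = middle_vertex i then 1 else 0)"
proof -
  have t: "iterates (up i) b = iterates (down i) (opposite b)"
    "string_length (up i) b = string_length (down i) (opposite b)"
    using string_transfer[of UNIV "down i" opposite "up i" "opposite b", OF _ opposite_down]
    by (simp_all add: opposite_opposite)
  show "finite (iterates (up i) b)"
    unfolding t(1) by (rule down_string(1)[OF opposite_carrier[OF assms(1)] assms(2)])
  show "string_length (up i) b =
      (case b of X \<alpha> \<Rightarrow> nat (- pairing i \<alpha>) | _ \<Rightarrow> if b = middle_vertex i then 1 else 0)"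
    unfolding t(2) down_string(2)[OF opposite_carrier[OF assms(1)] assms(2)]
    by (cases b) (simp_all add: pairing_minus middle_vertex_def)
qed

definition weight :: "nat \<Rightarrow> b8 \<Rightarrow> int" where
  "weight i b = int (string_length (down i) b) - int (string_length (up i) b)"

lemma weight_eq:
  assumes "b \<in> carrier B8" "i \<in> idx"
  shows "weight i b = (case b of X \<alpha> \<Rightarrow> pairing i \<alpha> | _ \<Rightarrow> 0)"
  unfolding weight_def down_string(2)[OF assms] up_string(2)[OF assms] by (cases b) simp_all

lemma weight_middle: "j \<in> idx \<Longrightarrow> i \<in> idx \<Longrightarrow> weight i (middle_vertex j) = 0"
  using weight_eq[OF middle_vertex_carrier] by (simp add: middle_vertex_def)

text \<open>The weight of a vertex is the pairing with its root, or zero at the vertices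
  \<open>Y j\<close> and \<open>Empty\<close>. Each arrow subtracts \<open>node_root i\<close>, also
  when it enters or leaves such a vertex.\<close>

lemma down_step:
  assumes b: "b \<in> carrier B8" and i: "i \<in> idx" and d: "down i b = Some b'"
  shows "b' \<in> carrier B8" "up i b' = Some b"
    "string_length (down i) b = Suc (string_length (down i) b')"
    "string_length (up i) b' = Suc (string_length (up i) b)"
    "\<And>j. j \<in> idx \<Longrightarrow> weight j b' = weight j b - cartan j i"
proof -
  show b': "b' \<in> carrier B8" "up i b' = Some b" using down_iff_up[OF i] b d by blast+
  show "string_length (down i) b = Suc (string_length (down i) b')"
    by (rule string_length_Some(1)[of "down i", OF d down_string(1)[OF b'(1) i]])
  show "string_length (up i) b' = Suc (string_length (up i) b)"
    by (rule string_length_Some(1)[of "up i", OF b'(2) up_string(1)[OF b i]])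
  fix j assume j: "j \<in> idx"
  from b show "weight j b' = weight j b - cartan j i"
  proof (cases rule: carrier_cases)
    case (1 \<alpha>)
    then consider "b' = X (\<alpha> - node_root i)" | "pairing i \<alpha> = 2" "b' = middle_vertex i"
      using d by (auto split: if_splits)
    then show ?thesis
    proof cases
      case a: 1
      then show ?thesis
        using weight_eq[OF b j] weight_eq[OF b'(1) j] 1 
          by (simp add: pairing_diff pairing_node_root[OF j i])
    next
      case a: 2
      then have "\<alpha> = node_root i" using contents_extreme(1)[OF 1(2) i] by simp
      then show ?thesis using weight_eq[OF b j] weight_middle[OF i j] a 1
        by (simp add: pairing_node_root[OF j i])
    qed
  next
    case (2 k)
    then have "k = i" and x: "b' = X (- node_root i)" using d by (auto simp: down_middle split: if_splits)
    then have "weight j b = 0" using weight_middle 2 j by simp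
    moreover have "weight j b' = - cartan j i"
      using weight_eq[OF b'(1) j] pairing_minus[of j "node_root i"] pairing_node_root[OF j i]
      unfolding x by simp
    ultimately show ?thesis by simp
  qed
qed

lemma B8_string_lengths:
  assumes "b \<in> carrier B8" "i \<in> idx"
  shows "string_length (B8_f i) b = string_length (down i) b"
    "string_length (B8_e i) b = string_length (up i) b"
proof -
  have "string_length (down i) (id b) = string_length (B8_f i) b"
  proof (rule string_transfer(2)[where S = "carrier B8"])
    show "x' \<in> carrier B8" if "x \<in> carrier B8" "B8_f i x = Some x'" for x x'
      using that B8_f_down[OF assms(2)] down_step(1)[OF _ assms(2)] by metis
    show "map_option id (B8_f i x) = down i (id x)" if "x \<in> carrier B8" for x
      using that B8_f_down[OF assms(2)] by (simp add: option.map_id)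
  qed (rule assms(1))
  then show "string_length (B8_f i) b = string_length (down i) b" by simp
  have "string_length (up i) (id b) = string_length (B8_e i) b"
  proof (rule string_transfer(2)[where S = "carrier B8"])
    show "x' \<in> carrier B8" if "x \<in> carrier B8" "B8_e i x = Some x'" for x x'
      using that B8_e_up[OF assms(2)] down_iff_up[OF assms(2)] by metis
    show "map_option id (B8_e i x) = up i (id x)" if "x \<in> carrier B8" for x
      using that B8_e_up[OF assms(2)] by (simp add: option.map_id)
  qed (rule assms(1))
  then show "string_length (B8_e i) b = string_length (up i) b" by simp
qed

lemma B8_simps:
  assumes "b \<in> carrier B8"
  shows "i \<in> idx \<Longrightarrow> e_op B8 i b = up i b" "i \<in> idx \<Longrightarrow> f_op B8 i b = down i b"
    "i \<in> idx \<Longrightarrow> eps B8 i b = Fin (int (string_length (up i) b))"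
    "i \<in> idx \<Longrightarrow> phi B8 i b = Fin (int (string_length (down i) b))"
    "wt B8 b = (\<lambda>i. if i \<in> idx then weight i b else 0)"
proof -
  show "i \<in> idx \<Longrightarrow> e_op B8 i b = up i b" "i \<in> idx \<Longrightarrow> f_op B8 i b = down i b"
    "i \<in> idx \<Longrightarrow> eps B8 i b = Fin (int (string_length (up i) b))"
    "i \<in> idx \<Longrightarrow> phi B8 i b = Fin (int (string_length (down i) b))"
    using B8_e_up[OF _ assms] B8_f_down[OF _ assms] B8_string_lengths[OF assms]
    by (simp_all add: B8_def)
  have "wt B8 b i = (if i \<in> idx then weight i b else 0)" for i
    using B8_string_lengths[OF assms, of i] by (simp add: B8_def weight_def)
  then show "wt B8 b = (\<lambda>i. if i \<in> idx then weight i b else 0)" by blast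
qed

lemma wt_step:
  assumes "b \<in> carrier B8" "b' \<in> carrier B8" "\<And>j. j \<in> idx \<Longrightarrow> weight j b' = weight j b - cartan j i"
  shows "wt B8 b' = wt B8 b - alpha i" "wt B8 b = wt B8 b' + alpha i"
  unfolding B8_simps(5)[OF assms(1)] B8_simps(5)[OF assms(2)] using assms(3)
  by (auto simp: fun_eq_iff alpha_def)

lemma classical_crystal_B8: "classical_crystal B8"
  unfolding classical_crystal_def
proof (intro conjI ballI)
  fix b assume "b \<in> carrier B8"
  then show "wt B8 b \<in> weight_lattice" by (simp add: B8_simps weight_lattice_def)
next
  fix i b assume i: "i \<in> idx" and b: "b \<in> carrier B8"
  show "eps B8 i b \<noteq> Pinf" "phi B8 i b \<noteq> Pinf" using B8_simps(3,4)[OF b i] by simp_all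
  show "phi B8 i b = eps B8 i b + Fin (wt B8 b i)"
    using i by (simp add: B8_simps[OF b] weight_def)
  show "\<forall>b'. e_op B8 i b = Some b' \<longrightarrow> b' \<in> carrier B8 \<and> wt B8 b' = wt B8 b + alpha i \<and>
      eps B8 i b' = eps B8 i b - Fin 1 \<and> phi B8 i b' = phi B8 i b + Fin 1"
  proof (intro allI impI)
    fix b' assume "e_op B8 i b = Some b'"
    then have b': "b' \<in> carrier B8" "down i b' = Some b"
      using b down_iff_up[OF i, of b' b] B8_simps(1)[OF b i] by auto
    note s = down_step[OF b'(1) i b'(2)]
    show "b' \<in> carrier B8 \<and> wt B8 b' = wt B8 b + alpha i \<and>
      eps B8 i b' = eps B8 i b - Fin 1 \<and> phi B8 i b' = phi B8 i b + Fin 1"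
      using wt_step(2)[OF b'(1) b s(5)] b'(1) s(3,4) B8_simps(3,4)[OF b i] B8_simps(3,4)[OF b'(1) i]
      by simp
  qed
  show "\<forall>b'. f_op B8 i b = Some b' \<longrightarrow> b' \<in> carrier B8 \<and> wt B8 b' = wt B8 b - alpha i \<and>
      eps B8 i b' = eps B8 i b + Fin 1 \<and> phi B8 i b' = phi B8 i b - Fin 1"
  proof (intro allI impI)
    fix b' assume "f_op B8 i b = Some b'"
    then have d: "down i b = Some b'" using B8_simps(2)[OF b i] by simp
    note s = down_step[OF b i d]
    show "b' \<in> carrier B8 \<and> wt B8 b' = wt B8 b - alpha i \<and>
      eps B8 i b' = eps B8 i b + Fin 1 \<and> phi B8 i b' = phi B8 i b - Fin 1"
      using wt_step(1)[OF b s(1) s(5)] s(1,3,4) B8_simps(3,4)[OF b i] B8_simps(3,4)[OF s(1) i]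
      by simp
  qed
  show "f_op B8 i b = Some b' \<longleftrightarrow> e_op B8 i b' = Some b" if "b' \<in> carrier B8" for b'
    using down_iff_up[OF i, of b b'] b that B8_simps(2)[OF b i] B8_simps(1)[OF that i] by simp
  show "phi B8 i b = Minf \<longrightarrow> e_op B8 i b = None \<and> f_op B8 i b = None"
    using B8_simps(4)[OF b i] by simp
qed

section \<open>The isomorphism\<close>

lemma vertex_carrier: "young_column y \<Longrightarrow> vertex y \<in> carrier B8"
proof (cases "content y = 0")
  case True
  assume y: "young_column y"
  obtain i q where "i \<in> idx" "y = middle_column i q" by (rule zero_column[OF y True])
  then show ?thesis using vertex_middle middle_vertex_carrier by simp
next
  case False
  assume "young_column y"
  then show ?thesis using False contentsI by (simp add: vertex_def roots_eq)
qed

lemma vertex_surj: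
  assumes "b \<in> carrier B8"
  shows "\<exists>y. young_column y \<and> vertex y = b"
  using assms
proof (cases rule: carrier_cases)
  case (1 \<alpha>)
  then show ?thesis by (auto elim!: contents_cases simp: vertex_def)
next
  case (2 j)
  then show ?thesis using vertex_middle young_middle by blast
qed

text \<open>The isomorphism, as the map to the fibres of \<open>vertex\<close>; by
  \<open>equiv_class\<close> these are the equivalence classes of columns.\<close>

definition column_class :: "b8 \<Rightarrow> block set set" where
  "column_class b = {y. young_column y \<and> vertex y = b}"

lemma equiv_class:
  assumes "young_column y"
  shows "column_equiv `` {y} = column_class (vertex y)"
  using vertex_eq_iff[OF assms] assms by (fastforce simp: column_equiv_def column_class_def)

lemma carrier_C8: "carrier C8 = column_class ` carrier B8"
proof -
  have "Collect young_column // column_equiv = {column_class (vertex y) | y. young_column y}"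
    unfolding quotient_def using equiv_class by auto
  also have "\<dots> = column_class ` carrier B8"
    using vertex_carrier vertex_surj by blast
  finally show ?thesis by (simp add: C8_def)
qed

lemma descend_class:
  assumes "b \<in> carrier B8" "\<And>y. young_column y \<Longrightarrow> vertex y = b \<Longrightarrow> g y = v"
  shows "descend g (column_class b) = v"
proof -
  have "g ` column_class b = {v}"
    using vertex_surj[OF assms(1)] assms(2) by (auto simp: column_class_def image_iff)
  then show ?thesis by (simp add: descend_def)
qed

lemma column_string_lengths:
  assumes "young_column y" "i \<in> idx"
  shows "string_length (column_f i) y = string_length (down i) (vertex y)"
    "string_length (column_e i) y = string_length (up i) (vertex y)"
proof -
  show "string_length (column_f i) y = string_length (down i) (vertex y)"
    by (rule string_transfer(2)[of "Collect young_column", symmetric])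
      (use assms young_column_f vertex_column_f in auto)
  show "string_length (column_e i) y = string_length (up i) (vertex y)"
    by (rule string_transfer(2)[of "Collect young_column", symmetric])
      (use assms young_column_e vertex_column_e in auto)
qed

lemma crystal_iso_columns: "crystal_iso column_class B8 C8"
  unfolding crystal_iso_def
proof (intro conjI ballI)
  have "inj_on column_class (carrier B8)"
  proof (rule inj_onI)
    fix b b' assume b: "b \<in> carrier B8" and eq: "column_class b = column_class b'"
    obtain y where "y \<in> column_class b" using vertex_surj[OF b] by (auto simp: column_class_def)
    moreover from this have "y \<in> column_class b'" using eq by simp
    ultimately show "b = b'" by (simp add: column_class_def)
  qed
  then show "bij_betw column_class (carrier B8) (carrier C8)"
    by (simp add: bij_betw_def carrier_C8)
next
  fix b assume b: "b \<in> carrier B8"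
  show "wt C8 (column_class b) = wt B8 b"
    unfolding C8_def crystal.simps
    by (rule descend_class[OF b])
      (auto simp: fun_eq_iff B8_simps(5)[OF b] column_string_lengths weight_def)
next
  fix i b assume i: "i \<in> idx" and b: "b \<in> carrier B8"
  show "eps C8 i (column_class b) = eps B8 i b" "phi C8 i (column_class b) = phi B8 i b"
    unfolding C8_def crystal.simps B8_simps(3,4)[OF b i]
    by (rule descend_class[OF b]; simp add: column_string_lengths[OF _ i])+
  show "e_op C8 i (column_class b) = map_option column_class (e_op B8 i b)"
    unfolding C8_def crystal.simps C8_op_def B8_simps(1)[OF b i]
  proof (rule descend_class[OF b])
    fix y assume y: "young_column y" "vertex y = b"
    have "map_option (\<lambda>z. column_equiv `` {z}) (column_e i y) =
        map_option column_class (map_option vertex (column_e i y))"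
      using young_column_e[OF y(1) i] equiv_class by (cases "column_e i y") simp_all
    then show "map_option (\<lambda>z. column_equiv `` {z}) (column_e i y) = map_option column_class (up i b)"
      using vertex_column_e[OF y(1) i] y(2) by simp
  qed
  show "f_op C8 i (column_class b) = map_option column_class (f_op B8 i b)"
    unfolding C8_def crystal.simps C8_op_def B8_simps(2)[OF b i]
  proof (rule descend_class[OF b])
    fix y assume y: "young_column y" "vertex y = b"
    have "map_option (\<lambda>z. column_equiv `` {z}) (column_f i y) =
        map_option column_class (map_option vertex (column_f i y))"
      using young_column_f[OF y(1) i] equiv_class by (cases "column_f i y") simp_all
    then show "map_option (\<lambda>z. column_equiv `` {z}) (column_f i y) = map_option column_class (down i b)"
      using vertex_column_f[OF y(1) i] y(2) by simp
  qed
qed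

text \<open>Transport of structure: the axioms for \<open>C8\<close> then require no further
  analysis of columns.\<close>

lemma crystal_iso_classical:
  assumes B: "classical_crystal B" and iso: "crystal_iso \<psi> B C"
  shows "classical_crystal C"
proof -
  have C: "carrier C = \<psi> ` carrier B" and inj: "inj_on \<psi> (carrier B)"
    using iso by (simp_all add: crystal_iso_def bij_betw_def)
  have wt: "wt C (\<psi> b) = wt B b" if "b \<in> carrier B" for b
    using iso that by (simp add: crystal_iso_def)
  have eq: "eps C i (\<psi> b) = eps B i b" "phi C i (\<psi> b) = phi B i b"
    "e_op C i (\<psi> b) = map_option \<psi> (e_op B i b)" "f_op C i (\<psi> b) = map_option \<psi> (f_op B i b)"
    if "b \<in> carrier B" "i \<in> idx" for b i
    using iso that unfolding crystal_iso_def by blast+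
  note ax = B[unfolded classical_crystal_def]
  show ?thesis
    unfolding classical_crystal_def C
  proof (intro conjI ballI)
    fix c assume "c \<in> \<psi> ` carrier B"
    then show "wt C c \<in> weight_lattice" using wt ax by auto
  next
    fix i c assume i: "i \<in> idx" and "c \<in> \<psi> ` carrier B"
    then obtain b where b: "b \<in> carrier B" "c = \<psi> b" by blast
    note ab = bspec[OF bspec[OF conjunct2[OF ax] i] b(1)]
    show "eps C i c \<noteq> Pinf" "phi C i c \<noteq> Pinf" "phi C i c = eps C i c + Fin (wt C c i)"
      "phi C i c = Minf \<longrightarrow> e_op C i c = None \<and> f_op C i c = None"
      unfolding b(2) eq[OF b(1) i] wt[OF b(1)] option.map_disc_iff using ab by blast+
    have e: "b' \<in> carrier B \<and> wt B b' = wt B b + alpha i \<and> eps B i b' = eps B i b - Fin 1 \<and>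
        phi B i b' = phi B i b + Fin 1" if "e_op B i b = Some b'" for b' using ab that by blast
    have f: "b' \<in> carrier B \<and> wt B b' = wt B b - alpha i \<and> eps B i b' = eps B i b + Fin 1 \<and>
        phi B i b' = phi B i b - Fin 1" if "f_op B i b = Some b'" for b' using ab that by blast
    show "\<forall>c'. e_op C i c = Some c' \<longrightarrow> c' \<in> \<psi> ` carrier B \<and> wt C c' = wt C c + alpha i \<and>
        eps C i c' = eps C i c - Fin 1 \<and> phi C i c' = phi C i c + Fin 1"
    proof (intro allI impI)
      fix c' assume "e_op C i c = Some c'"
      then obtain b' where b': "e_op B i b = Some b'" "c' = \<psi> b'"
        unfolding b(2) eq[OF b(1) i] by auto
      note e = e[OF b'(1)]
      then show "c' \<in> \<psi> ` carrier B \<and> wt C c' = wt C c + alpha i \<and>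
          eps C i c' = eps C i c - Fin 1 \<and> phi C i c' = phi C i c + Fin 1"
        unfolding b(2) b'(2) eq[OF b(1) i] wt[OF b(1)]
        using e eq(1,2)[OF conjunct1[OF e] i] wt[OF conjunct1[OF e]] by simp
    qed
    show "\<forall>c'. f_op C i c = Some c' \<longrightarrow> c' \<in> \<psi> ` carrier B \<and> wt C c' = wt C c - alpha i \<and>
        eps C i c' = eps C i c + Fin 1 \<and> phi C i c' = phi C i c - Fin 1"
    proof (intro allI impI)
      fix c' assume "f_op C i c = Some c'"
      then obtain b' where b': "f_op B i b = Some b'" "c' = \<psi> b'"
        unfolding b(2) eq[OF b(1) i] by auto
      note f = f[OF b'(1)]
      then show "c' \<in> \<psi> ` carrier B \<and> wt C c' = wt C c - alpha i \<and>
          eps C i c' = eps C i c + Fin 1 \<and> phi C i c' = phi C i c - Fin 1"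
        unfolding b(2) b'(2) eq[OF b(1) i] wt[OF b(1)]
        using f eq(1,2)[OF conjunct1[OF f] i] wt[OF conjunct1[OF f]] by simp
    qed
    fix c' assume "c' \<in> \<psi> ` carrier B"
    then obtain b' where b': "b' \<in> carrier B" "c' = \<psi> b'" by blast
    \<comment> \<open>The map is injective on the carrier only, so cancelling it requires the
      operators to stay inside the carrier.\<close>
    have op: "map_option \<psi> r = Some (\<psi> d) \<longleftrightarrow> r = Some d"
      if "d \<in> carrier B" "\<And>x. r = Some x \<Longrightarrow> x \<in> carrier B" for r d
      using that inj by (cases r) (auto dest: inj_onD)
    have "f_op B i b = Some b' \<longleftrightarrow> e_op B i b' = Some b" using ab b'(1) by blast
    moreover have "map_option \<psi> (f_op B i b) = Some (\<psi> b') \<longleftrightarrow> f_op B i b = Some b'"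
      by (rule op[OF b'(1) conjunct1[OF f]])
    moreover have "x \<in> carrier B" if "e_op B i b' = Some x" for x
      using bspec[OF bspec[OF conjunct2[OF ax] i] b'(1)] that by blast
    from op[OF b(1) this] have "map_option \<psi> (e_op B i b') = Some (\<psi> b) \<longleftrightarrow> e_op B i b' = Some b" .
    ultimately show "f_op C i c = Some c' \<longleftrightarrow> e_op C i c' = Some c"
      unfolding b(2) b'(2) eq[OF b(1) i] eq[OF b'(1) i] by blast
  qed
qed

theorem proposition3p17:
  shows "classical_crystal B8 \<and> classical_crystal C8 \<and> (\<exists>\<psi>. crystal_iso \<psi> B8 C8)"
  using classical_crystal_B8 crystal_iso_columns crystal_iso_classical by blast

end
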